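(* Consider the separable constraint-coupled problem $$\min_{\mathrm{x}}\ \sum_{i=1}^N f_i^0(x_i,\theta_i)\quad\text{s.t. } x_i\in\mathcal{C}_i(\theta_i)\ (i=1,\dots,N),\quad \sum_{i=1}^N H_i(x_i,\theta_c)=0,\quad \sum_{i=1}^N F_i(x_i,\theta_c)\le 0,$$ with optimal solution $(\mathrm{x}^\star,\nu^\star,\lambda^\star)$ at parameter value $\theta^0$ (together with the multipliers of the local constraints). Assume the problem is strictly convex and: (A1) all functions defining it are twice continuously differentiable in $\mathrm{x}$ and $\theta$ in a neighborhood of $\mathrm{x}^\star(\theta^0)$; (A2) the solution satisfies the first order KKT conditions; (A4) the gradients of the binding constraints (local and coupling) are linearly independent; (A5) the dual variable of every binding inequality constraint (local and coupling) is strictly positive. Let $\omega\ge 0$ be an integer, let $\{\mathcal{V}_k^\omega\}_{k\in\mathcal{V}_p}$ be the constraint sets, $\partial C\,y=q$ the coupling system with solution $y^\star$, and let $(y^{(t)})_{t\ge0}$ be generated from an arbitrary $y^{(0)}$ by $$y^{(t+1)}=\Gamma\,(S^\omega y^{(t)}+U^\omega q)$$ (all as defined in the context). Then for all $t\ge 0$ $$\|y^{(t)}-y^\star\|_\infty\le\alpha^t\,\|y^{(0)}-y^\star\|_\infty,$$ where the convergence rate $\alpha$ is defined by $$\alpha:=\max_{k\in\mathcal{V}_p}\frac{R_k\bar\sigma_k}{\underline\sigma_k^2}\left(\frac{\bar\sigma_k^2-\underline\sigma_k^2}{\bar\sigma_k^2+\underline\sigma_k^2}\right)^{\left\lceil\frac{\omega}{2B_{\partial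 C_k^\omega}}-1\right\rceil_+},$$ with $\bar\sigma_k$ and $\underline\sigma_k$ the largest and smallest singular values of $\partial C_k^\omega$, $R_k:=\sum_{i\in\mathcal{V}_k^\omega,\ j\in\mathcal{V}_c\setminus\mathcal{V}_k^\omega}|(\partial C_{-k}^\omega)_{i,j}|$, and $B_{\partial C_k^\omega}$ the bandwidth of $\partial C_k^\omega$ induced by the bipartite graph $\mathcal{G}_b$.
   Context: Setting. $x_i\in\mathbb{R}^{n_i}$, $\mathrm{x}=(x_1,\dots,x_N)$, $\theta=(\theta_1,\dots,\theta_N,\theta_c)$, the local problems are convex: $f_i^0(\cdot,\theta_i)$ is convex and $\mathcal{C}_i(\theta_i)$ is a convex set described by local constraints $g_i^{\rm loc}(x_i,\theta_i)\le 0$, $h_i^{\rm loc}(x_i,\theta_i)=0$. $H_i$ takes values in $\mathbb{R}^{\Lambda_H}$, $F_i$ in $\mathbb{R}^{\Lambda_F}$, $\Lambda=\Lambda_H+\Lambda_F$. The dual variables of the coupling equality and inequality constraints are $\nu\in\mathbb{R}^{\Lambda_H}$ and $\lambda\in\mathbb{R}^{\Lambda_F}$. Local Jacobians. Subproblem $i$ is $\min_{x_i\in\mathcal{C}_i(\theta_i)} f_i^0(x_i,\theta_i)+\nu^TH_i(x_i,\theta_c)+\lambda^TF_i(x_i,\theta_c)$ with $\nu,\lambda$ treated as parameters and $\bar\theta_i=(\theta_i,\theta_c,\nu,\lambda)$, evaluated at $\nu^\star,\lambda^\star$. With $\pi_i,\mu_i$ the multipliers of its local equality and inequality constraints, $z_i=(x_i,\pi_i,\mu_i)$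 and $L_i=f_i^0+\nu^TH_i+\lambda^TF_i+\pi_i^Th_i^{\rm loc}+\mu_i^Tg_i^{\rm loc}$, let $G_i=(\nabla_{x_i}L_i,\ h_i^{\rm loc},\ \mathrm{diag}(\mu_i)g_i^{\rm loc})$. The local Jacobian is $\partial_{\bar\theta_i}x_i^\star=-[I_{n_i}\ 0](\partial_{z_i}G_i)^{-1}\partial_{\bar\theta_i}G_i$. Coupling system. With $$C(\mathrm{x},\lambda,\theta_c)=\begin{bmatrix}\sum_iH_i(x_i,\theta_c)\\ \mathrm{diag}(\lambda)\sum_iF_i(x_i,\theta_c)\end{bmatrix},$$ $$\partial C=-\begin{bmatrix}\partial_{\mathrm{x}}C\,\partial_\nu\mathrm{x} & \partial_{\mathrm{x}}C\,\partial_\lambda\mathrm{x}+\partial_\lambda C\end{bmatrix},\qquad q=\partial_{\mathrm{x}}C\,\partial_\theta\mathrm{x}+\partial_\theta C,$$ evaluated at the solution, where $\partial_\nu\mathrm{x},\partial_\lambda\mathrm{x},\partial_\theta\mathrm{x}$ stack the blocks of the local Jacobians (with $\partial_{\theta_j}x_i^\star=0$ for $j\ne i$). The rows and columns of $\partial C\in\mathbb{R}^{\Lambda\times\Lambda}$ are indexed by the coupling constraints. The coupling system is $\partial C\,y=q$. Graph and projections. $\mathcal{G}_b$ is the bipartite graph with node set $\mathcal{V}_p\cup\mathcal{V}_c$, where $\mathcal{V}_p$ is the set of $N$ subproblems and $\mathcal{V}_c$ the set of $\Lambda$ coupling constraints; $(k,j)$ is an edge iff subproblem $k$ is directly involved in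 constraint $j$ (the corresponding component of $H_k$ or $F_k$ depends on $x_k$). $d_{\mathcal{G}_b}$ is graph distance, and $\mathcal{V}_k^\omega=\{c\in\mathcal{V}_c: d_{\mathcal{G}_b}(c,k)\le 2\omega+1\}$. With $e_i$ the canonical basis vectors of $\mathbb{R}^\Lambda$, $T_k$, $T_k^\omega$, $T_{-k}^\omega$ are the matrices with columns $e_i$ for $i\in\mathcal{V}_k^0$, $i\in\mathcal{V}_k^\omega$, $i\in\mathcal{V}_c\setminus\mathcal{V}_k^\omega$ respectively. Set $$\partial C_k^\omega=(T_k^\omega)^T\partial C\,T_k^\omega,\qquad \partial C_{-k}^\omega=(T_k^\omega)^T\partial C\,T_{-k}^\omega,$$ $$S_k^\omega=-(T_k)^TT_k^\omega(\partial C_k^\omega)^{-1}\partial C_{-k}^\omega(T_{-k}^\omega)^T,\qquad U_k^\omega=(T_k)^TT_k^\omega(\partial C_k^\omega)^{-1}(T_k^\omega)^T,$$ and let $S^\omega,U^\omega$ be the vertical stackings of $S_1^\omega,\dots,S_N^\omega$ and $U_1^\omega,\dots,U_N^\omega$. Aggregation. The rows of $S^\omega$ are indexed by pairs (subproblem $k$, constraint $l\in\mathcal{V}_k^0$); for row index $j$ let $m(j)=l$ be the corresponding constraint. $\Gamma$ has $\Lambda$ rows and $\sum_k|\mathcal{V}_k^0|$ columns with $\Gamma_{i,j}=1/\delta_i$ if $i=m(j)$ and $0$ otherwise, where $\delta_i$ is the degree of constraint $i$ in $\mathcal{G}_b$ (averaging over all subproblems involved in constraint $i$). Bandwidth. The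 bandwidth $B_A$ of a matrix $A$ with rows and columns indexed by constraints in $\mathcal{V}_c$, induced by $\mathcal{G}_b$, is the smallest nonnegative integer $B$ such that $A_{i,j}=0$ whenever $d_{\mathcal{G}_b}(i,j)>B$. Also $\lceil a\rceil_+=\max(0,\lceil a\rceil)$. $\|\cdot\|_\infty$ is the vector $\infty$-norm, or the induced matrix norm (maximum absolute row sum) when $y$ has several columns.
   Formalization: It is additionally assumed that every matrix ∂_{z_i}G_i is invertible, so that the local Jacobians exist; strict convexity with (A1), (A2), (A4), (A5) does not ensure this (f = x⁴, coupling x − θ = 0 at θ = 0). *)

theory Defs
  imports "HOL-Analysis.Analysis" "HOL-Library.Extended_Nat"
begin

section \<open>Separable constraint-coupled problems\<close>

text \<open>
  Blocks of varying size (\<open>n\<^sub>i\<close>, the number of local constraints of subproblem \<open>i\<close>, the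
  dimensions of \<open>\<theta>\<^sub>i\<close>, \<open>\<theta>\<^sub>c\<close>, \<open>\<Lambda>\<^sub>H\<close> and \<open>\<Lambda>\<^sub>F\<close>) are encoded by index types with ownership maps:
  \<open>'p\<close> indexes subproblems, \<open>'x\<close> all primal coordinates, \<open>'l\<close> all local constraints,
  \<open>'c\<close> all coupling constraints and \<open>'q\<close> all parameter coordinates.
  The subvector \<open>x\<^sub>i\<close> consists of the coordinates \<open>a\<close> with \<open>xown a = i\<close>; \<open>\<theta>\<^sub>i\<close> of those \<open>b\<close> with
  \<open>pown b = Some i\<close>, and \<open>\<theta>\<^sub>c\<close> of those with \<open>pown b = None\<close>.
  Elements of \<open>'l\<close> outside \<open>leqs \<union> lineqs\<close> are not used, so there may be no local constraints.
  \<open>fcpl P i c\<close> is the component of \<open>H\<^sub>i\<close> (if \<open>c \<in> ceqs\<close>) or of \<open>F\<^sub>i\<close> (otherwise) belonging to the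
  coupling constraint \<open>c\<close>; accordingly one vector \<open>d :: real ^ 'c\<close> holds \<open>\<nu>\<close> and \<open>\<lambda>\<close>, and one vector
  \<open>m :: real ^ 'l\<close> holds all \<open>\<pi>\<^sub>i\<close> and \<open>\<mu>\<^sub>i\<close>.
\<close>

record ('p, 'x, 'l, 'c, 'q) sep_problem =
  xown :: "'x \<Rightarrow> 'p"
  pown :: "'q \<Rightarrow> 'p option"
  lown :: "'l \<Rightarrow> 'p"
  leqs :: "'l set"
  lineqs :: "'l set"
  ceqs :: "'c set"
  fobj :: "'p \<Rightarrow> real ^ 'x \<Rightarrow> real ^ 'q \<Rightarrow> real"
  floc :: "'l \<Rightarrow> real ^ 'x \<Rightarrow> real ^ 'q \<Rightarrow> real"
  fcpl :: "'p \<Rightarrow> 'c \<Rightarrow> real ^ 'x \<Rightarrow> real ^ 'q \<Rightarrow> real"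

definition same_x ::
  "('p, 'x::finite, 'l, 'c, 'q::finite) sep_problem \<Rightarrow> 'p \<Rightarrow> real ^ 'x \<Rightarrow> real ^ 'x \<Rightarrow> bool" where
  "same_x P i x x' \<longleftrightarrow> (\<forall>a. xown P a = i \<longrightarrow> x $ a = x' $ a)"

definition same_par ::
  "('p, 'x::finite, 'l, 'c, 'q::finite) sep_problem \<Rightarrow> 'p option \<Rightarrow> real ^ 'q \<Rightarrow> real ^ 'q \<Rightarrow> bool" where
  "same_par P s \<theta> \<theta>' \<longleftrightarrow> (\<forall>b. pown P b = s \<longrightarrow> \<theta> $ b = \<theta>' $ b)"

text \<open>
  \<open>f\<^sub>i\<^sup>0\<close>, \<open>g\<^sub>i\<close>, \<open>h\<^sub>i\<close> are functions of \<open>(x\<^sub>i, \<theta>\<^sub>i)\<close> only, and \<open>H\<^sub>i\<close>, \<open>F\<^sub>i\<close> of \<open>(x\<^sub>i, \<theta>\<^sub>c)\<close> only.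
\<close>

definition separable ::
  "('p, 'x::finite, 'l, 'c, 'q::finite) sep_problem \<Rightarrow> bool" where
  "separable P \<longleftrightarrow>
     leqs P \<inter> lineqs P = {} \<and>
     (\<forall>i x x' \<theta> \<theta>'. same_x P i x x' \<and> same_par P (Some i) \<theta> \<theta>' \<longrightarrow>
        fobj P i x \<theta> = fobj P i x' \<theta>') \<and>
     (\<forall>l \<in> leqs P \<union> lineqs P. \<forall>x x' \<theta> \<theta>'.
        same_x P (lown P l) x x' \<and> same_par P (Some (lown P l)) \<theta> \<theta>' \<longrightarrow>
        floc P l x \<theta> = floc P l x' \<theta>') \<and>
     (\<forall>i c x x' \<theta> \<theta>'. same_x P i x x' \<and> same_par P None \<theta> \<theta>' \<longrightarrow>
        fcpl P i c x \<theta> = fcpl P i c x' \<theta>')"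

definition total_obj ::
  "('p::finite, 'x::finite, 'l, 'c, 'q::finite) sep_problem \<Rightarrow> real ^ 'x \<Rightarrow> real ^ 'q \<Rightarrow> real" where
  "total_obj P x \<theta> = (\<Sum>i\<in>UNIV. fobj P i x \<theta>)"

definition total_cpl ::
  "('p::finite, 'x::finite, 'l, 'c, 'q::finite) sep_problem \<Rightarrow> 'c \<Rightarrow> real ^ 'x \<Rightarrow> real ^ 'q \<Rightarrow> real" where
  "total_cpl P c x \<theta> = (\<Sum>i\<in>UNIV. fcpl P i c x \<theta>)"

text \<open>The set \<open>\<C>\<^sub>i(\<theta>\<^sub>i)\<close>, as a cylinder over the block \<open>x\<^sub>i\<close>.\<close>

definition local_set ::
  "('p, 'x::finite, 'l, 'c, 'q::finite) sep_problem \<Rightarrow> 'p \<Rightarrow> real ^ 'q \<Rightarrow> (real ^ 'x) set" where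
  "local_set P i \<theta> = {x. (\<forall>l \<in> leqs P. lown P l = i \<longrightarrow> floc P l x \<theta> = 0) \<and>
                         (\<forall>l \<in> lineqs P. lown P l = i \<longrightarrow> floc P l x \<theta> \<le> 0)}"

definition feasible ::
  "('p::finite, 'x::finite, 'l, 'c, 'q::finite) sep_problem \<Rightarrow> real ^ 'q \<Rightarrow> real ^ 'x \<Rightarrow> bool" where
  "feasible P \<theta> x \<longleftrightarrow> (\<forall>i. x \<in> local_set P i \<theta>) \<and>
     (\<forall>c \<in> ceqs P. total_cpl P c x \<theta> = 0) \<and> (\<forall>c \<in> - ceqs P. total_cpl P c x \<theta> \<le> 0)"

definition optimal ::
  "('p::finite, 'x::finite, 'l, 'c, 'q::finite) sep_problem \<Rightarrow> real ^ 'q \<Rightarrow> real ^ 'x \<Rightarrow> bool" where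
  "optimal P \<theta> x \<longleftrightarrow> feasible P \<theta> x \<and>
     (\<forall>x'. feasible P \<theta> x' \<longrightarrow> total_obj P x \<theta> \<le> total_obj P x' \<theta>)"

definition strictly_convex :: "('a::real_vector \<Rightarrow> real) \<Rightarrow> bool" where
  "strictly_convex f \<longleftrightarrow> (\<forall>x y t. x \<noteq> y \<and> 0 < t \<and> t < 1 \<longrightarrow>
     f ((1 - t) *\<^sub>R x + t *\<^sub>R y) < (1 - t) * f x + t * f y)"

text \<open>
  Convexity in \<open>x\<close> at the parameter value \<open>\<theta>\<close>. The sets \<open>\<C>\<^sub>i\<close> are only required to be convex as
  sets; the functions describing them need not be convex or affine.
\<close>

definition strictly_convex_problem ::
  "('p::finite, 'x::finite, 'l, 'c, 'q::finite) sep_problem \<Rightarrow> real ^ 'q \<Rightarrow> bool" where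
  "strictly_convex_problem P \<theta> \<longleftrightarrow>
     (\<forall>i. convex_on UNIV (\<lambda>x. fobj P i x \<theta>)) \<and>
     strictly_convex (\<lambda>x. total_obj P x \<theta>) \<and>
     (\<forall>i. convex (local_set P i \<theta>)) \<and>
     (\<forall>i. \<forall>c \<in> ceqs P. \<exists>a b. \<forall>x. fcpl P i c x \<theta> = a \<bullet> x + b) \<and>
     (\<forall>i. \<forall>c \<in> - ceqs P. convex_on UNIV (\<lambda>x. fcpl P i c x \<theta>))"


section \<open>Regularity assumptions\<close>

definition C2_on :: "('a::real_normed_vector) set \<Rightarrow> ('a \<Rightarrow> real) \<Rightarrow> bool" where
  "C2_on U f \<longleftrightarrow> (\<exists>(f' :: 'a \<Rightarrow> 'a \<Rightarrow>\<^sub>L real) (f'' :: 'a \<Rightarrow> 'a \<Rightarrow>\<^sub>L 'a \<Rightarrow>\<^sub>L real).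
     (\<forall>z \<in> U. (f has_derivative blinfun_apply (f' z)) (at z) \<and>
              (f' has_derivative blinfun_apply (f'' z)) (at z)) \<and>
     continuous_on U f'')"

definition C2_problem ::
  "('p, 'x::finite, 'l, 'c, 'q::finite) sep_problem \<Rightarrow> real ^ 'x \<Rightarrow> real ^ 'q \<Rightarrow> bool" where
  "C2_problem P x \<theta> \<longleftrightarrow> (\<exists>U. open U \<and> (x, \<theta>) \<in> U \<and>
     (\<forall>i. C2_on U (\<lambda>(x, \<theta>). fobj P i x \<theta>)) \<and>
     (\<forall>l \<in> leqs P \<union> lineqs P. C2_on U (\<lambda>(x, \<theta>). floc P l x \<theta>)) \<and>
     (\<forall>i c. C2_on U (\<lambda>(x, \<theta>). fcpl P i c x \<theta>)))"

definition grad :: "(real ^ 'n::finite \<Rightarrow> real) \<Rightarrow> real ^ 'n \<Rightarrow> real ^ 'n" where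
  "grad f x = (\<chi> j. frechet_derivative f (at x) (axis j 1))"

text \<open>The Lagrangian \<open>L\<^sub>i\<close> of subproblem \<open>i\<close>.\<close>

definition lagr ::
  "('p, 'x::finite, 'l::finite, 'c::finite, 'q::finite) sep_problem \<Rightarrow> 'p \<Rightarrow>
     real ^ 'x \<Rightarrow> real ^ 'l \<Rightarrow> real ^ 'c \<Rightarrow> real ^ 'q \<Rightarrow> real" where
  "lagr P i x m d \<theta> = fobj P i x \<theta> + (\<Sum>c\<in>UNIV. d $ c * fcpl P i c x \<theta>) +
     (\<Sum>l | l \<in> leqs P \<union> lineqs P \<and> lown P l = i. m $ l * floc P l x \<theta>)"

definition KKT ::
  "('p::finite, 'x::finite, 'l::finite, 'c::finite, 'q::finite) sep_problem \<Rightarrow>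
     real ^ 'q \<Rightarrow> real ^ 'x \<Rightarrow> real ^ 'l \<Rightarrow> real ^ 'c \<Rightarrow> bool" where
  "KKT P \<theta> x m d \<longleftrightarrow>
     grad (\<lambda>x. \<Sum>i\<in>UNIV. lagr P i x m d \<theta>) x = 0 \<and>
     feasible P \<theta> x \<and>
     (\<forall>l \<in> lineqs P. m $ l \<ge> 0) \<and> (\<forall>c \<in> - ceqs P. d $ c \<ge> 0) \<and>
     (\<forall>l \<in> lineqs P. m $ l * floc P l x \<theta> = 0) \<and>
     (\<forall>c \<in> - ceqs P. d $ c * total_cpl P c x \<theta> = 0)"

definition binding ::
  "('p::finite, 'x::finite, 'l, 'c, 'q::finite) sep_problem \<Rightarrow> real ^ 'q \<Rightarrow> real ^ 'x \<Rightarrow> ('l + 'c) set" where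
  "binding P \<theta> x =
     Inl ` (leqs P \<union> {l \<in> lineqs P. floc P l x \<theta> = 0}) \<union>
     Inr ` (ceqs P \<union> {c \<in> - ceqs P. total_cpl P c x \<theta> = 0})"

definition constraint_grad ::
  "('p::finite, 'x::finite, 'l, 'c, 'q::finite) sep_problem \<Rightarrow> real ^ 'q \<Rightarrow> real ^ 'x \<Rightarrow> 'l + 'c \<Rightarrow> real ^ 'x" where
  "constraint_grad P \<theta> x r = (case r of
     Inl l \<Rightarrow> grad (\<lambda>x. floc P l x \<theta>) x | Inr c \<Rightarrow> grad (\<lambda>x. total_cpl P c x \<theta>) x)"

text \<open>Injectivity makes this linear independence of the family, not only of its range.\<close>

definition LICQ ::
  "('p::finite, 'x::finite, 'l, 'c, 'q::finite) sep_problem \<Rightarrow> real ^ 'q \<Rightarrow> real ^ 'x \<Rightarrow> bool" where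
  "LICQ P \<theta> x \<longleftrightarrow> inj_on (constraint_grad P \<theta> x) (binding P \<theta> x) \<and>
     independent (constraint_grad P \<theta> x ` binding P \<theta> x)"

definition strict_complementarity ::
  "('p::finite, 'x::finite, 'l::finite, 'c::finite, 'q::finite) sep_problem \<Rightarrow>
     real ^ 'q \<Rightarrow> real ^ 'x \<Rightarrow> real ^ 'l \<Rightarrow> real ^ 'c \<Rightarrow> bool" where
  "strict_complementarity P \<theta> x m d \<longleftrightarrow>
     (\<forall>l \<in> lineqs P. floc P l x \<theta> = 0 \<longrightarrow> m $ l > 0) \<and>
     (\<forall>c \<in> - ceqs P. total_cpl P c x \<theta> = 0 \<longrightarrow> d $ c > 0)"


section \<open>Matrices indexed by subsets of a type\<close>

text \<open>
  A matrix with rows in \<open>I\<close> and columns in \<open>J\<close> is represented by the matrix over the full index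
  types that is zero outside \<open>I \<times> J\<close>; products and transposes are then the usual ones, while
  inverses and singular values have to be taken relative to the index set.
\<close>

definition id_on :: "'n set \<Rightarrow> real ^ 'n::finite ^ 'n" where
  "id_on I = (\<chi> i j. if i = j \<and> j \<in> I then 1 else 0)"

definition is_inverse_on :: "'n set \<Rightarrow> real ^ 'n::finite ^ 'n \<Rightarrow> real ^ 'n ^ 'n \<Rightarrow> bool" where
  "is_inverse_on I A B \<longleftrightarrow> (\<forall>i j. i \<notin> I \<or> j \<notin> I \<longrightarrow> B $ i $ j = 0) \<and>
     A ** B = id_on I \<and> B ** A = id_on I"

definition invertible_on :: "'n set \<Rightarrow> real ^ 'n::finite ^ 'n \<Rightarrow> bool" where
  "invertible_on I A \<longleftrightarrow> (\<exists>B. is_inverse_on I A B)"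

definition inverse_on :: "'n set \<Rightarrow> real ^ 'n::finite ^ 'n \<Rightarrow> real ^ 'n ^ 'n" where
  "inverse_on I A = (THE B. is_inverse_on I A B)"

definition singular_values_on :: "'n set \<Rightarrow> real ^ 'n::finite ^ 'n \<Rightarrow> real set" where
  "singular_values_on I A = {s. s \<ge> 0 \<and> (\<exists>v. v \<noteq> 0 \<and> (\<forall>i. i \<notin> I \<longrightarrow> v $ i = 0) \<and>
     (transpose A ** A) *v v = s\<^sup>2 *\<^sub>R v)}"

text \<open>Maximum absolute row sum; for a single column this is the vector \<open>\<infinity>\<close>-norm.\<close>

definition norm_inf :: "real ^ 'n::finite ^ 'm::finite \<Rightarrow> real" where
  "norm_inf A = (MAX i. \<Sum>j\<in>UNIV. \<bar>A $ i $ j\<bar>)"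


section \<open>Local Jacobians and the coupling system\<close>

text \<open>
  \<open>G\<^sub>i\<close> as a function of \<open>z = (x, m)\<close>, \<open>d = (\<nu>, \<lambda>)\<close> and \<open>\<theta>\<close>. Its rows and the variables \<open>z\<^sub>i\<close> are
  indexed by \<open>zidx P i\<close>; the remaining rows are zero.
\<close>

definition zidx :: "('p, 'x::finite, 'l, 'c, 'q::finite) sep_problem \<Rightarrow> 'p \<Rightarrow> ('x + 'l) set" where
  "zidx P i = Inl ` {a. xown P a = i} \<union> Inr ` {l \<in> leqs P \<union> lineqs P. lown P l = i}"

definition zpair :: "real ^ 'x::finite \<Rightarrow> real ^ 'l::finite \<Rightarrow> real ^ ('x + 'l)" where
  "zpair x m = (\<chi> r. case r of Inl a \<Rightarrow> x $ a | Inr l \<Rightarrow> m $ l)"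

definition local_G ::
  "('p, 'x::finite, 'l::finite, 'c::finite, 'q::finite) sep_problem \<Rightarrow> 'p \<Rightarrow>
     real ^ ('x + 'l) \<Rightarrow> real ^ 'c \<Rightarrow> real ^ 'q \<Rightarrow> real ^ ('x + 'l)" where
  "local_G P i z d \<theta> =
     (let x = (\<chi> a. z $ Inl a); m = (\<chi> l. z $ Inr l) in
      \<chi> r. if r \<notin> zidx P i then 0
          else (case r of
            Inl a \<Rightarrow> grad (\<lambda>x. lagr P i x m d \<theta>) x $ a
          | Inr l \<Rightarrow> if l \<in> leqs P then floc P l x \<theta> else m $ l * floc P l x \<theta>))"

text \<open>
  \<open>local_G_z\<close> is \<open>\<partial>\<^bsub>z\<^sub>i\<^esub> G\<^sub>i\<close>. The derivatives of \<open>G\<^sub>i\<close> with respect to entries of \<open>z\<close> outside the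
  block \<open>z\<^sub>i\<close>, and to \<open>\<theta>\<^sub>j\<close> with \<open>j \<noteq> i\<close>, vanish by separability.
\<close>

definition local_G_z ::
  "('p, 'x::finite, 'l::finite, 'c::finite, 'q::finite) sep_problem \<Rightarrow> 'p \<Rightarrow>
     real ^ 'x \<Rightarrow> real ^ 'l \<Rightarrow> real ^ 'c \<Rightarrow> real ^ 'q \<Rightarrow> real ^ ('x + 'l) ^ ('x + 'l)" where
  "local_G_z P i x m d \<theta> = jacobian (\<lambda>z. local_G P i z d \<theta>) (at (zpair x m))"

text \<open>
  \<open>stacked_theta\<close> and \<open>stacked_dual\<close> are \<open>\<partial>\<^sub>\<theta> x\<close> and \<open>[\<partial>\<^sub>\<nu> x, \<partial>\<^sub>\<lambda> x]\<close>: the rows \<open>a\<close> of block \<open>i\<close> are those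
  of \<open>- [I 0] (\<partial>\<^bsub>z\<^sub>i\<^esub> G\<^sub>i)\<inverse> \<partial>G\<^sub>i\<close>.
\<close>

definition stacked_theta ::
  "('p, 'x::finite, 'l::finite, 'c::finite, 'q::finite) sep_problem \<Rightarrow>
     real ^ 'x \<Rightarrow> real ^ 'l \<Rightarrow> real ^ 'c \<Rightarrow> real ^ 'q \<Rightarrow> real ^ 'q ^ 'x" where
  "stacked_theta P x m d \<theta> = (\<chi> a. let i = xown P a in
     - (inverse_on (zidx P i) (local_G_z P i x m d \<theta>) **
        jacobian (\<lambda>\<theta>. local_G P i (zpair x m) d \<theta>) (at \<theta>)) $ Inl a)"

definition stacked_dual ::
  "('p, 'x::finite, 'l::finite, 'c::finite, 'q::finite) sep_problem \<Rightarrow>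
     real ^ 'x \<Rightarrow> real ^ 'l \<Rightarrow> real ^ 'c \<Rightarrow> real ^ 'q \<Rightarrow> real ^ 'c ^ 'x" where
  "stacked_dual P x m d \<theta> = (\<chi> a. let i = xown P a in
     - (inverse_on (zidx P i) (local_G_z P i x m d \<theta>) **
        jacobian (\<lambda>d. local_G P i (zpair x m) d \<theta>) (at d)) $ Inl a)"

text \<open>
  The map \<open>C\<close>. It does not depend on \<open>\<nu>\<close>, so its Jacobian in \<open>d\<close> is the block row \<open>[0, \<partial>\<^sub>\<lambda> C]\<close>.
\<close>

definition coupling_C ::
  "('p::finite, 'x::finite, 'l, 'c::finite, 'q::finite) sep_problem \<Rightarrow>
     real ^ 'x \<Rightarrow> real ^ 'c \<Rightarrow> real ^ 'q \<Rightarrow> real ^ 'c" where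
  "coupling_C P x d \<theta> =
     (\<chi> c. if c \<in> ceqs P then total_cpl P c x \<theta> else d $ c * total_cpl P c x \<theta>)"

definition coupling_matrix ::
  "('p::finite, 'x::finite, 'l::finite, 'c::finite, 'q::finite) sep_problem \<Rightarrow>
     real ^ 'x \<Rightarrow> real ^ 'l \<Rightarrow> real ^ 'c \<Rightarrow> real ^ 'q \<Rightarrow> real ^ 'c ^ 'c" where
  "coupling_matrix P x m d \<theta> =
     - (jacobian (\<lambda>x. coupling_C P x d \<theta>) (at x) ** stacked_dual P x m d \<theta> +
        jacobian (\<lambda>d. coupling_C P x d \<theta>) (at d))"

definition coupling_rhs ::
  "('p::finite, 'x::finite, 'l::finite, 'c::finite, 'q::finite) sep_problem \<Rightarrow>
     real ^ 'x \<Rightarrow> real ^ 'l \<Rightarrow> real ^ 'c \<Rightarrow> real ^ 'q \<Rightarrow> real ^ 'q ^ 'c" where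
  "coupling_rhs P x m d \<theta> =
     jacobian (\<lambda>x. coupling_C P x d \<theta>) (at x) ** stacked_theta P x m d \<theta> +
     jacobian (\<lambda>\<theta>. coupling_C P x d \<theta>) (at \<theta>)"


section \<open>The bipartite graph\<close>

definition involved ::
  "('p, 'x::finite, 'l, 'c, 'q::finite) sep_problem \<Rightarrow> 'p \<Rightarrow> 'c \<Rightarrow> bool" where
  "involved P k c \<longleftrightarrow> (\<exists>x x' \<theta>. fcpl P k c x \<theta> \<noteq> fcpl P k c x' \<theta>)"

definition graph_edges ::
  "('p, 'x::finite, 'l, 'c, 'q::finite) sep_problem \<Rightarrow> ('p + 'c) rel" where
  "graph_edges P = {(Inl k, Inr c) | k c. involved P k c} \<union> {(Inr c, Inl k) | k c. involved P k c}"

definition graph_dist ::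
  "('p, 'x::finite, 'l, 'c, 'q::finite) sep_problem \<Rightarrow> 'p + 'c \<Rightarrow> 'p + 'c \<Rightarrow> enat" where
  "graph_dist P u v = (INF n \<in> {n. (u, v) \<in> graph_edges P ^^ n}. enat n)"

definition nbhd ::
  "('p, 'x::finite, 'l, 'c, 'q::finite) sep_problem \<Rightarrow> nat \<Rightarrow> 'p \<Rightarrow> 'c set" where
  "nbhd P \<omega> k = {c. graph_dist P (Inr c) (Inl k) \<le> enat (2 * \<omega> + 1)}"

definition cdegree ::
  "('p, 'x::finite, 'l, 'c, 'q::finite) sep_problem \<Rightarrow> 'c \<Rightarrow> nat" where
  "cdegree P c = card {k. involved P k c}"

definition bandwidth ::
  "('p, 'x::finite, 'l, 'c::finite, 'q::finite) sep_problem \<Rightarrow> real ^ 'c ^ 'c \<Rightarrow> nat" where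
  "bandwidth P A =
     (LEAST B. \<forall>i j. graph_dist P (Inr i) (Inr j) > enat B \<longrightarrow> A $ i $ j = 0)"


section \<open>The iteration and its rate\<close>

text \<open>
  In the following, \<open>D\<close> stands for the coupling matrix \<open>\<partial>C\<close>. The columns of \<open>id_on V\<close> with
  index in \<open>V\<close> are the unit vectors \<open>e\<^sub>i\<close>, \<open>i \<in> V\<close>, so \<open>id_on (nbhd P \<omega> k)\<close> is \<open>T\<^sub>k\<^sup>\<omega>\<close>, and
  \<open>id_on (nbhd P 0 k)\<close> is \<open>T\<^sub>k\<close>.
\<close>

definition C_in ::
  "('p, 'x::finite, 'l, 'c::finite, 'q::finite) sep_problem \<Rightarrow> real ^ 'c ^ 'c \<Rightarrow> nat \<Rightarrow> 'p \<Rightarrow>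
     real ^ 'c ^ 'c" where
  "C_in P D \<omega> k = transpose (id_on (nbhd P \<omega> k)) ** D ** id_on (nbhd P \<omega> k)"

definition C_out ::
  "('p, 'x::finite, 'l, 'c::finite, 'q::finite) sep_problem \<Rightarrow> real ^ 'c ^ 'c \<Rightarrow> nat \<Rightarrow> 'p \<Rightarrow>
     real ^ 'c ^ 'c" where
  "C_out P D \<omega> k = transpose (id_on (nbhd P \<omega> k)) ** D ** id_on (- nbhd P \<omega> k)"

definition S_block ::
  "('p, 'x::finite, 'l, 'c::finite, 'q::finite) sep_problem \<Rightarrow> real ^ 'c ^ 'c \<Rightarrow> nat \<Rightarrow> 'p \<Rightarrow>
     real ^ 'c ^ 'c" where
  "S_block P D \<omega> k = - (transpose (id_on (nbhd P 0 k)) ** id_on (nbhd P \<omega> k) **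
     inverse_on (nbhd P \<omega> k) (C_in P D \<omega> k) ** C_out P D \<omega> k **
     transpose (id_on (- nbhd P \<omega> k)))"

definition U_block ::
  "('p, 'x::finite, 'l, 'c::finite, 'q::finite) sep_problem \<Rightarrow> real ^ 'c ^ 'c \<Rightarrow> nat \<Rightarrow> 'p \<Rightarrow>
     real ^ 'c ^ 'c" where
  "U_block P D \<omega> k = transpose (id_on (nbhd P 0 k)) ** id_on (nbhd P \<omega> k) **
     inverse_on (nbhd P \<omega> k) (C_in P D \<omega> k) ** transpose (id_on (nbhd P \<omega> k))"

text \<open>
  The rows of the stacked matrices are indexed by the pairs \<open>(k, l)\<close> with \<open>l \<in> nbhd P 0 k\<close>;
  rows for other pairs are zero.
\<close>

definition S_stack ::
  "('p::finite, 'x::finite, 'l, 'c::finite, 'q::finite) sep_problem \<Rightarrow> real ^ 'c ^ 'c \<Rightarrow> nat \<Rightarrow>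
     real ^ 'c ^ ('p \<times> 'c)" where
  "S_stack P D \<omega> = (\<chi> r. S_block P D \<omega> (fst r) $ snd r)"

definition U_stack ::
  "('p::finite, 'x::finite, 'l, 'c::finite, 'q::finite) sep_problem \<Rightarrow> real ^ 'c ^ 'c \<Rightarrow> nat \<Rightarrow>
     real ^ 'c ^ ('p \<times> 'c)" where
  "U_stack P D \<omega> = (\<chi> r. U_block P D \<omega> (fst r) $ snd r)"

definition aggregation ::
  "('p::finite, 'x::finite, 'l, 'c::finite, 'q::finite) sep_problem \<Rightarrow> real ^ ('p \<times> 'c) ^ 'c" where
  "aggregation P = (\<chi> i r. if snd r \<in> nbhd P 0 (fst r) \<and> i = snd r
                           then 1 / real (cdegree P i) else 0)"

definition R_const ::
  "('p, 'x::finite, 'l, 'c::finite, 'q::finite) sep_problem \<Rightarrow> real ^ 'c ^ 'c \<Rightarrow> nat \<Rightarrow> 'p \<Rightarrow> real" where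
  "R_const P D \<omega> k = (\<Sum>i\<in>nbhd P \<omega> k. \<Sum>j\<in>- nbhd P \<omega> k. \<bar>C_out P D \<omega> k $ i $ j\<bar>)"

definition sigma_max ::
  "('p, 'x::finite, 'l, 'c::finite, 'q::finite) sep_problem \<Rightarrow> real ^ 'c ^ 'c \<Rightarrow> nat \<Rightarrow> 'p \<Rightarrow> real" where
  "sigma_max P D \<omega> k = Max (singular_values_on (nbhd P \<omega> k) (C_in P D \<omega> k))"

definition sigma_min ::
  "('p, 'x::finite, 'l, 'c::finite, 'q::finite) sep_problem \<Rightarrow> real ^ 'c ^ 'c \<Rightarrow> nat \<Rightarrow> 'p \<Rightarrow> real" where
  "sigma_min P D \<omega> k = Min (singular_values_on (nbhd P \<omega> k) (C_in P D \<omega> k))"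

text \<open>
  The power \<open>\<rho> ^ \<lceil>\<omega> / (2 B) - 1\<rceil>\<^sub>+\<close>, for \<open>0 \<le> \<rho> < 1\<close>. If \<open>B = 0\<close> (a diagonal matrix) and \<open>\<omega> > 0\<close>, the
  exponent is read as \<open>\<infinity>\<close> and the power as \<open>0\<close>; if \<open>B = \<omega> = 0\<close>, the exponent is \<open>0\<close>.
\<close>

definition decay :: "real \<Rightarrow> nat \<Rightarrow> nat \<Rightarrow> real" where
  "decay \<rho> \<omega> B = (if B = 0 \<and> \<omega> > 0 then 0 else \<rho> ^ nat \<lceil>real \<omega> / (2 * real B) - 1\<rceil>)"

text \<open>
  If \<open>nbhd P \<omega> k\<close> is empty, there are no singular values, but then \<open>R_const P D \<omega> k = 0\<close> and
  the term for \<open>k\<close> is \<open>0\<close>.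
\<close>

definition rate ::
  "('p::finite, 'x::finite, 'l, 'c::finite, 'q::finite) sep_problem \<Rightarrow> real ^ 'c ^ 'c \<Rightarrow> nat \<Rightarrow> real" where
  "rate P D \<omega> = (MAX k.
     let \<sigma>1 = sigma_max P D \<omega> k; \<sigma>0 = sigma_min P D \<omega> k in
     R_const P D \<omega> k * \<sigma>1 / \<sigma>0\<^sup>2 *
     decay ((\<sigma>1\<^sup>2 - \<sigma>0\<^sup>2) / (\<sigma>1\<^sup>2 + \<sigma>0\<^sup>2)) \<omega> (bandwidth P (C_in P D \<omega> k)))"

end

theory Submission
  imports Defs
begin

text \<open>
  Each step is an averaged block solve, so the error of row \<open>c\<close> is multiplied by an average over the
  subproblems \<open>k\<close> involved in \<open>c\<close> of the rows of \<open>- (\<partial>C\<^sub>k\<^sup>\<omega>)\<inverse> \<partial>C\<^sub>-\<^sub>k\<^sup>\<omega>\<close>. The nonzero rows \<open>i\<close> of the second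
  factor belong to constraints at the boundary of the neighbourhood, at distance at least \<open>\<omega>\<close> from \<open>c\<close>,
  so it suffices that the entries of the inverse decay with the distance. The latter follows from
  the Neumann series of \<open>A\<^sup>T A\<close>, whose partial sums are banded.

  The blocks \<open>\<partial>C\<^sub>k\<^sup>\<omega>\<close> are invertible: up to positive row scaling and a nonzero diagonal part for the
  inactive constraints, \<open>\<partial>C\<close> is \<open>A M A\<^sup>T\<close>, where \<open>A\<close> is the Jacobian of the coupling constraints and \<open>M\<close> is
  block diagonal. Each block of \<open>M\<close> is positive semidefinite by the second-order necessary condition
  for the local problem, and its kernel is spanned by the gradients of the active local
  constraints, so linear independence of all active gradients makes the principal blocks definite.
\<close>

section \<open>Symmetric matrices and singular values\<close>

text \<open>The local sets are convex, but the functions describing them need not be, so the Hessian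
  of a local Lagrangian is semidefinite only on the tangent space of the active constraints; seeing
  this takes curves inside the constraint manifold. Strict convexity alone would still allow a flat
  tangent direction (as for a quartic), but such a direction yields a kernel vector of the local KKT
  matrix \<open>local_G_z\<close>, which is assumed invertible. Origin of the constants: the scaling
  \<open>2 / (\<sigma>1\<^sup>2 + \<sigma>0\<^sup>2)\<close> moves the spectrum of
  \<open>A\<^sup>T A\<close> into the symmetric interval from \<open>- \<rho>\<close> to
  \<open>\<rho>\<close>; \<open>n\<close> Neumann terms reach distance \<open>(2 n - 1) B\<close>,
  which stays below \<open>\<omega>\<close> for the exponent \<open>n\<close> of the rate; the
  remainder is at most \<open>\<rho>^n / \<sigma>0\<close>, and
  \<open>1 / \<sigma>0 \<le> \<sigma>1 / \<sigma>0\<^sup>2\<close>. \<open>R_const\<close> arises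
  from bounding all relevant entries of the inverse uniformly. A constraint that involves no
  subproblem has a zero row in \<open>aggregation\<close>, so its iterates vanish after one step;
  independence of the gradients makes it nonbinding, and then its row of the solution vanishes
  too.\<close>

lemma quadratic_nonneg_imp_linear_zero:
  fixes b c :: real
  assumes "\<And>s. 0 \<le> 2 * s * b + s\<^sup>2 * c"
  shows "b = 0"
proof (rule ccontr)
  assume b: "b \<noteq> 0"
  \<comment> \<open>At \<open>s = - b / k\<close> with \<open>k > c\<close> the negative linear term
    outweighs the quadratic one.\<close>
  define k where "k = \<bar>c\<bar> + 1"
  have k: "k > 0" "c < k" by (auto simp: k_def)
  have "0 \<le> 2 * (- b / k) * b + (- b / k)\<^sup>2 * c" using assms .
  also have "\<dots> = b\<^sup>2 / k\<^sup>2 * (c - 2 * k)"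
    using k by (simp add: field_simps power2_eq_square)
  also have "\<dots> < 0"
    using k b by (intro mult_pos_neg) auto
  finally show False by simp
qed

text \<open>The vector \<open>v\<close> minimizes the form over \<open>W\<close>, so the first
  variation along \<open>h\<close> vanishes. Semidefiniteness on \<open>W\<close> suffices, which
  matters for Hessians that are controlled only on a tangent space.\<close>

lemma psd_form_kernel:
  fixes Q :: "real ^ 'n::finite ^ 'n"
  assumes sym: "\<And>u v. u \<bullet> (Q *v v) = v \<bullet> (Q *v u)"
    and W: "subspace W"
    and psd: "\<And>w. w \<in> W \<Longrightarrow> 0 \<le> w \<bullet> (Q *v w)"
    and v: "v \<in> W" "v \<bullet> (Q *v v) = 0" and h: "h \<in> W"
  shows "h \<bullet> (Q *v v) = 0"
proof (rule quadratic_nonneg_imp_linear_zero)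
  fix s :: real
  have "v + s *\<^sub>R h \<in> W"
    by (intro subspace_add[OF W] subspace_scale[OF W] v h)
  from psd[OF this] show "0 \<le> 2 * s * (h \<bullet> (Q *v v)) + s\<^sup>2 * (h \<bullet> (Q *v h))"
    using v(2) sym[of v h]
    by (simp add: algebra_simps inner_simps power2_eq_square)
qed

lemma symmetric_matrix_inner:
  fixes T :: "real ^ 'n::finite ^ 'n"
  assumes "transpose T = T"
  shows "u \<bullet> (T *v v) = v \<bullet> (T *v u)"
  by (metis assms dot_lmul_matrix inner_commute transpose_matrix_vector)

text \<open>Take \<open>v\<close> maximizing the Rayleigh quotient on the unit sphere of
  \<open>W\<close>. The form of \<open>\<mu> - T\<close> is nonnegative on \<open>W\<close> and
  vanishes at \<open>v\<close>, so \<open>(\<mu> - T) v\<close> is orthogonal to \<open>W\<close> by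
  \<open>psd_form_kernel\<close>; by invariance it also lies in \<open>W\<close>, hence it is
  zero.\<close>

lemma rayleigh_max_eigenvector:
  fixes T :: "real ^ 'n::finite ^ 'n"
  assumes sym: "transpose T = T" and W: "subspace W" "W \<noteq> {0}"
    and inv: "\<And>v. v \<in> W \<Longrightarrow> T *v v \<in> W"
  obtains \<mu> v where "v \<in> W" "v \<noteq> 0" "T *v v = \<mu> *\<^sub>R v"
    "\<And>w. w \<in> W \<Longrightarrow> w \<bullet> (T *v w) \<le> \<mu> * (w \<bullet> w)"
proof -
  let ?S = "sphere 0 1 \<inter> W"
  obtain w0 where w0: "w0 \<in> W" "w0 \<noteq> 0"
    using W subspace_0 by blast
  have "w0 /\<^sub>R norm w0 \<in> ?S"
    using w0 W(1) by (auto intro: subspace_scale)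
  then have ne: "?S \<noteq> {}" by blast
  have cpt: "compact ?S"
    by (intro compact_Int_closed closed_subspace W) auto
  have cont: "continuous_on ?S (\<lambda>w. w \<bullet> (T *v w))"
    by (intro continuous_intros matrix_vector_mult_linear_continuous_on)
  obtain v where v: "v \<in> ?S" and max: "\<And>w. w \<in> ?S \<Longrightarrow> w \<bullet> (T *v w) \<le> v \<bullet> (T *v v)"
    using continuous_attains_sup[OF cpt ne cont] by blast
  define \<mu> where "\<mu> = v \<bullet> (T *v v)"
  have vW: "v \<in> W" and v1: "v \<bullet> v = 1"
    using v by (auto simp: dot_square_norm)
  have bound: "w \<bullet> (T *v w) \<le> \<mu> * (w \<bullet> w)" if w: "w \<in> W" for w
  proof (cases "w = 0")
    case False
    have "w /\<^sub>R norm w \<in> ?S"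
      using False w W(1) by (auto intro: subspace_scale)
    from max[OF this] have "(w \<bullet> (T *v w)) / (norm w)\<^sup>2 \<le> \<mu>"
      using False by (simp add: \<mu>_def matrix_vector_mult_scaleR power2_eq_square divide_inverse_commute)
    then show ?thesis
      using False by (simp add: field_simps dot_square_norm)
  qed simp
  define Q where "Q = \<mu> *\<^sub>R mat 1 - T"
  have Q: "Q *v u = \<mu> *\<^sub>R u - T *v u" for u
    by (simp add: Q_def matrix_vector_mult_diff_rdistrib scaleR_matrix_vector_assoc[symmetric])
  have Qsym: "u \<bullet> (Q *v w) = w \<bullet> (Q *v u)" for u w
    using symmetric_matrix_inner[OF sym, of u w] by (simp add: Q inner_simps inner_commute)
  have "h \<bullet> (Q *v v) = 0" if "h \<in> W" for h
  proof (rule psd_form_kernel[of Q W])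
    show "0 \<le> w \<bullet> (Q *v w)" if "w \<in> W" for w
      using bound[OF that] by (simp add: Q inner_simps)
    show "v \<bullet> (Q *v v) = 0"
      using v1 by (simp add: Q inner_simps \<mu>_def)
  qed (use Qsym W vW that in auto)
  moreover have "Q *v v \<in> W"
    unfolding Q by (intro subspace_diff subspace_scale W inv vW)
  ultimately have "Q *v v = 0"
    by (metis inner_eq_zero_iff)
  then have "T *v v = \<mu> *\<^sub>R v" by (simp add: Q)
  with vW v1 bound that show thesis by force
qed

section \<open>Matrices supported on an index set: relative inverses and singular values\<close>

definition coord_space :: "'n set \<Rightarrow> (real ^ 'n::finite) set" where
  "coord_space I = {v. \<forall>i. i \<notin> I \<longrightarrow> v $ i = 0}"

lemma subspace_coord_space: "subspace (coord_space I)"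
  by (auto simp: coord_space_def subspace_def)

lemma coord_space_nontrivial:
  assumes "i \<in> I" shows "coord_space I \<noteq> {0}"
proof -
  have "axis i 1 \<in> coord_space I" using assms by (auto simp: coord_space_def axis_def)
  then show ?thesis by (metis axis_eq_0_iff singletonD zero_neq_one)
qed

definition supported_matrix :: "'n set \<Rightarrow> real ^ 'n::finite ^ 'n \<Rightarrow> bool" where
  "supported_matrix I A \<longleftrightarrow> (\<forall>i j. i \<notin> I \<or> j \<notin> I \<longrightarrow> A $ i $ j = 0)"

lemma supported_matrix_transpose: "supported_matrix I A \<Longrightarrow> supported_matrix I (transpose A)"
  by (auto simp: supported_matrix_def transpose_def)

lemma supported_matrix_vector: "supported_matrix I A \<Longrightarrow> A *v v \<in> coord_space I"
  by (auto simp: supported_matrix_def coord_space_def matrix_vector_mult_def)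

lemma id_on_mult_left: "(id_on I ** A) $ i $ j = (if i \<in> I then A $ i $ j else 0)"
proof -
  have "(id_on I ** A) $ i $ j = (\<Sum>k\<in>UNIV. if k = i then (if i \<in> I then A $ i $ j else 0) else 0)"
    unfolding matrix_matrix_mult_def id_on_def vec_lambda_beta by (intro sum.cong) auto
  then show ?thesis by simp
qed

lemma id_on_mult_right: "(A ** id_on I) $ i $ j = (if j \<in> I then A $ i $ j else 0)"
proof -
  have "(A ** id_on I) $ i $ j = (\<Sum>k\<in>UNIV. if k = j then (if j \<in> I then A $ i $ j else 0) else 0)"
    unfolding matrix_matrix_mult_def id_on_def vec_lambda_beta by (intro sum.cong) auto
  then show ?thesis by simp
qed

lemma id_on_vector: "(id_on I *v v) $ i = (if i \<in> I then v $ i else 0)"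
proof -
  have "(id_on I *v v) $ i = (\<Sum>k\<in>UNIV. if k = i then (if i \<in> I then v $ i else 0) else 0)"
    unfolding matrix_vector_mult_def id_on_def vec_lambda_beta by (intro sum.cong) auto
  then show ?thesis by simp
qed

lemma id_on_vector_coord_space: "v \<in> coord_space I \<Longrightarrow> id_on I *v v = v"
  by (auto simp: vec_eq_iff id_on_vector coord_space_def)

lemma transpose_id_on [simp]: "transpose (id_on I) = id_on I"
  by (auto simp: vec_eq_iff transpose_def id_on_def)

lemma supported_matrix_id_left: "supported_matrix I A \<Longrightarrow> id_on I ** A = A"
  by (auto simp: vec_eq_iff id_on_mult_left supported_matrix_def)

lemma supported_matrix_id_right: "supported_matrix I A \<Longrightarrow> A ** id_on I = A"
  by (auto simp: vec_eq_iff id_on_mult_right supported_matrix_def)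

text \<open>The support condition makes \<open>id_on I\<close> a unit for both candidates, so the
  usual uniqueness argument for two-sided inverses applies and \<open>THE\<close> is well
  defined.\<close>

lemma inverse_on_eq:
  assumes B: "is_inverse_on I A B"
  shows "inverse_on I A = B"
  unfolding inverse_on_def
proof (rule the_equality)
  fix C assume C: "is_inverse_on I A C"
  have sB: "supported_matrix I B" and sC: "supported_matrix I C"
    using B C by (auto simp: is_inverse_on_def supported_matrix_def)
  have "C = C ** (A ** B)"
    using B supported_matrix_id_right[OF sC] by (simp add: is_inverse_on_def)
  also have "\<dots> = (C ** A) ** B" by (simp add: matrix_mul_assoc)
  also have "\<dots> = B"
    using C supported_matrix_id_left[OF sB] by (simp add: is_inverse_on_def)
  finally show "C = B" .
qed (rule B)

lemma inverse_on_works: "invertible_on I A \<Longrightarrow> is_inverse_on I A (inverse_on I A)"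
  using inverse_on_eq by (metis invertible_on_def)

lemma matrix_diff_rdistrib:
  fixes X Y :: "real ^ 'n::finite ^ 'm::finite" and Z :: "real ^ 'k::finite ^ 'n"
  shows "(X - Y) ** Z = X ** Z - Y ** Z"
  by (simp add: vec_eq_iff matrix_matrix_mult_def sum_subtractf algebra_simps)

lemma matrix_diff_ldistrib:
  fixes X Y :: "real ^ 'n::finite ^ 'm::finite" and Z :: "real ^ 'm ^ 'k::finite"
  shows "Z ** (X - Y) = Z ** X - Z ** Y"
  by (simp add: vec_eq_iff matrix_matrix_mult_def sum_subtractf algebra_simps)

lemma matrix_add_rdistrib:
  fixes X Y :: "real ^ 'n::finite ^ 'm::finite" and Z :: "real ^ 'k::finite ^ 'n"
  shows "(X + Y) ** Z = X ** Z + Y ** Z"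
  by (simp add: vec_eq_iff matrix_matrix_mult_def sum.distrib algebra_simps)

text \<open>Adding the identity \<open>E\<close> on the complement of \<open>I\<close> gives a
  matrix that is injective on the whole space. Its inverse \<open>B\<close> satisfies
  \<open>B ** E = E = E ** B\<close>, so subtracting \<open>E\<close> again leaves the relative
  inverse.\<close>

lemma injective_imp_invertible_on:
  fixes A :: "real ^ 'n::finite ^ 'n"
  assumes A: "supported_matrix I A"
    and inj: "\<And>v. v \<in> coord_space I \<Longrightarrow> A *v v = 0 \<Longrightarrow> v = 0"
  shows "invertible_on I A"
proof -
  define E where "E = (id_on (- I) :: real ^ 'n ^ 'n)"
  have AE: "A ** E = 0" "E ** A = 0"
    using A by (auto simp: vec_eq_iff E_def id_on_mult_left id_on_mult_right supported_matrix_def)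
  have EE: "E ** E = E"
    unfolding E_def vec_eq_iff id_on_mult_left by (simp add: id_on_def)
  have one: "mat 1 - E = id_on I"
    by (auto simp: vec_eq_iff E_def id_on_def mat_def)
  have "v = 0" if v: "(A + E) *v v = 0" for v
  proof -
    have "A *v v \<in> coord_space I" by (rule supported_matrix_vector[OF A])
    then have "v $ i = 0" if "i \<notin> I" for i
      using arg_cong[OF v, of "\<lambda>u. u $ i"] that
      by (simp add: matrix_vector_mult_add_rdistrib E_def id_on_vector coord_space_def)
    then have vI: "v \<in> coord_space I" by (simp add: coord_space_def)
    then have "E *v v = 0"
      by (auto simp: vec_eq_iff E_def id_on_vector coord_space_def)
    then have "A *v v = 0" using v by (simp add: matrix_vector_mult_add_rdistrib)
    then show ?thesis using inj vI by blast
  qed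
  then obtain B where B: "B ** (A + E) = mat 1" "(A + E) ** B = mat 1"
    by (metis matrix_left_invertible_ker matrix_left_right_inverse)
  have BE: "B ** E = E"
    by (metis AE(1) B(1) EE add_0 matrix_add_rdistrib matrix_mul_assoc matrix_mul_lid)
  have EB: "E ** B = E"
    by (metis AE(2) B(2) EE add_0 matrix_add_ldistrib matrix_mul_assoc matrix_mul_rid)
  define C where "C = B - E"
  have "A ** B = mat 1 - E"
    using B(2) EB by (simp add: matrix_add_rdistrib eq_diff_eq)
  then have 1: "A ** C = id_on I"
    using one AE by (simp add: C_def matrix_diff_ldistrib)
  have "B ** A = mat 1 - E"
    using B(1) BE by (simp add: matrix_add_ldistrib eq_diff_eq)
  then have 2: "C ** A = id_on I"
    using one AE by (simp add: C_def matrix_diff_rdistrib)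
  have "E ** C = 0" "C ** E = 0"
    using BE EB EE by (auto simp: C_def matrix_diff_rdistrib matrix_diff_ldistrib)
  then have "C $ i $ j = 0" if "i \<notin> I \<or> j \<notin> I" for i j
    using that unfolding E_def vec_eq_iff id_on_mult_left id_on_mult_right by (metis ComplI zero_index)
  with 1 2 show ?thesis by (auto simp: invertible_on_def is_inverse_on_def)
qed


text \<open>Eigenvectors of \<open>A\<^sup>T A\<close> for distinct singular values are orthogonal,
  hence independent, which bounds their number. The two norm estimates come from the Rayleigh
  maximum of \<open>T\<close> and of \<open>- T\<close>: both extremal eigenvalues are squares of
  singular values.\<close>

lemma
  fixes A :: "real ^ 'n::finite ^ 'n"
  assumes A: "supported_matrix I A" and ne: "I \<noteq> {}"
  defines "SV \<equiv> singular_values_on I A"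
  shows finite_singular_values_on: "finite SV"
    and singular_values_on_nonempty: "SV \<noteq> {}"
    and sigma_max_bound: "v \<in> coord_space I \<Longrightarrow> norm (A *v v) \<le> Max SV * norm v"
    and sigma_min_bound: "v \<in> coord_space I \<Longrightarrow> Min SV * norm v \<le> norm (A *v v)"
proof -
  define T where "T = transpose A ** A"
  have Tsym: "transpose T = T" by (simp add: T_def matrix_transpose_mul)
  have Tv: "T *v v = transpose A *v (A *v v)" for v
    by (simp add: T_def matrix_vector_mul_assoc)
  have vTv: "v \<bullet> (T *v v) = (norm (A *v v))\<^sup>2" for v
    unfolding Tv by (metis dot_lmul_matrix dot_square_norm inner_commute transpose_matrix_vector)
  have inv: "T *v v \<in> coord_space I" for v
    unfolding Tv by (intro supported_matrix_vector supported_matrix_transpose A)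
  have SV: "s \<in> SV \<longleftrightarrow> s \<ge> 0 \<and> (\<exists>v. v \<noteq> 0 \<and> v \<in> coord_space I \<and> T *v v = s\<^sup>2 *\<^sub>R v)" for s
    by (simp add: SV_def singular_values_on_def T_def coord_space_def)
  obtain i where i: "i \<in> I" using ne by blast
  note W = subspace_coord_space[of I] coord_space_nontrivial[OF i]

  have eig: "sqrt \<mu> \<in> SV \<and> (sqrt \<mu>)\<^sup>2 = \<mu>"
    if "v \<in> coord_space I" "v \<noteq> 0" "T *v v = \<mu> *\<^sub>R v" for \<mu> v
  proof -
    have "\<mu> * (norm v)\<^sup>2 = (norm (A *v v))\<^sup>2"
      using vTv[of v] that by (simp add: dot_square_norm)
    then have "\<mu> * (norm v)\<^sup>2 \<ge> 0" by simp
    then have "\<mu> \<ge> 0" using that(2) by (simp add: zero_le_mult_iff)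
    then show ?thesis using that by (auto simp: SV)
  qed

  show fin: "finite SV"
  proof -
    obtain f where f: "\<And>s. s \<in> SV \<Longrightarrow> f s \<noteq> 0 \<and> T *v f s = s\<^sup>2 *\<^sub>R f s"
      using SV by metis
    have orth: "s = t \<or> f s \<bullet> f t = 0" if st: "s \<in> SV" "t \<in> SV" for s t
    proof (rule disjCI)
      assume "f s \<bullet> f t \<noteq> 0"
      moreover have "s\<^sup>2 * (f s \<bullet> f t) = t\<^sup>2 * (f s \<bullet> f t)"
        using symmetric_matrix_inner[OF Tsym, of "f s" "f t"] f[OF st(1)] f[OF st(2)]
        by (metis inner_commute inner_scaleR_right)
      ultimately show "s = t"
        using st SV by (metis mult_cancel_right power2_eq_imp_eq)
    qed
    have "independent (f ` SV)"
    proof (rule pairwise_orthogonal_independent)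
      show "pairwise orthogonal (f ` SV)"
        using orth by (auto simp: pairwise_def orthogonal_def)
      show "0 \<notin> f ` SV" using f by force
    qed
    then have "finite (f ` SV)" by (rule independent_imp_finite)
    moreover have "inj_on f SV"
      using orth f by (intro inj_onI) (metis inner_eq_zero_iff)
    ultimately show ?thesis by (rule finite_imageD)
  qed

  obtain \<mu> u where max: "u \<in> coord_space I" "u \<noteq> 0" "T *v u = \<mu> *\<^sub>R u"
    "\<And>w. w \<in> coord_space I \<Longrightarrow> w \<bullet> (T *v w) \<le> \<mu> * (w \<bullet> w)"
    using rayleigh_max_eigenvector[OF Tsym W inv] by metis
  have neg: "(- T) *v w = - (T *v w)" for w
    by (simp add: vec_eq_iff matrix_vector_mult_def sum_negf)
  have negsym: "transpose (- T) = - T"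
    using Tsym by (simp add: vec_eq_iff transpose_def)
  have neginv: "(- T) *v w \<in> coord_space I" for w
    unfolding neg by (intro subspace_neg W inv)
  obtain \<nu> u' where min: "u' \<in> coord_space I" "u' \<noteq> 0" "(- T) *v u' = \<nu> *\<^sub>R u'"
    "\<And>w. w \<in> coord_space I \<Longrightarrow> w \<bullet> ((- T) *v w) \<le> \<nu> * (w \<bullet> w)"
    using rayleigh_max_eigenvector[OF negsym W neginv] by metis
  have eigmin: "T *v u' = (- \<nu>) *\<^sub>R u'"
    using min(3) by (simp add: neg equation_minus_iff[of "T *v u'"])
  note max_SV = eig[OF max(1-3)] and min_SV = eig[OF min(1,2) eigmin]
  show "SV \<noteq> {}" using max_SV by auto
  have Max0: "0 \<le> Max SV" and Min0: "0 \<le> Min SV"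
    using fin \<open>SV \<noteq> {}\<close> SV by (metis Max_in, metis Min_in)
  show "norm (A *v v) \<le> Max SV * norm v" if v: "v \<in> coord_space I"
  proof (rule power2_le_imp_le)
    have "\<mu> \<le> (Max SV)\<^sup>2"
      using max_SV fin by (metis Max_ge SV power2_eq_square mult_mono Max0)
    with max(4)[OF v] show "(norm (A *v v))\<^sup>2 \<le> (Max SV * norm v)\<^sup>2"
      unfolding vTv dot_square_norm power_mult_distrib
      by (meson mult_right_mono order_trans zero_le_power2)
  qed (use Max0 in simp)
  show "Min SV * norm v \<le> norm (A *v v)" if v: "v \<in> coord_space I"
  proof (rule power2_le_imp_le)
    have "(Min SV)\<^sup>2 \<le> - \<nu>"
      using min_SV fin Min0 by (metis Min_le SV power2_eq_square mult_mono)
    moreover have "- \<nu> * (norm v)\<^sup>2 \<le> (norm (A *v v))\<^sup>2"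
      using min(4)[OF v] by (simp add: neg vTv dot_square_norm)
    ultimately show "(Min SV * norm v)\<^sup>2 \<le> (norm (A *v v))\<^sup>2"
      unfolding power_mult_distrib
      by (meson mult_right_mono order_trans zero_le_power2)
  qed simp
qed

lemma Min_singular_values_pos:
  fixes A :: "real ^ 'n::finite ^ 'n"
  assumes A: "supported_matrix I A" and ne: "I \<noteq> {}"
    and inj: "\<And>v. v \<in> coord_space I \<Longrightarrow> A *v v = 0 \<Longrightarrow> v = 0"
  shows "0 < Min (singular_values_on I A)"
proof -
  have "Min (singular_values_on I A) \<in> singular_values_on I A"
    using finite_singular_values_on[OF A ne] singular_values_on_nonempty[OF A ne] by (rule Min_in)
  then obtain v where s: "0 \<le> Min (singular_values_on I A)" and v: "v \<noteq> 0" "v \<in> coord_space I"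
      "(transpose A ** A) *v v = (Min (singular_values_on I A))\<^sup>2 *\<^sub>R v"
    by (auto simp: singular_values_on_def coord_space_def)
  have "(norm (A *v v))\<^sup>2 = v \<bullet> ((transpose A ** A) *v v)"
    by (metis dot_lmul_matrix dot_square_norm inner_commute transpose_matrix_vector matrix_vector_mul_assoc)
  moreover have "A *v v \<noteq> 0" using inj v by blast
  ultimately have "Min (singular_values_on I A) \<noteq> 0" using v(3) by auto
  then show ?thesis using s by linarith
qed

text \<open>A symmetric form bounded by \<open>\<rho>\<close> is contracting by polarization, with \<open>w = X v\<close> rescaled to the
  length of \<open>v\<close>.\<close>

lemma symmetric_numerical_radius_bound:
  fixes X :: "real ^ 'n::finite ^ 'n"
  assumes sym: "transpose X = X" and W: "subspace W"
    and inv: "\<And>v. v \<in> W \<Longrightarrow> X *v v \<in> W"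
    and bound: "\<And>v. v \<in> W \<Longrightarrow> \<bar>v \<bullet> (X *v v)\<bar> \<le> \<rho> * (norm v)\<^sup>2"
    and v: "v \<in> W"
  shows "norm (X *v v) \<le> \<rho> * norm v"
proof (cases "X *v v = 0")
  case True
  have "0 \<le> \<rho> * (norm v)\<^sup>2" using bound[OF v] by linarith
  then show ?thesis using True
    by (cases "v = 0") (auto simp: zero_le_mult_iff)
next
  case False
  define w where "w = (norm v / norm (X *v v)) *\<^sub>R (X *v v)"
  have w: "w \<in> W" unfolding w_def by (intro subspace_scale W inv v)
  have nw: "norm w = norm v" using False by (simp add: w_def)
  have vpos: "norm v > 0" using False by auto
  have "w \<bullet> (X *v v) = norm v * norm (X *v v)"
    using False by (simp add: w_def dot_square_norm power2_eq_square)
  moreover have "4 * (w \<bullet> (X *v v)) = (v + w) \<bullet> (X *v (v + w)) - (v - w) \<bullet> (X *v (v - w))"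
    using symmetric_matrix_inner[OF sym, of v w]
    by (simp add: inner_simps matrix_vector_right_distrib matrix_vector_mult_diff_distrib)
  moreover have "(v + w) \<bullet> (X *v (v + w)) \<le> \<rho> * (norm (v + w))\<^sup>2"
    using bound[OF subspace_add[OF W v w]] by linarith
  moreover have "- ((v - w) \<bullet> (X *v (v - w))) \<le> \<rho> * (norm (v - w))\<^sup>2"
    using bound[OF subspace_diff[OF W v w]] by linarith
  moreover have "\<rho> * (norm (v + w))\<^sup>2 + \<rho> * (norm (v - w))\<^sup>2 = 4 * \<rho> * (norm v)\<^sup>2"
  proof -
    have "w \<bullet> w = v \<bullet> v" using nw by (simp flip: power2_norm_eq_inner)
    then show ?thesis
      unfolding power2_norm_eq_inner by (simp add: inner_simps inner_commute algebra_simps)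
  qed
  ultimately have "4 * (norm v * norm (X *v v)) \<le> 4 * \<rho> * (norm v)\<^sup>2"
    by linarith
  then have "norm v * norm (X *v v) \<le> norm v * (\<rho> * norm v)"
    by (simp add: power2_eq_square mult_ac)
  then show ?thesis using vpos by simp
qed

section \<open>Decay of inverses of banded matrices\<close>

text \<open>Distances are extended, so entries between unconnected indices have to vanish whatever
  \<open>b\<close> is.\<close>

definition banded :: "('n \<Rightarrow> 'n \<Rightarrow> enat) \<Rightarrow> real ^ 'n::finite ^ 'n \<Rightarrow> nat \<Rightarrow> bool" where
  "banded \<delta> A b \<longleftrightarrow> (\<forall>i j. \<delta> i j > enat b \<longrightarrow> A $ i $ j = 0)"

lemma banded_mono: "banded \<delta> A b \<Longrightarrow> b \<le> b' \<Longrightarrow> banded \<delta> A b'"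
  unfolding banded_def by (meson enat_ord_simps(1) le_less_trans)

lemma banded_transpose: "(\<And>i j. \<delta> i j = \<delta> j i) \<Longrightarrow> banded \<delta> A b \<Longrightarrow> banded \<delta> (transpose A) b"
  by (simp add: banded_def transpose_def)

lemma banded_add: "banded \<delta> A b \<Longrightarrow> banded \<delta> B b \<Longrightarrow> banded \<delta> (A + B) b"
  by (simp add: banded_def)

lemma banded_diff: "banded \<delta> A b \<Longrightarrow> banded \<delta> B b \<Longrightarrow> banded \<delta> (A - B) b"
  by (simp add: banded_def)

lemma banded_scaleR: "banded \<delta> A b \<Longrightarrow> banded \<delta> (c *\<^sub>R A) b"
  by (simp add: banded_def)

lemma banded_mult:
  assumes tri: "\<And>i j k. \<delta> i k \<le> \<delta> i j + \<delta> j k"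
    and A: "banded \<delta> A a" and B: "banded \<delta> B b"
  shows "banded \<delta> (A ** B) (a + b)"
  unfolding banded_def
proof (intro allI impI)
  fix i j assume ij: "\<delta> i j > enat (a + b)"
  have "A $ i $ k * B $ k $ j = 0" for k
  proof (rule ccontr)
    assume "A $ i $ k * B $ k $ j \<noteq> 0"
    then have "\<delta> i k \<le> enat a" "\<delta> k j \<le> enat b"
      using A B by (auto simp: banded_def not_less[symmetric])
    then have "\<delta> i j \<le> enat a + enat b"
      using tri by (meson add_mono order_trans)
    then show False using ij by simp
  qed
  then show "(A ** B) $ i $ j = 0"
    unfolding matrix_matrix_mult_def vec_lambda_beta by (rule sum.neutral[OF ballI])
qed

text \<open>
  With \<open>X = 1 - \<tau> A\<^sup>T A\<close> one has \<open>A\<^sup>-\<^sup>1 = X\<^sup>n A\<^sup>-\<^sup>1 + \<tau> \<Sum>\<^bsub>j<n\<^esub> X\<^sup>j A\<^sup>T\<close>, where the sum has bandwidth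
  \<open>(2 n - 1) b\<close>, and \<open>\<tau> = 2 / (\<sigma>1\<^sup>2 + \<sigma>0\<^sup>2)\<close> makes \<open>X\<close> a contraction with factor \<open>\<rho>\<close>.
\<close>

lemma inverse_entry_decay:
  fixes A :: "real ^ 'n::finite ^ 'n" and \<delta> :: "'n \<Rightarrow> 'n \<Rightarrow> enat"
  assumes A: "supported_matrix I A" and ne: "I \<noteq> {}" and B: "is_inverse_on I A B"
    and pos: "0 < Min (singular_values_on I A)"
    and refl: "\<And>i. \<delta> i i = 0" and sym: "\<And>i j. \<delta> i j = \<delta> j i"
    and tri: "\<And>i j k. \<delta> i k \<le> \<delta> i j + \<delta> j k"
    and band: "banded \<delta> A b"
    and far: "n = 0 \<or> \<delta> i j > enat ((2 * n - 1) * b)"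
  defines "\<sigma>0 \<equiv> Min (singular_values_on I A)" and "\<sigma>1 \<equiv> Max (singular_values_on I A)"
  shows "\<bar>B $ i $ j\<bar> \<le> ((\<sigma>1\<^sup>2 - \<sigma>0\<^sup>2) / (\<sigma>1\<^sup>2 + \<sigma>0\<^sup>2)) ^ n / \<sigma>0"
proof -
  note fin = finite_singular_values_on[OF A ne] and nonempty = singular_values_on_nonempty[OF A ne]
  have \<sigma>: "0 < \<sigma>0" "\<sigma>0 \<le> \<sigma>1"
    using pos fin nonempty by (auto simp: \<sigma>0_def \<sigma>1_def intro: Min_le_iff[THEN iffD2])
  define s where "s = \<sigma>1\<^sup>2 + \<sigma>0\<^sup>2"
  define \<rho> where "\<rho> = (\<sigma>1\<^sup>2 - \<sigma>0\<^sup>2) / s"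
  have s: "s > 0" using \<sigma> by (simp add: s_def add_nonneg_pos)
  define X where "X = mat 1 - (2 / s) *\<^sub>R (transpose A ** A)"
  have Xv: "X *v v = v - (2 / s) *\<^sub>R (transpose A *v (A *v v))" for v
    by (simp add: X_def matrix_vector_mult_diff_rdistrib scaleR_matrix_vector_assoc[symmetric]
        matrix_vector_mul_assoc)
  have vXv: "v \<bullet> (X *v v) = (norm v)\<^sup>2 - 2 / s * (norm (A *v v))\<^sup>2" for v
  proof -
    have "v \<bullet> (transpose A *v (A *v v)) = (norm (A *v v))\<^sup>2"
      by (metis dot_lmul_matrix dot_square_norm inner_commute transpose_matrix_vector)
    then show ?thesis by (simp add: Xv inner_simps dot_square_norm)
  qed
  have inv: "X *v v \<in> coord_space I" if "v \<in> coord_space I" for v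
    unfolding Xv using that
    by (intro subspace_diff subspace_scale subspace_coord_space supported_matrix_vector
        supported_matrix_transpose A)
  \<comment> \<open>The bounds on \<open>norm (A *v u)\<close> place the quotient of the form of
    \<open>X\<close> between \<open>1 - 2 \<sigma>1\<^sup>2 / s = - \<rho>\<close> and
    \<open>1 - 2 \<sigma>0\<^sup>2 / s = \<rho>\<close>; this balance determines the factor
    \<open>2 / s\<close>.\<close>
  have contr: "norm (X *v v) \<le> \<rho> * norm v" if v: "v \<in> coord_space I" for v
  proof (rule symmetric_numerical_radius_bound[of X "coord_space I"])
    show "transpose X = X"
      by (simp add: X_def vec_eq_iff transpose_def mat_def matrix_matrix_mult_def mult.commute)
    fix u assume u: "u \<in> coord_space I"
    have "(norm (A *v u))\<^sup>2 \<le> (\<sigma>1 * norm u)\<^sup>2"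
      using sigma_max_bound[OF A ne u] by (intro power_mono) (auto simp: \<sigma>1_def)
    then have 1: "(norm (A *v u))\<^sup>2 \<le> \<sigma>1\<^sup>2 * (norm u)\<^sup>2" by (simp add: power_mult_distrib)
    have "(\<sigma>0 * norm u)\<^sup>2 \<le> (norm (A *v u))\<^sup>2"
      using sigma_min_bound[OF A ne u] \<sigma> by (intro power_mono) (auto simp: \<sigma>0_def)
    then have 2: "\<sigma>0\<^sup>2 * (norm u)\<^sup>2 \<le> (norm (A *v u))\<^sup>2" by (simp add: power_mult_distrib)
    have "s * (u \<bullet> (X *v u)) = s * (norm u)\<^sup>2 - 2 * (norm (A *v u))\<^sup>2"
      using s by (simp add: vXv field_simps)
    then have "\<bar>s * (u \<bullet> (X *v u))\<bar> \<le> (\<sigma>1\<^sup>2 - \<sigma>0\<^sup>2) * (norm u)\<^sup>2"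
      using 1 2 by (simp add: s_def abs_le_iff algebra_simps)
    then have "s * \<bar>u \<bullet> (X *v u)\<bar> \<le> (\<sigma>1\<^sup>2 - \<sigma>0\<^sup>2) * (norm u)\<^sup>2"
      using s by (simp add: abs_mult)
    then show "\<bar>u \<bullet> (X *v u)\<bar> \<le> \<rho> * (norm u)\<^sup>2"
      using s by (simp add: \<rho>_def field_simps)
  qed (use v inv subspace_coord_space in auto)
  have \<rho>: "0 \<le> \<rho>"
    using \<sigma> s by (simp add: \<rho>_def power_mono)

  have supB: "supported_matrix I B" and AB: "A ** B = id_on I"
    using B by (auto simp: is_inverse_on_def supported_matrix_def)
  have step: "X ** B + (2 / s) *\<^sub>R transpose A = B"
  proof -
    have "X ** B = B - (2 / s) *\<^sub>R (transpose A ** (A ** B))"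
      by (simp add: X_def matrix_diff_rdistrib scalar_matrix_assoc[symmetric] matrix_mul_assoc)
    then show ?thesis
      using supported_matrix_id_right[OF supported_matrix_transpose[OF A]] AB by simp
  qed
  have bandX: "banded \<delta> X (2 * b)"
  proof -
    have "banded \<delta> (transpose A ** A) (b + b)"
      by (intro banded_mult banded_transpose tri sym band)
    moreover have "banded \<delta> (mat 1) (2 * b)"
      using refl by (auto simp: banded_def mat_def)
    ultimately show ?thesis
      unfolding X_def by (intro banded_diff banded_scaleR) (simp_all add: mult_2)
  qed
  \<comment> \<open>Iterating \<open>step\<close>. The remainder \<open>R = 0\<close> at
    \<open>n = 0\<close> is tracked separately: there \<open>2 * n - 1\<close> truncates to
    \<open>0\<close>, and the first term \<open>transpose A\<close> adds only \<open>b\<close>,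
    whereas every later step adds \<open>2 * b\<close>.\<close>
  have "\<exists>R. B = (((**) X) ^^ n) B + R \<and> (n = 0 \<or> banded \<delta> R ((2 * n - 1) * b)) \<and> (n = 0 \<longrightarrow> R = 0)" for n
  proof (induction n)
    case (Suc n)
    then obtain R where R: "B = (((**) X) ^^ n) B + R"
      "n = 0 \<or> banded \<delta> R ((2 * n - 1) * b)" "n = 0 \<Longrightarrow> R = 0" by blast
    let ?R = "X ** R + (2 / s) *\<^sub>R transpose A"
    have "B = X ** ((((**) X) ^^ n) B + R) + (2 / s) *\<^sub>R transpose A"
      using step R(1) by simp
    then have "B = (((**) X) ^^ Suc n) B + ?R"
      by (simp add: matrix_add_ldistrib add.assoc)
    moreover have "banded \<delta> ?R ((2 * Suc n - 1) * b)"
    proof (rule banded_add)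
      show "banded \<delta> ((2 / s) *\<^sub>R transpose A) ((2 * Suc n - 1) * b)"
        by (rule banded_mono[of _ _ b]) (intro banded_scaleR banded_transpose sym band, simp)
      show "banded \<delta> (X ** R) ((2 * Suc n - 1) * b)"
      proof (cases "n = 0")
        case True
        then show ?thesis using R(3) by (simp add: banded_def)
      next
        case False
        then have "banded \<delta> (X ** R) (2 * b + (2 * n - 1) * b)"
          using R(2) by (intro banded_mult tri bandX) auto
        moreover have "2 * b + (2 * n - 1) * b = (2 * Suc n - 1) * b"
          using False by (cases n) (auto simp: algebra_simps)
        ultimately show ?thesis by metis
      qed
    qed
    ultimately show ?case by blast
  qed simp
  \<comment> \<open>At the distance required by \<open>far\<close> the banded part has a zero entry,
    so only the contracted part contributes.\<close>
  from this[of n] have entry: "B $ i $ j = ((((**) X) ^^ n) B) $ i $ j"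
    using far by (metis add.right_neutral banded_def vector_add_component zero_index)
  have col: "column j ((((**) X) ^^ n) B) = (((*v) X) ^^ n) (column j B)" for n
    by (induction n) (simp_all add: matrix_vector_mult_def matrix_matrix_mult_def column_def vec_eq_iff)
  have "(((*v) X) ^^ n) u \<in> coord_space I \<and> norm ((((*v) X) ^^ n) u) \<le> \<rho> ^ n * norm u"
    if "u \<in> coord_space I" for u n
  proof (induction n)
    case (Suc n)
    have "norm (X *v (((*v) X) ^^ n) u) \<le> \<rho> * norm ((((*v) X) ^^ n) u)"
      using Suc by (intro contr) auto
    also have "\<dots> \<le> \<rho> * (\<rho> ^ n * norm u)" using Suc \<rho> by (intro mult_left_mono) auto
    finally show ?case using Suc inv by simp
  qed (use that in simp)
  moreover have colB: "column j B \<in> coord_space I"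
    using supB by (auto simp: column_def coord_space_def supported_matrix_def)
  ultimately have le: "norm (column j ((((**) X) ^^ n) B)) \<le> \<rho> ^ n * norm (column j B)"
    by (simp add: col)
  \<comment> \<open>A column of the inverse is mapped by \<open>A\<close> to a unit vector or to
    zero, so its norm is at most \<open>1 / \<sigma>0\<close>.\<close>
  have "A *v column j B = column j (id_on I)"
    using AB by (auto simp: vec_eq_iff matrix_vector_mult_def matrix_matrix_mult_def column_def)
  moreover have "norm (column j (id_on I :: real ^ 'n ^ 'n)) \<le> 1"
  proof -
    have "column j (id_on I :: real ^ 'n ^ 'n) = (if j \<in> I then axis j 1 else 0)"
      by (auto simp: column_def id_on_def axis_def vec_eq_iff)
    then show ?thesis by (simp add: norm_axis_1)
  qed
  ultimately have "\<sigma>0 * norm (column j B) \<le> 1"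
    using sigma_min_bound[OF A ne colB] by (simp add: \<sigma>0_def)
  then have "norm (column j B) \<le> 1 / \<sigma>0" using \<sigma> by (simp add: field_simps)
  then have "\<rho> ^ n * norm (column j B) \<le> \<rho> ^ n / \<sigma>0"
    using \<rho> mult_left_mono[of "norm (column j B)" "1 / \<sigma>0" "\<rho> ^ n"] by simp
  moreover have "\<bar>B $ i $ j\<bar> \<le> norm (column j ((((**) X) ^^ n) B))"
    unfolding entry using component_le_norm_cart[of "column j ((((**) X) ^^ n) B)" i]
    by (simp add: column_def)
  ultimately show ?thesis using le by (simp add: \<rho>_def s_def)
qed

section \<open>Second-order conditions\<close>

lemma matrix_sum_vector:
  fixes A :: "'l \<Rightarrow> real ^ 'n::finite ^ 'm::finite"
  assumes "finite L"
  shows "(\<Sum>l\<in>L. A l) *v h = (\<Sum>l\<in>L. A l *v h)"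
  using assms by (induction L rule: finite_induct) (auto simp: matrix_vector_mult_add_rdistrib)

text \<open>Second-order differentiability at the single point \<open>x\<close>. No continuity of
  second derivatives is asked for, yet this suffices for a symmetric Hessian and for a Taylor
  expansion with small-o remainder.\<close>

definition twice_diff :: "(real ^ 'n::finite \<Rightarrow> real) \<Rightarrow> real ^ 'n \<Rightarrow> bool" where
  "twice_diff g x \<longleftrightarrow> (\<forall>\<^sub>F y in nhds x. g differentiable (at y)) \<and> grad g differentiable (at x)"

definition hess :: "(real ^ 'n::finite \<Rightarrow> real) \<Rightarrow> real ^ 'n \<Rightarrow> real ^ 'n ^ 'n" where
  "hess g x = jacobian (grad g) (at x)"

lemma has_derivative_grad:
  assumes "g differentiable (at x)"
  shows "(g has_derivative (\<lambda>h. grad g x \<bullet> h)) (at x)"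
proof -
  let ?f = "frechet_derivative g (at x)"
  have f: "(g has_derivative ?f) (at x)" using assms by (simp add: frechet_derivative_works)
  then have lin: "linear ?f" by (rule has_derivative_linear)
  have "?f h = grad g x \<bullet> h" for h
  proof -
    have "?f h = ?f (\<Sum>j\<in>UNIV. h $ j *\<^sub>R axis j 1)" by (simp add: basis_expansion scalar_mult_eq_scaleR[symmetric])
    also have "\<dots> = (\<Sum>j\<in>UNIV. h $ j * ?f (axis j 1))"
      using lin by (simp add: linear_sum linear_scale)
    finally show ?thesis by (simp add: grad_def inner_vec_def mult.commute)
  qed
  then show ?thesis using f by (metis (no_types, lifting) ext)
qed

lemma grad_unique:
  assumes "(g has_derivative (\<lambda>h. v \<bullet> h)) (at x)"
  shows "grad g x = v"
proof -
  have "frechet_derivative g (at x) = (\<lambda>h. v \<bullet> h)"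
    using assms by (metis frechet_derivative_at)
  then show ?thesis by (simp add: grad_def vec_eq_iff inner_axis)
qed

lemma jacobian_unique:
  fixes f :: "real ^ 'n::finite \<Rightarrow> real ^ 'm::finite"
  assumes "(f has_derivative (\<lambda>h. A *v h)) (at x)"
  shows "jacobian f (at x) = A"
    by (simp add: jacobian_def matrix_of_matrix_vector_mul flip: frechet_derivative_at[OF assms])

lemma twice_diff_hess:
  "twice_diff g x \<Longrightarrow> (grad g has_derivative (\<lambda>h. hess g x *v h)) (at x)"
  unfolding twice_diff_def hess_def using jacobian_works by blast

lemma twice_diffD: "twice_diff g x \<Longrightarrow> g differentiable (at x)"
  unfolding twice_diff_def using eventually_nhds_x_imp_x by blast

lemma grad_linear_combination:
  assumes "finite L" and "\<And>l. l \<in> L \<Longrightarrow> f l differentiable (at x)"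
  shows "grad (\<lambda>y. \<Sum>l\<in>L. a l * f l y) x = (\<Sum>l\<in>L. a l *\<^sub>R grad (f l) x)"
proof (rule grad_unique)
  have "((\<lambda>y. \<Sum>l\<in>L. a l * f l y) has_derivative (\<lambda>h. \<Sum>l\<in>L. a l * (grad (f l) x \<bullet> h))) (at x)"
    by (intro has_derivative_sum has_derivative_mult_right has_derivative_grad assms)
  then show "((\<lambda>y. \<Sum>l\<in>L. a l * f l y) has_derivative
      (\<lambda>h. (\<Sum>l\<in>L. a l *\<^sub>R grad (f l) x) \<bullet> h)) (at x)"
    by (simp add: inner_sum_left)
qed

lemma
  fixes f :: "'l \<Rightarrow> real ^ 'n::finite \<Rightarrow> real"
  assumes L: "finite L" and f: "\<And>l. l \<in> L \<Longrightarrow> twice_diff (f l) x"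
  shows twice_diff_linear_combination: "twice_diff (\<lambda>y. \<Sum>l\<in>L. a l * f l y) x"
    and hess_linear_combination:
      "hess (\<lambda>y. \<Sum>l\<in>L. a l * f l y) x = (\<Sum>l\<in>L. a l *\<^sub>R hess (f l) x)"
proof -
  let ?g = "\<lambda>y. \<Sum>l\<in>L. a l * f l y"
  have ev: "\<forall>\<^sub>F y in nhds x. \<forall>l\<in>L. f l differentiable (at y)"
    using f L by (intro eventually_ball_finite) (auto simp: twice_diff_def)
  have ev1: "\<forall>\<^sub>F y in nhds x. ?g differentiable (at y)"
    using ev by eventually_elim (use L in \<open>auto intro!: differentiable_sum differentiable_mult\<close>)
  have ev2: "\<forall>\<^sub>F y in nhds x. grad ?g y = (\<Sum>l\<in>L. a l *\<^sub>R grad (f l) y)"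
    using ev by eventually_elim (rule grad_linear_combination[OF L], auto)
  have "((\<lambda>y. \<Sum>l\<in>L. a l *\<^sub>R grad (f l) y) has_derivative
      (\<lambda>h. \<Sum>l\<in>L. a l *\<^sub>R (hess (f l) x *v h))) (at x)"
    by (intro has_derivative_sum has_derivative_scaleR_right twice_diff_hess f)
  moreover have "(\<Sum>l\<in>L. a l *\<^sub>R (hess (f l) x *v h)) = (\<Sum>l\<in>L. a l *\<^sub>R hess (f l) x) *v h" for h
    by (simp add: matrix_sum_vector L scaleR_matrix_vector_assoc)
  ultimately have "((\<lambda>y. \<Sum>l\<in>L. a l *\<^sub>R grad (f l) y) has_derivative
      (\<lambda>h. (\<Sum>l\<in>L. a l *\<^sub>R hess (f l) x) *v h)) (at x)" by simp
  moreover have "\<forall>\<^sub>F y in at x. (\<Sum>l\<in>L. a l *\<^sub>R grad (f l) y) = grad ?g y"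
    using ev2 by (auto simp: eventually_at_filter elim!: eventually_mono)
  ultimately have der: "(grad ?g has_derivative (\<lambda>h. (\<Sum>l\<in>L. a l *\<^sub>R hess (f l) x) *v h)) (at x)"
    by (rule has_derivative_transform_eventually)
      (use eventually_nhds_x_imp_x[OF ev2] in simp_all)
  show "twice_diff ?g x"
    using ev1 der by (auto simp: twice_diff_def differentiable_def)
  show "hess ?g x = (\<Sum>l\<in>L. a l *\<^sub>R hess (f l) x)"
    using jacobian_unique[OF der] by (simp add: hess_def)
qed

lemma has_derivative_at_bound:
  fixes f :: "'a::real_normed_vector \<Rightarrow> 'b::real_normed_vector"
  assumes "(f has_derivative f') (at x)" and "0 < e"
  obtains r where "0 < r" "\<And>h. norm h < r \<Longrightarrow> norm (f (x + h) - f x - f' h) \<le> e * norm h"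
proof -
  obtain r where r: "0 < r" "\<And>y. norm (y - x) < r \<Longrightarrow> norm (f y - f x - f' (y - x)) \<le> e * norm (y - x)"
    using assms by (auto simp: has_derivative_at_alt)
  show thesis using that[OF r(1)] r(2)[of "x + _"] by auto
qed

lemma twice_diff_ball:
  assumes "twice_diff g x" and "0 < e"
  obtains r where "0 < r"
    "\<And>h. norm h < r \<Longrightarrow> (g has_derivative (\<lambda>k. grad g (x + h) \<bullet> k)) (at (x + h))"
    "\<And>h. norm h < r \<Longrightarrow> norm (grad g (x + h) - grad g x - hess g x *v h) \<le> e * norm h"
proof -
  obtain r where r: "0 < r" "\<And>h. norm h < r \<Longrightarrow> norm (grad g (x + h) - grad g x - hess g x *v h) \<le> e * norm h"
    using has_derivative_at_bound[OF twice_diff_hess[OF assms(1)] assms(2)] by metis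
  obtain s where s: "0 < s" "\<And>y. dist y x < s \<Longrightarrow> g differentiable (at y)"
    using assms(1) by (auto simp: twice_diff_def eventually_nhds_metric)
  show thesis
  proof (rule that[of "min r s"])
    fix h :: "real ^ 'a" assume h: "norm h < min r s"
    show "(g has_derivative (\<lambda>k. grad g (x + h) \<bullet> k)) (at (x + h))"
      using h by (intro has_derivative_grad s) (simp add: dist_norm)
  qed (use r s in auto)
qed

lemma has_real_derivative_along_line:
  assumes "(g has_derivative (\<lambda>k. v \<bullet> k)) (at (a + t *\<^sub>R h))"
  shows "((\<lambda>t. g (a + t *\<^sub>R h)) has_real_derivative v \<bullet> h) (at t)"
proof -
  have "((\<lambda>t. a + t *\<^sub>R h) has_derivative (\<lambda>s. s *\<^sub>R h)) (at t)"
    by (auto intro!: derivative_eq_intros)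
  then have "((\<lambda>t. g (a + t *\<^sub>R h)) has_derivative (\<lambda>s. v \<bullet> (s *\<^sub>R h))) (at t)"
    using assms by (rule has_derivative_compose)
  then show ?thesis by (simp add: has_field_derivative_def mult.commute[of _ "v \<bullet> h"])
qed

text \<open>The mean value theorem is applied to \<open>g\<close> along the segment minus its
  quadratic model. The derivative of this difference is the first-order remainder of the gradient
  paired with \<open>h\<close>, hence at most \<open>e * (norm h)\<^sup>2\<close>.\<close>

lemma taylor_second_order:
  assumes g: "twice_diff g x" and e: "0 < e"
  obtains r where "0 < r" "\<And>h. norm h < r \<Longrightarrow>
    \<bar>g (x + h) - g x - grad g x \<bullet> h - (h \<bullet> (hess g x *v h)) / 2\<bar> \<le> e * (norm h)\<^sup>2"
proof -
  obtain r where r: "0 < r"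
    "\<And>h. norm h < r \<Longrightarrow> (g has_derivative (\<lambda>k. grad g (x + h) \<bullet> k)) (at (x + h))"
    "\<And>h. norm h < r \<Longrightarrow> norm (grad g (x + h) - grad g x - hess g x *v h) \<le> e * norm h"
    using twice_diff_ball[OF g e] by metis
  show thesis
  proof (rule that[OF r(1)])
    fix h :: "real ^ 'a" assume h: "norm h < r"
    let ?H = "hess g x"
    let ?f = "\<lambda>t. g (x + t *\<^sub>R h) - t * (grad g x \<bullet> h) - t\<^sup>2 * (h \<bullet> (?H *v h)) / 2"
    let ?f' = "\<lambda>t. (grad g (x + t *\<^sub>R h) - grad g x - ?H *v (t *\<^sub>R h)) \<bullet> h"
    have small: "norm (t *\<^sub>R h) < r" if "0 \<le> t" "t \<le> 1" for t
      using that h mult_left_le_one_le[of "norm h" t] by simp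
    have "(?f has_real_derivative ?f' t) (at t)" if "0 \<le> t" "t \<le> 1" for t
    proof -
      have "((\<lambda>t. g (x + t *\<^sub>R h)) has_real_derivative grad g (x + t *\<^sub>R h) \<bullet> h) (at t)"
        by (intro has_real_derivative_along_line r(2) small that)
      then have "(?f has_real_derivative grad g (x + t *\<^sub>R h) \<bullet> h - grad g x \<bullet> h - t * (h \<bullet> (?H *v h))) (at t)"
        by (auto intro!: derivative_eq_intros)
      then show ?thesis
        by (simp add: inner_simps inner_commute matrix_vector_mult_scaleR)
    qed
    then obtain t where t: "0 < t" "t < 1" "?f 1 - ?f 0 = (1 - 0) * ?f' t"
      using MVT2[of 0 1 ?f ?f'] by auto
    have "\<bar>?f' t\<bar> \<le> norm (grad g (x + t *\<^sub>R h) - grad g x - ?H *v (t *\<^sub>R h)) * norm h"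
      by (rule Cauchy_Schwarz_ineq2)
    also have "\<dots> \<le> e * norm (t *\<^sub>R h) * norm h"
      using t by (intro mult_right_mono r(3) small) auto
    also have "\<dots> \<le> e * norm h * norm h"
      using t e by (intro mult_right_mono mult_left_mono) (auto simp: mult_left_le_one_le)
    finally show "\<bar>g (x + h) - g x - grad g x \<bullet> h - (h \<bullet> (?H *v h)) / 2\<bar> \<le> e * (norm h)\<^sup>2"
      using t(3) by (simp add: power2_eq_square)
  qed
qed

text \<open>The second difference \<open>D u v s\<close> is symmetric in \<open>u\<close> and
  \<open>v\<close>. By the mean value theorem along \<open>v\<close> it equals
  \<open>s\<^sup>2 * (v \<bullet> (H *v u))\<close> up to an error that is small relative to
  \<open>s\<^sup>2\<close>; exchanging the roles and dividing by \<open>s\<^sup>2\<close> gives the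
  claim.\<close>

lemma hess_symmetric:
  assumes g: "twice_diff g x"
  shows "u \<bullet> (hess g x *v v) = v \<bullet> (hess g x *v u)"
proof -
  let ?H = "hess g x"
  define D where "D u v s = g (x + s *\<^sub>R u + s *\<^sub>R v) - g (x + s *\<^sub>R u) - g (x + s *\<^sub>R v) + g x" for u v s
  define n where "n = norm u + norm v + 1"
  have n: "n > 0" unfolding n_def by (intro add_nonneg_pos) auto
  have "\<bar>u \<bullet> (?H *v v) - v \<bullet> (?H *v u)\<bar> \<le> e" if "e > 0" for e
  proof -
    \<comment> \<open>Chosen so that two errors of size \<open>2 * d * s\<^sup>2 * n\<^sup>2\<close>
      add up to \<open>s\<^sup>2 * e\<close>.\<close>
    define d where "d = e / (4 * n\<^sup>2)"
    have d: "d > 0" using that n by (simp add: d_def)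
    obtain r where r: "0 < r"
      "\<And>h. norm h < r \<Longrightarrow> (g has_derivative (\<lambda>k. grad g (x + h) \<bullet> k)) (at (x + h))"
      "\<And>h. norm h < r \<Longrightarrow> norm (grad g (x + h) - grad g x - hess g x *v h) \<le> d * norm h"
      using twice_diff_ball[OF g d] by metis
    define s where "s = r / (2 * n)"
    have s: "s > 0" "s * n < r" using r(1) n by (auto simp: s_def)
    have key: "\<bar>D u v s - s\<^sup>2 * (v \<bullet> (?H *v u))\<bar> \<le> 2 * d * s\<^sup>2 * n\<^sup>2"
      if uv: "norm u + norm v \<le> n" for u v :: "real ^ 'a"
    proof -
      have uvn: "norm u \<le> n" "norm v \<le> n" using uv norm_ge_zero[of u] norm_ge_zero[of v] by linarith+
      let ?a = "\<lambda>t. s *\<^sub>R u + t *\<^sub>R (s *\<^sub>R v)" and ?b = "\<lambda>t. t *\<^sub>R (s *\<^sub>R v)"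
      let ?f = "\<lambda>t. g (x + s *\<^sub>R u + t *\<^sub>R (s *\<^sub>R v)) - g (x + t *\<^sub>R (s *\<^sub>R v))"
      let ?f' = "\<lambda>t. grad g (x + ?a t) \<bullet> (s *\<^sub>R v) - grad g (x + ?b t) \<bullet> (s *\<^sub>R v)"
      have b: "norm (?b t) \<le> s * n" if "0 \<le> t" "t \<le> 1" for t
      proof -
        have "norm (?b t) = t * (s * norm v)" using that s by simp
        also have "\<dots> \<le> 1 * (s * n)" using that s uvn by (intro mult_mono) auto
        finally show ?thesis by simp
      qed
      have a: "norm (?a t) \<le> s * n" if "0 \<le> t" "t \<le> 1" for t
      proof -
        have "norm (?a t) \<le> s * norm u + t * (s * norm v)"
          using that s norm_triangle_ineq[of "s *\<^sub>R u" "?b t"] by simp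
        also have "t * (s * norm v) \<le> 1 * (s * norm v)"
          using that s by (intro mult_right_mono) auto
        also have "s * norm u + 1 * (s * norm v) \<le> s * n"
          using uv s by (simp flip: distrib_left)
        finally show ?thesis by simp
      qed
      have "(?f has_real_derivative ?f' t) (at t)" if "0 \<le> t" "t \<le> 1" for t
      proof -
        have "norm (?a t) < r" "norm (?b t) < r"
          using a[OF that] b[OF that] s by linarith+
        note r(2)[OF this(1)] r(2)[OF this(2)]
        then show ?thesis
          by (intro DERIV_diff has_real_derivative_along_line) (simp_all add: add.assoc)
      qed
      then obtain t where t: "0 < t" "t < 1" "?f 1 - ?f 0 = (1 - 0) * ?f' t"
        using MVT2[of 0 1 ?f ?f'] by auto
      let ?p = "grad g (x + ?a t) - grad g x - ?H *v ?a t"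
      let ?q = "grad g (x + ?b t) - grad g x - ?H *v ?b t"
      have "D u v s = ?f' t" using t(3) by (simp add: D_def)
      also have "\<dots> = (?p - ?q) \<bullet> (s *\<^sub>R v) + s\<^sup>2 * (v \<bullet> (?H *v u))"
        by (simp add: inner_simps inner_commute matrix_vector_right_distrib power2_eq_square algebra_simps)
      finally have "\<bar>D u v s - s\<^sup>2 * (v \<bullet> (?H *v u))\<bar> = \<bar>(?p - ?q) \<bullet> (s *\<^sub>R v)\<bar>" by simp
      also have "\<dots> \<le> norm (?p - ?q) * norm (s *\<^sub>R v)" by (rule Cauchy_Schwarz_ineq2)
      also have "\<dots> \<le> (d * (s * n) + d * (s * n)) * (s * n)"
      proof (rule mult_mono)
        have at: "norm (?a t) \<le> s * n" and bt: "norm (?b t) \<le> s * n"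
          using a b t by auto
        have "norm ?p \<le> d * norm (?a t)" using at s by (intro r(3)) auto
        moreover have "norm ?q \<le> d * norm (?b t)" using bt s by (intro r(3)) auto
        moreover have "d * norm (?a t) \<le> d * (s * n)" "d * norm (?b t) \<le> d * (s * n)"
          using at bt d by (intro mult_left_mono; simp)+
        ultimately show "norm (?p - ?q) \<le> d * (s * n) + d * (s * n)"
          using norm_triangle_ineq4[of ?p ?q] by linarith
      qed (use s d n uvn in auto)
      finally show ?thesis by (simp add: power2_eq_square algebra_simps)
    qed
    have "norm u + norm v \<le> n" "norm v + norm u \<le> n" by (auto simp: n_def)
    note 1 = key[OF this(1)] and 2 = key[OF this(2)]
    have "D v u s = D u v s" by (simp add: D_def add_ac)
    with 1 2 have "\<bar>s\<^sup>2 * (u \<bullet> (?H *v v)) - s\<^sup>2 * (v \<bullet> (?H *v u))\<bar> \<le> 4 * d * s\<^sup>2 * n\<^sup>2"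
      by linarith
    then have "s\<^sup>2 * \<bar>u \<bullet> (?H *v v) - v \<bullet> (?H *v u)\<bar> \<le> s\<^sup>2 * e"
      using n s by (simp add: d_def abs_mult flip: right_diff_distrib)
    then show ?thesis using s by simp
  qed
  then show ?thesis using zero_less_abs_iff dense not_le by (metis eq_iff_diff_eq_0)
qed

text \<open>\<open>dir\<close> only asks that \<open>u\<close> be approximated by directions
  \<open>w = h / t\<close> along which \<open>g\<close> does not drop. The gradient vanishes, so the
  Taylor expansion divided by \<open>t\<^sup>2\<close> bounds the form at \<open>w\<close> from
  below, and \<open>w\<close> tends to \<open>u\<close>.\<close>

lemma second_order_necessary:
  assumes g: "twice_diff g x" and crit: "grad g x = 0"
    and dir: "\<And>e. 0 < e \<Longrightarrow> \<exists>t>0. \<exists>h. norm h < e \<and> norm (h - t *\<^sub>R u) \<le> e * t \<and> g x \<le> g (x + h)"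
  shows "0 \<le> u \<bullet> (hess g x *v u)"
proof -
  let ?H = "hess g x"
  have "\<exists>w. norm (w - u) \<le> e \<and> 0 \<le> (w \<bullet> (?H *v w)) / 2 + e * (norm w)\<^sup>2" if e: "e > 0" for e
  proof -
    obtain r where r: "0 < r" "\<And>h. norm h < r \<Longrightarrow>
      \<bar>g (x + h) - g x - grad g x \<bullet> h - (h \<bullet> (?H *v h)) / 2\<bar> \<le> e * (norm h)\<^sup>2"
      using taylor_second_order[OF g e] by metis
    have "min e r > 0" using e r by simp
    from dir[OF this] obtain t h where t: "t > 0" and h: "norm h < min e r"
      "norm (h - t *\<^sub>R u) \<le> min e r * t" "g x \<le> g (x + h)" by auto
    have "\<bar>g (x + h) - g x - (h \<bullet> (?H *v h)) / 2\<bar> \<le> e * (norm h)\<^sup>2"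
      using r(2)[of h] h crit by simp
    then have 1: "0 \<le> (h \<bullet> (?H *v h)) / 2 + e * (norm h)\<^sup>2"
      using h(3) by linarith
    define w where "w = h /\<^sub>R t"
    have hw: "h = t *\<^sub>R w" using t by (simp add: w_def)
    have "0 \<le> t\<^sup>2 * ((w \<bullet> (?H *v w)) / 2 + e * (norm w)\<^sup>2)"
      using 1 by (simp add: hw power_mult_distrib power2_eq_square algebra_simps)
    then have "0 \<le> (w \<bullet> (?H *v w)) / 2 + e * (norm w)\<^sup>2"
      using t by (simp add: zero_le_mult_iff)
    moreover have "t * norm (w - u) \<le> t * e"
    proof -
      have "t * norm (w - u) = norm (h - t *\<^sub>R u)"
        using t by (simp add: hw flip: scaleR_diff_right)
      also have "\<dots> \<le> e * t"
        using h(2) t by (meson min.cobounded1 mult_right_mono order_trans less_imp_le)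
      finally show ?thesis by (simp add: mult.commute)
    qed
    ultimately show ?thesis using t by auto
  qed
  then have "\<exists>w. norm (w - u) \<le> inverse (real (Suc k)) \<and>
      0 \<le> (w \<bullet> (?H *v w)) / 2 + inverse (real (Suc k)) * (norm w)\<^sup>2" for k
    by simp
  then obtain w where w: "\<And>k. norm (w k - u) \<le> inverse (real (Suc k))"
    "\<And>k. 0 \<le> (w k \<bullet> (?H *v w k)) / 2 + inverse (real (Suc k)) * (norm (w k))\<^sup>2"
    by metis
  have lim0: "(\<lambda>k. inverse (real (Suc k))) \<longlonglongrightarrow> 0" by (rule LIMSEQ_inverse_real_of_nat)
  have lim: "w \<longlonglongrightarrow> u"
    by (rule Lim_transform2[OF tendsto_const])
      (rule Lim_null_comparison[OF _ lim0], use w(1) in \<open>simp add: norm_minus_commute\<close>)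
  have "(\<lambda>k. (w k \<bullet> (?H *v w k)) / 2 + inverse (real (Suc k)) * (norm (w k))\<^sup>2)
      \<longlonglongrightarrow> (u \<bullet> (?H *v u)) / 2 + 0 * (norm u)\<^sup>2"
    by (intro tendsto_intros lim lim0 bounded_linear.tendsto[OF matrix_vector_mul_bounded_linear]) simp
  then have "0 \<le> (u \<bullet> (?H *v u)) / 2 + 0 * (norm u)\<^sup>2"
    by (rule LIMSEQ_le_const) (use w(2) in auto)
  then show ?thesis by simp
qed

text \<open>\<open>w l\<close> is the component \<open>z\<close> of \<open>b l\<close> orthogonal to
  the other vectors, divided by \<open>z \<bullet> z\<close>; independence makes \<open>z\<close>
  nonzero. The dual family serves both to straighten constraint manifolds and to read off
  coefficients of linear combinations.\<close>

lemma independent_dual_family: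
  fixes b :: "'l \<Rightarrow> 'a::euclidean_space"
  assumes inj: "inj_on b L" and ind: "independent (b ` L)"
  obtains w where "\<And>k l. k \<in> L \<Longrightarrow> l \<in> L \<Longrightarrow> b k \<bullet> w l = (if k = l then 1 else 0)"
proof -
  have "\<exists>w. \<forall>k\<in>L. b k \<bullet> w = (if k = l then 1 else 0)" if l: "l \<in> L" for l
  proof -
    obtain y z where yz: "y \<in> span (b ` L - {b l})"
      "\<And>w. w \<in> span (b ` L - {b l}) \<Longrightarrow> orthogonal z w" "b l = y + z"
      using orthogonal_subspace_decomp_exists[of "b ` L - {b l}" "b l"] by metis
    have "z \<noteq> 0"
      using ind l yz unfolding dependent_def by auto
    then have zz: "z \<bullet> z \<noteq> 0" by simp
    have "b k \<bullet> (z /\<^sub>R (z \<bullet> z)) = (if k = l then 1 else 0)" if k: "k \<in> L" for k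
    proof (cases "k = l")
      case True
      have "y \<bullet> z = 0" using yz(1,2) by (simp add: orthogonal_def inner_commute)
      then show ?thesis using True zz yz(3) by (simp add: inner_left_distrib)
    next
      case False
      then have "b k \<in> b ` L - {b l}" using inj k l by (auto dest: inj_onD)
      then have "z \<bullet> b k = 0" using yz(2) span_base by (metis orthogonal_def)
      then show ?thesis using False by (simp add: inner_commute)
    qed
    then show ?thesis by blast
  qed
  then show thesis using that by metis
qed

text \<open>
  For \<open>w\<close> dual to the gradients \<open>b\<close>, the map \<open>\<Phi>(y) = y + \<Sum>\<^bsub>l\<^esub> (c\<^sub>l(y) - b\<^sub>l \<bullet> (y - x)) w\<^sub>l\<close> has derivative
  \<open>1\<close> at \<open>x\<close> and satisfies \<open>b\<^sub>l \<bullet> (\<Phi>(y) - x) = c\<^sub>l(y)\<close>, so preimages of \<open>x + t u\<close> lie on the constraint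
  manifold.
\<close>

lemma feasible_direction:
  fixes c :: "'l \<Rightarrow> real ^ 'n::finite \<Rightarrow> real"
  assumes L: "finite L" and c: "\<And>l. l \<in> L \<Longrightarrow> twice_diff (c l) x" and c0: "\<And>l. l \<in> L \<Longrightarrow> c l x = 0"
    and inj: "inj_on (\<lambda>l. grad (c l) x) L" and ind: "independent ((\<lambda>l. grad (c l) x) ` L)"
    and u: "\<And>l. l \<in> L \<Longrightarrow> grad (c l) x \<bullet> u = 0" and e: "0 < e"
  shows "\<exists>t>0. \<exists>h. norm h < e \<and> norm (h - t *\<^sub>R u) \<le> e * t \<and> (\<forall>l\<in>L. c l (x + h) = 0)"
proof -
  define b where "b = (\<lambda>l. grad (c l) x)"
  obtain w where w: "\<And>k l. k \<in> L \<Longrightarrow> l \<in> L \<Longrightarrow> b k \<bullet> w l = (if k = l then 1 else 0)"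
    using independent_dual_family[OF inj ind] unfolding b_def by metis
  define \<Phi> where "\<Phi> y = y + (\<Sum>l\<in>L. (c l y - b l \<bullet> (y - x)) *\<^sub>R w l)" for y
  have \<Phi>x: "\<Phi> x = x" using c0 by (simp add: \<Phi>_def)
  have \<Phi>b: "b k \<bullet> (\<Phi> y - x) = c k y" if k: "k \<in> L" for k y
  proof -
    have "b k \<bullet> (\<Phi> y - x) = b k \<bullet> (y - x) + (\<Sum>l\<in>L. (c l y - b l \<bullet> (y - x)) * (b k \<bullet> w l))"
      by (simp add: \<Phi>_def inner_sum_right inner_simps)
    also have "(\<Sum>l\<in>L. (c l y - b l \<bullet> (y - x)) * (b k \<bullet> w l)) = 
        (\<Sum>l\<in>L. if l = k then c k y - b k \<bullet> (y - x) else 0)"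
      by (intro sum.cong) (auto simp: w k)
    also have "\<dots> = c k y - b k \<bullet> (y - x)" using k L by simp
    finally show ?thesis by simp
  qed
  have "\<forall>\<^sub>F y in nhds x. \<forall>l\<in>L. c l differentiable (at y)"
    using c L by (intro eventually_ball_finite) (auto simp: twice_diff_def)
  then obtain S where S: "open S" "x \<in> S" "\<And>y l. y \<in> S \<Longrightarrow> l \<in> L \<Longrightarrow> c l differentiable (at y)"
    by (auto simp: eventually_nhds)
  have "continuous_on S (c l)" if "l \<in> L" for l
    using S that by (auto intro!: continuous_at_imp_continuous_on differentiable_imp_continuous_within)
  then have cont: "continuous_on S \<Phi>"
    unfolding \<Phi>_def by (intro continuous_intros) auto
  have der: "(\<Phi> has_derivative id) (at x)"
  proof -
    have "(\<Phi> has_derivative (\<lambda>h. h + (\<Sum>l\<in>L. (b l \<bullet> h - b l \<bullet> h) *\<^sub>R w l))) (at x)"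
      unfolding \<Phi>_def b_def
      by (intro has_derivative_add has_derivative_sum has_derivative_scaleR_left has_derivative_diff
          has_derivative_grad twice_diffD c has_derivative_ident)
        (auto intro!: derivative_eq_intros)
    then show ?thesis by (simp add: id_def)
  qed
  \<comment> \<open>The bound \<open>1 / 2\<close> lets the error be absorbed, giving
    \<open>norm h \<le> 2 * (t * norm u)\<close>; the other bound then turns
    \<open>d * norm h\<close> into at most \<open>e * t\<close>.\<close>
  define d where "d = min (1 / 2) (e / (2 * norm u + 1))"
  have d: "0 < d" "d \<le> 1 / 2" using e unfolding d_def by (simp add: add_nonneg_pos, intro min.cobounded1)
  have du: "d * (2 * norm u) \<le> e"
  proof -
    have "d * (2 * norm u) \<le> e / (2 * norm u + 1) * (2 * norm u)"
      by (intro mult_right_mono) (auto simp: d_def)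
    also have "\<dots> \<le> e"
      using e by (simp add: divide_le_eq add_nonneg_pos) 
    finally show ?thesis .
  qed
  obtain r where r: "0 < r" "\<And>h. norm h < r \<Longrightarrow> norm (\<Phi> (x + h) - \<Phi> x - id h) \<le> d * norm h"
    using has_derivative_at_bound[OF der d(1)] by metis
  define T where "T = ball x (min r e) \<inter> S"
  have "\<Phi> x \<in> interior (\<Phi> ` T)"
  \<comment> \<open>This open mapping theorem needs continuity near \<open>x\<close> but a
    derivative only at \<open>x\<close> itself, which is all that \<open>twice_diff\<close> provides
    for \<open>\<Phi>\<close>. Restricting to \<open>T\<close> makes the preimages close to
    \<open>x\<close>.\<close>
  proof (rule sussmann_open_mapping[OF S(1) cont S(2) der, where g' = id])
    show "x \<in> interior T" using S r e by (simp add: T_def interior_open open_Int)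
  qed (auto simp: T_def bounded_linear_ident id_def)
  then obtain \<delta> where \<delta>: "\<delta> > 0" "ball x \<delta> \<subseteq> \<Phi> ` T"
    unfolding \<Phi>x mem_interior by blast
  define t where "t = \<delta> / (2 * (norm u + 1))"
  have t: "t > 0" using \<delta> by (simp add: t_def add_nonneg_pos)
  have "t * norm u < \<delta>"
  proof -
    have "t * norm u \<le> t * (norm u + 1)" using t by simp
    also have "\<dots> = \<delta> / 2"
    proof -
      have "norm u + 1 \<noteq> 0" using norm_ge_zero[of u] by linarith
      then show ?thesis by (simp add: t_def divide_simps)
    qed
    finally show ?thesis using \<delta> by linarith
  qed
  then have "x + t *\<^sub>R u \<in> ball x \<delta>" using t by (simp add: dist_norm)
  with \<delta>(2) have "x + t *\<^sub>R u \<in> \<Phi> ` T" by (rule subsetD)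
  then obtain y where y: "y \<in> T" "\<Phi> y = x + t *\<^sub>R u" by (metis imageE)
  define h where "h = y - x"
  have yh: "y = x + h" by (simp add: h_def)
  have nh: "norm h < r" "norm h < e"
    using y(1) by (auto simp: T_def h_def dist_norm norm_minus_commute)
  have hd: "norm (h - t *\<^sub>R u) \<le> d * norm h"
    using r(2)[OF nh(1)] y(2) by (simp add: \<Phi>x yh norm_minus_commute)
  moreover have "norm h \<le> 2 * (t * norm u)"
  proof -
    have "norm h \<le> norm (h - t *\<^sub>R u) + norm (t *\<^sub>R u)"
      using norm_triangle_ineq[of "h - t *\<^sub>R u" "t *\<^sub>R u"] by simp
    also have "\<dots> \<le> 1 / 2 * norm h + t * norm u"
      using hd t d by (intro add_mono order.trans[OF hd] mult_right_mono) auto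
    finally show ?thesis by linarith
  qed
  ultimately have "norm (h - t *\<^sub>R u) \<le> d * (2 * (t * norm u))"
    using d by (meson less_imp_le mult_left_mono order_trans)
  also have "\<dots> = d * (2 * norm u) * t" by simp
  also have "\<dots> \<le> e * t" using du t by (intro mult_right_mono) auto
  finally have "norm (h - t *\<^sub>R u) \<le> e * t" .
  moreover have "c l (x + h) = 0" if l: "l \<in> L" for l
    using \<Phi>b[OF l, of y] y(2) u[OF l] by (simp add: yh b_def)
  ultimately show ?thesis using nh(2) t by blast
qed

text \<open>Passing to the limit in one-sided difference quotients. It yields both the gradient
  inequality of a convex function and the sign of a constraint derivative along a feasible
  segment.\<close>

lemma directional_derivative_upper_bound:
  assumes f: "f differentiable (at x)"
    and le: "\<And>s. 0 < s \<Longrightarrow> s < 1 \<Longrightarrow> f (x + s *\<^sub>R h) \<le> f x + s * a"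
  shows "grad f x \<bullet> h \<le> a"
proof -
  have "((\<lambda>s. f (x + s *\<^sub>R h)) has_real_derivative grad f x \<bullet> h) (at 0)"
    by (rule has_real_derivative_along_line) (use has_derivative_grad[OF f] in simp)
  then have "((\<lambda>s. (f (x + s *\<^sub>R h) - f x) / s) \<longlongrightarrow> grad f x \<bullet> h) (at 0)"
    by (simp add: has_field_derivative_iff)
  then have lim: "((\<lambda>s. (f (x + s *\<^sub>R h) - f x) / s) \<longlongrightarrow> grad f x \<bullet> h) (at_right 0)"
    by (rule filterlim_mono) (auto simp: at_le)
  have "\<forall>\<^sub>F s in at_right (0::real). s \<in> {0<..<1}"
    by (rule eventually_at_right_real) simp
  moreover have "(f (x + s *\<^sub>R h) - f x) / s \<le> a" if "s \<in> {0<..<1}" for s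
    using le[of s] that by (simp add: divide_le_eq mult.commute)
  ultimately have "\<forall>\<^sub>F s in at_right 0. (f (x + s *\<^sub>R h) - f x) / s \<le> a"
    by (rule eventually_mono)
  then show ?thesis
    using tendsto_upperbound[OF lim] by simp
qed

text \<open>
  \<open>x\<close> minimizes \<open>\<phi>\<close> over the convex set \<open>C\<close>, since for \<open>y \<in> C\<close> the active constraints do not increase
  along the segment from \<open>x\<close> to \<open>y\<close>. Hence the Lagrangian, which equals \<open>\<phi>\<close> on the active
  manifold, is minimal at \<open>x\<close> along the curves of \<open>feasible_direction\<close>.
\<close>

lemma convex_second_order_condition:
  fixes c :: "'l \<Rightarrow> real ^ 'n::finite \<Rightarrow> real" and m :: "'l \<Rightarrow> real"
    and E J :: "'l set" and x :: "real ^ 'n"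
  defines "C \<equiv> {y. (\<forall>l\<in>E. c l y = 0) \<and> (\<forall>l\<in>J. c l y \<le> 0)}"
    and "A \<equiv> E \<union> {l \<in> J. c l x = 0}"
  assumes fin: "finite E" "finite J" and disj: "E \<inter> J = {}"
    and conv: "convex (C)" "convex_on UNIV \<phi>" and x: "x \<in> C"
    and \<phi>: "twice_diff \<phi> x" and c: "\<And>l. l \<in> E \<union> J \<Longrightarrow> twice_diff (c l) x"
    and stat: "grad \<phi> x + (\<Sum>l\<in>E \<union> J. m l *\<^sub>R grad (c l) x) = 0"
    and m: "\<And>l. l \<in> J \<Longrightarrow> 0 \<le> m l" and compl: "\<And>l. l \<in> J \<Longrightarrow> m l * c l x = 0"
    and inj: "inj_on (\<lambda>l. grad (c l) x) (A)"
    and ind: "independent ((\<lambda>l. grad (c l) x) ` A)"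
    and u: "\<And>l. l \<in> A \<Longrightarrow> grad (c l) x \<bullet> u = 0"
  shows "0 \<le> u \<bullet> ((hess \<phi> x + (\<Sum>l\<in>E \<union> J. m l *\<^sub>R hess (c l) x)) *v u)"
proof -
  \<comment> \<open>The index \<open>None\<close> stands for \<open>\<phi>\<close> with coefficient
    \<open>1\<close>, so that the lemmas on linear combinations treat the whole Lagrangian
    \<open>g\<close> at once.\<close>
  define f where "f o' = (case o' of None \<Rightarrow> \<phi> | Some l \<Rightarrow> c l)" for o'
  define a where "a o' = (case o' of None \<Rightarrow> 1 | Some l \<Rightarrow> m l)" for o'
  define K where "K = insert None (Some ` (E \<union> J))"
  define g where "g = (\<lambda>y. \<Sum>k\<in>K. a k * f k y)"
  have K: "finite K" using fin by (simp add: K_def)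
  have f: "twice_diff (f k) x" if "k \<in> K" for k
    using that \<phi> c by (auto simp: K_def f_def)
  have sumK: "(\<Sum>k\<in>K. F k) = F None + (\<Sum>l\<in>E \<union> J. F (Some l))" for F :: "'l option \<Rightarrow> 'z::comm_monoid_add"
    using fin by (simp add: K_def sum.reindex)
  have g: "twice_diff g x" unfolding g_def by (intro twice_diff_linear_combination K f)
  have hg: "hess g x = hess \<phi> x + (\<Sum>l\<in>E \<union> J. m l *\<^sub>R hess (c l) x)"
    unfolding g_def by (subst hess_linear_combination[OF K f]) (simp_all add: sumK a_def f_def)
  have grg: "grad g x = 0"
    unfolding g_def using stat
    by (subst grad_linear_combination[OF K twice_diffD[OF f]]) (simp_all add: sumK a_def f_def)
  have minim: "\<phi> x \<le> \<phi> y" if y: "y \<in> C" for y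
  proof -
    have seg: "x + s *\<^sub>R (y - x) = (1 - s) *\<^sub>R x + s *\<^sub>R y" for s by (simp add: algebra_simps)
    have segC: "x + s *\<^sub>R (y - x) \<in> C" if "0 < s" "s < 1" for s
      unfolding seg using conv(1) x y that by (intro convexD) auto
    have "grad \<phi> x \<bullet> (y - x) \<le> \<phi> y - \<phi> x"
    proof (rule directional_derivative_upper_bound[OF twice_diffD[OF \<phi>]])
      fix s :: real assume "0 < s" "s < 1"
      then show "\<phi> (x + s *\<^sub>R (y - x)) \<le> \<phi> x + s * (\<phi> y - \<phi> x)"
        unfolding seg using convex_onD[OF conv(2), of s x y] by (simp add: algebra_simps)
    qed
    moreover have "m l * (grad (c l) x \<bullet> (y - x)) \<le> 0" if l: "l \<in> E \<union> J" for l
    proof (cases "l \<in> E")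
      case True
      have 0: "c l (x + s *\<^sub>R (y - x)) = 0" if "0 < s" "s < 1" for s
        using segC[OF that] True by (simp add: C_def)
      have cx: "c l x = 0" using x True by (simp add: C_def)
      have d: "c l differentiable (at x)" using c l by (intro twice_diffD) auto
      \<comment> \<open>Multipliers of equality constraints have no sign, so the derivative must be
        shown to vanish; bounding it for \<open>c l\<close> and for \<open>- c l\<close> does
        so.\<close>
      then have d': "(\<lambda>y. - c l y) differentiable (at x)" by (rule differentiable_minus)
      have "grad (\<lambda>y. - c l y) x = - grad (c l) x"
        by (rule grad_unique) (use has_derivative_minus[OF has_derivative_grad[OF d]] in simp)
      then have "- grad (c l) x \<bullet> (y - x) \<le> 0"
        using directional_derivative_upper_bound[OF d', of "y - x" 0] 0 cx by simp
      moreover have "grad (c l) x \<bullet> (y - x) \<le> 0"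
        using directional_derivative_upper_bound[OF d, of "y - x" 0] 0 cx by simp
      ultimately have "grad (c l) x \<bullet> (y - x) = 0" by simp
      then show ?thesis by simp
    next
      case False
      then have lJ: "l \<in> J" using l by simp
      show ?thesis
      proof (cases "m l = 0")
        case ml: False
        then have cx: "c l x = 0" using compl[OF lJ] by simp
        have "grad (c l) x \<bullet> (y - x) \<le> 0"
          using segC lJ cx c l by (intro directional_derivative_upper_bound twice_diffD) (auto simp: C_def)
        then show ?thesis using m[OF lJ] by (simp add: mult_nonneg_nonpos)
      qed simp
    qed
    then have "(\<Sum>l\<in>E \<union> J. m l * (grad (c l) x \<bullet> (y - x))) \<le> 0" by (rule sum_nonpos)
    moreover have "grad \<phi> x \<bullet> (y - x) + (\<Sum>l\<in>E \<union> J. m l * (grad (c l) x \<bullet> (y - x))) = 0"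
      using arg_cong[OF stat, of "\<lambda>v. v \<bullet> (y - x)"] by (simp add: inner_left_distrib inner_sum_left)
    ultimately show ?thesis by linarith
  qed
  \<comment> \<open>Inactive inequalities stay strict near \<open>x\<close>, so nearby points of the
    active manifold are feasible.\<close>
  have "\<forall>\<^sub>F y in nhds x. \<forall>l\<in>J - A. c l y < 0"
  proof (rule eventually_ball_finite)
    show "finite (J - A)" using fin by simp
    show "\<forall>l\<in>J - A. \<forall>\<^sub>F y in nhds x. c l y < 0"
    proof
      fix l assume l: "l \<in> J - A"
      then have "c l x < 0" using x by (auto simp: C_def A_def order_less_le)
      moreover have "isCont (c l) x"
        using l c by (intro differentiable_imp_continuous_within twice_diffD) auto
      then have "(c l \<longlongrightarrow> c l x) (nhds x)" by (simp add: continuous_at tendsto_at_iff_tendsto_nhds)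
      ultimately show "\<forall>\<^sub>F y in nhds x. c l y < 0" by (intro order_tendstoD)
    qed
  qed
  then obtain r where r: "r > 0" "\<And>y l. dist y x < r \<Longrightarrow> l \<in> J - A \<Longrightarrow> c l y < 0"
    by (auto simp: eventually_nhds_metric)
  \<comment> \<open>By complementarity only active constraints carry a nonzero multiplier.\<close>
  have gC: "g y = \<phi> y" if "\<And>l. l \<in> A \<Longrightarrow> c l y = 0" for y
  proof -
    have "m l * c l y = 0" if "l \<in> E \<union> J" for l
      using that compl[of l] \<open>\<And>l. l \<in> A \<Longrightarrow> c l y = 0\<close>[of l] by (cases "c l x = 0") (auto simp: A_def)
    then have "(\<Sum>l\<in>E \<union> J. m l * c l y) = 0" by (rule sum.neutral[OF ballI])
    then show ?thesis by (simp add: g_def sumK a_def f_def)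
  qed
  show ?thesis
    unfolding hg[symmetric]
  proof (rule second_order_necessary[OF g grg])
    fix e :: real assume e: "0 < e"
    have "\<exists>t>0. \<exists>h. norm h < min e r \<and> norm (h - t *\<^sub>R u) \<le> min e r * t \<and> (\<forall>l\<in>A. c l (x + h) = 0)"
      using fin c x inj ind u e r
      by (intro feasible_direction) (auto simp: A_def C_def)
    then obtain t h where t: "t > 0" and h: "norm h < min e r" "norm (h - t *\<^sub>R u) \<le> min e r * t"
      "\<And>l. l \<in> A \<Longrightarrow> c l (x + h) = 0" by blast
    have "x + h \<in> C"
      unfolding C_def
    proof (intro CollectI conjI ballI)
      fix l assume l: "l \<in> J"
      show "c l (x + h) \<le> 0"
        using h(3)[of l] r(2)[of "x + h" l] h(1) l by (cases "l \<in> A") (auto simp: dist_norm)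
    qed (use h(3) in \<open>auto simp: A_def\<close>)
    from minim[OF this] have "\<phi> x \<le> \<phi> (x + h)" .
    moreover have "g (x + h) = \<phi> (x + h)" by (rule gC[OF h(3)])
    moreover have "g x = \<phi> x" using x by (intro gC) (auto simp: A_def C_def)
    moreover have "norm (h - t *\<^sub>R u) \<le> e * t"
      using h(2) t by (meson min.cobounded1 mult_right_mono order_trans less_imp_le)
    ultimately show "\<exists>t>0. \<exists>h. norm h < e \<and> norm (h - t *\<^sub>R u) \<le> e * t \<and> g x \<le> g (x + h)"
      using t h(1) by (intro exI[of _ t] conjI exI[of _ h]) auto
  qed
qed

section \<open>Calculus for sums, vector-valued maps and slices of C2 functions\<close>

lemma twice_diff_add:
  assumes f: "twice_diff f x" and g: "twice_diff g x"
  shows "twice_diff (\<lambda>y. f y + g y) x"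
    and "hess (\<lambda>y. f y + g y) x = hess f x + hess g x"
proof -
  have F: "twice_diff (if b then f else g) x" for b using f g by simp
  note td = twice_diff_linear_combination[where L = UNIV and f = "\<lambda>b. if b then f else g" and a = "\<lambda>_. 1", OF _ F]
    and h = hess_linear_combination[where L = UNIV and f = "\<lambda>b. if b then f else g" and a = "\<lambda>_. 1", OF _ F]
  show "twice_diff (\<lambda>y. f y + g y) x" using td by (simp add: UNIV_bool add.commute)
  show "hess (\<lambda>y. f y + g y) x = hess f x + hess g x"
    using h by (simp add: UNIV_bool add.commute)
qed

lemma grad_add:
  assumes "f differentiable (at x)" "g differentiable (at x)"
  shows "grad (\<lambda>y. f y + g y) x = grad f x + grad g x"
  by (rule grad_unique)
    (use has_derivative_add[OF has_derivative_grad[OF assms(1)] has_derivative_grad[OF assms(2)]]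
     in \<open>simp add: inner_left_distrib\<close>)

lemma has_derivative_vecI:
  fixes f :: "'a::real_normed_vector \<Rightarrow> real ^ 'n::finite"
  assumes "\<And>i. ((\<lambda>x. f x $ i) has_derivative (\<lambda>h. f' h $ i)) (at x)"
  shows "(f has_derivative f') (at x)"
  using assms
  by (subst has_derivative_componentwise_within) (auto simp: Basis_vec_def inner_axis)

lemma has_derivative_vecD:
  fixes f :: "'a::real_normed_vector \<Rightarrow> real ^ 'n::finite"
  assumes "(f has_derivative f') (at x)"
  shows "((\<lambda>x. f x $ i) has_derivative (\<lambda>h. f' h $ i)) (at x)"
  using bounded_linear.has_derivative[OF bounded_linear_vec_nth assms] .

lemma jacobian_vector_unique:
  fixes f :: "real ^ 'n::finite \<Rightarrow> real ^ 'm::finite"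
  assumes "(f has_derivative f') (at x)"
  shows "jacobian f (at x) *v h = f' h"
proof -
  have "(f has_derivative (\<lambda>h. jacobian f (at x) *v h)) (at x)"
    using assms jacobian_works differentiable_def by blast
  then show ?thesis using assms has_derivative_unique by metis
qed

lemma convex_on_sum_functions:
  assumes "finite I" and "\<And>i. i \<in> I \<Longrightarrow> convex_on S (f i)" and "convex S"
  shows "convex_on S (\<lambda>x. \<Sum>i\<in>I. f i x)"
  using assms by (induction I rule: finite_induct) (auto simp: convex_on_const)

lemma
  fixes f :: "real ^ 'x::finite \<Rightarrow> real ^ 'q::finite \<Rightarrow> real"
  assumes U: "open U" "(x, \<theta>) \<in> U" and C2: "C2_on U (\<lambda>(x, \<theta>). f x \<theta>)"
  shows C2_on_imp_twice_diff: "twice_diff (\<lambda>x. f x \<theta>) x"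
    and C2_on_imp_differentiable_param: "(\<lambda>\<theta>. f x \<theta>) differentiable (at \<theta>)"
proof -
  obtain f' :: "(real ^ 'x) \<times> (real ^ 'q) \<Rightarrow> ((real ^ 'x) \<times> (real ^ 'q)) \<Rightarrow>\<^sub>L real" and f''
    where d1: "\<And>z. z \<in> U \<Longrightarrow> ((\<lambda>(x, \<theta>). f x \<theta>) has_derivative blinfun_apply (f' z)) (at z)"
      and d2: "\<And>z. z \<in> U \<Longrightarrow> (f' has_derivative blinfun_apply (f'' z)) (at z)"
    using C2 unfolding C2_on_def by blast
  have emb: "((\<lambda>y. (y, \<theta>)) has_derivative (\<lambda>h. (h, 0))) (at y)" for y :: "real ^ 'x"
    by (auto intro!: derivative_eq_intros)
  have der: "((\<lambda>x. f x \<theta>) has_derivative (\<lambda>h. f' (y, \<theta>) (h, 0))) (at y)" if "(y, \<theta>) \<in> U" for y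
    using has_derivative_compose[OF emb d1[OF that]] by simp
  have "open {y. (y, \<theta>) \<in> U}"
  proof -
    have "open ((\<lambda>y. (y, \<theta>)) -` U)"
      by (rule open_vimage[OF U(1)]) (intro continuous_intros)
    then show ?thesis by (simp add: vimage_def)
  qed
  then have ev: "\<forall>\<^sub>F y in nhds x. (y, \<theta>) \<in> U"
    using U(2) by (auto simp: eventually_nhds)
  have grad: "grad (\<lambda>x. f x \<theta>) y $ a = f' (y, \<theta>) (axis a 1, 0)" if "(y, \<theta>) \<in> U" for y a
    by (simp add: grad_def flip: frechet_derivative_at[OF der[OF that]])
  have "((\<lambda>y. f' (y, \<theta>)) has_derivative (\<lambda>h. f'' (x, \<theta>) (h, 0))) (at x)"
    using has_derivative_compose[OF emb d2[OF U(2)]] .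
  then have "((\<lambda>y. f' (y, \<theta>) v) has_derivative (\<lambda>h. f'' (x, \<theta>) (h, 0) v)) (at x)" for v
    by (rule bounded_linear.has_derivative[OF blinfun.bounded_linear_left])
  then have "((\<lambda>y. \<chi> a. f' (y, \<theta>) (axis a 1, 0)) has_derivative
      (\<lambda>h. \<chi> a. f'' (x, \<theta>) (h, 0) (axis a 1, 0))) (at x)"
    by (intro has_derivative_vecI) simp
  then have "(grad (\<lambda>x. f x \<theta>) has_derivative
      (\<lambda>h. \<chi> a. f'' (x, \<theta>) (h, 0) (axis a 1, 0))) (at x)"
  proof (rule has_derivative_transform_eventually)
    have "\<forall>\<^sub>F y in at x. (y, \<theta>) \<in> U"
      using ev by (simp add: eventually_at_filter eventually_mono)
    then show "\<forall>\<^sub>F y in at x. (\<chi> a. f' (y, \<theta>) (axis a 1, 0)) = grad (\<lambda>x. f x \<theta>) y"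
      by eventually_elim (simp add: vec_eq_iff grad)
  qed (simp_all add: vec_eq_iff grad U(2))
  moreover have "\<forall>\<^sub>F y in nhds x. (\<lambda>x. f x \<theta>) differentiable (at y)"
    using ev by eventually_elim (use der differentiable_def in blast)
  ultimately show "twice_diff (\<lambda>x. f x \<theta>) x"
    unfolding twice_diff_def differentiable_def by blast
  have "((\<lambda>\<theta>. (x, \<theta>)) has_derivative (\<lambda>h. (0, h))) (at \<theta>)"
    by (auto intro!: derivative_eq_intros)
  from has_derivative_compose[OF this d1[OF U(2)]]
  show "(\<lambda>\<theta>. f x \<theta>) differentiable (at \<theta>)"
    unfolding differentiable_def by auto
qed

lemma grad_component_zero:
  assumes "g differentiable (at y)" and "\<And>t. g (y + t *\<^sub>R axis a 1) = g y"
  shows "grad g y $ a = 0"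
proof -
  have "((\<lambda>t. g (y + t *\<^sub>R axis a 1)) has_real_derivative grad g y \<bullet> axis a 1) (at 0)"
    by (rule has_real_derivative_along_line) (use has_derivative_grad[OF assms(1)] in simp)
  moreover have "((\<lambda>t. g (y + t *\<^sub>R axis a 1)) has_real_derivative 0) (at 0)"
    unfolding assms(2) by simp
  ultimately show ?thesis by (metis DERIV_unique inner_axis inner_real_def mult.right_neutral)
qed

section \<open>The coupling matrix at a KKT point\<close>

text \<open>\<open>local_invertible\<close> says that the local Jacobians are defined; it is also
  what excludes flat tangent directions in \<open>local_energy_zero\<close>.\<close>

locale kkt_point =
  fixes P :: "('p::finite, 'x::finite, 'l::finite, 'c::finite, 'q::finite) sep_problem"
    and x :: "real ^ 'x" and m :: "real ^ 'l" and d :: "real ^ 'c" and \<theta> :: "real ^ 'q"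
  assumes separable: "separable P"
    and convexity: "strictly_convex_problem P \<theta>"
    and C2: "C2_problem P x \<theta>"
    and KKT: "KKT P \<theta> x m d"
    and LICQ: "LICQ P \<theta> x"
    and strict_compl: "strict_complementarity P \<theta> x m d"
    and local_invertible: "\<And>i. invertible_on (zidx P i) (local_G_z P i x m d \<theta>)"
begin

definition loc :: "'p \<Rightarrow> 'l set" where
  "loc i = {l \<in> leqs P \<union> lineqs P. lown P l = i}"

abbreviation obj_fun :: "'p \<Rightarrow> real ^ 'x \<Rightarrow> real" where
  "obj_fun i \<equiv> \<lambda>y. fobj P i y \<theta>"

abbreviation loc_fun :: "'l \<Rightarrow> real ^ 'x \<Rightarrow> real" where
  "loc_fun l \<equiv> \<lambda>y. floc P l y \<theta>"

abbreviation cpl_fun :: "'p \<Rightarrow> 'c \<Rightarrow> real ^ 'x \<Rightarrow> real" where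
  "cpl_fun i c \<equiv> \<lambda>y. fcpl P i c y \<theta>"

abbreviation tot_fun :: "'c \<Rightarrow> real ^ 'x \<Rightarrow> real" where
  "tot_fun c \<equiv> \<lambda>y. total_cpl P c y \<theta>"

definition sub_fun :: "'p \<Rightarrow> real ^ 'x \<Rightarrow> real" where
  "sub_fun i = (\<lambda>y. obj_fun i y + (\<Sum>c\<in>UNIV. d $ c * cpl_fun i c y))"

definition lagr_hess :: "'p \<Rightarrow> real ^ 'x ^ 'x" where
  "lagr_hess i = hess (sub_fun i) x + (\<Sum>l\<in>loc i. m $ l *\<^sub>R hess (loc_fun l) x)"

lemma
  shows twice_diff_obj: "twice_diff (obj_fun i) x"
    and twice_diff_loc: "l \<in> leqs P \<union> lineqs P \<Longrightarrow> twice_diff (loc_fun l) x"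
    and twice_diff_cpl: "twice_diff (cpl_fun i c) x"
    and differentiable_cpl_param: "(\<lambda>\<theta>. fcpl P i c x \<theta>) differentiable (at \<theta>)"
  using C2 C2_on_imp_twice_diff C2_on_imp_differentiable_param unfolding C2_problem_def by blast+

lemma twice_diff_sub: "twice_diff (sub_fun i) x"
  unfolding sub_fun_def
  by (intro twice_diff_add twice_diff_obj twice_diff_linear_combination twice_diff_cpl) simp

lemma loc_subset: "l \<in> loc i \<Longrightarrow> l \<in> leqs P \<union> lineqs P"
  by (simp add: loc_def)

lemma obj_same: "same_x P i y y' \<Longrightarrow> obj_fun i y = obj_fun i y'"
  and loc_same: "l \<in> leqs P \<union> lineqs P \<Longrightarrow> same_x P (lown P l) y y' \<Longrightarrow> loc_fun l y = loc_fun l y'"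
  and cpl_same: "same_x P i y y' \<Longrightarrow> cpl_fun i c y = cpl_fun i c y'"
  using separable unfolding separable_def by (auto simp: same_par_def)

lemma same_x_shift: "xown P a \<noteq> i \<Longrightarrow> same_x P i (y + t *\<^sub>R axis a 1) y"
  by (auto simp: same_x_def axis_def)

lemma grad_loc_block: "l \<in> leqs P \<union> lineqs P \<Longrightarrow> xown P a \<noteq> lown P l \<Longrightarrow> grad (loc_fun l) x $ a = 0"
  by (intro grad_component_zero twice_diffD twice_diff_loc loc_same same_x_shift)

lemma grad_cpl_block: "xown P a \<noteq> i \<Longrightarrow> grad (cpl_fun i c) x $ a = 0"
  by (intro grad_component_zero twice_diffD twice_diff_cpl cpl_same same_x_shift)

lemma grad_sub_block: "xown P a \<noteq> i \<Longrightarrow> grad (sub_fun i) x $ a = 0"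
  by (intro grad_component_zero twice_diffD twice_diff_sub)
    (unfold sub_fun_def, intro arg_cong2[where f = "(+)"] sum.cong refl
      arg_cong2[where f = "(*)"] obj_same cpl_same same_x_shift)

lemma grad_tot: "grad (tot_fun c) x $ a = grad (cpl_fun (xown P a) c) x $ a"
proof -
  have "grad (tot_fun c) x = (\<Sum>i\<in>UNIV. grad (cpl_fun i c) x)"
    using grad_linear_combination[OF finite_class.finite_UNIV twice_diffD[OF twice_diff_cpl], of "\<lambda>_. 1" "\<lambda>i. i" "\<lambda>_. c"]
    by (simp add: total_cpl_def)
  then have "grad (tot_fun c) x $ a = (\<Sum>i\<in>UNIV. grad (cpl_fun i c) x $ a)" by simp
  also have "\<dots> = (\<Sum>i\<in>UNIV. if i = xown P a then grad (cpl_fun (xown P a) c) x $ a else 0)"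
    by (intro sum.cong refl) (auto intro: grad_cpl_block)
  finally show ?thesis by simp
qed

lemma differentiable_tot: "tot_fun c differentiable (at x)"
  unfolding total_cpl_def
  using twice_diffD[OF twice_diff_cpl] by (auto intro!: differentiable_sum)

lemma eventually_differentiable:
  "\<forall>\<^sub>F y in nhds x. (\<forall>i. obj_fun i differentiable (at y)) \<and>
    (\<forall>l\<in>leqs P \<union> lineqs P. loc_fun l differentiable (at y)) \<and>
    (\<forall>i c. cpl_fun i c differentiable (at y))"
  using twice_diff_obj twice_diff_loc twice_diff_cpl
  by (intro eventually_conj eventually_all_finite eventually_ball_finite) (auto simp: twice_diff_def)

lemma lagr_grad:
  assumes obj: "obj_fun i differentiable (at y)"
    and loc: "\<And>l. l \<in> leqs P \<union> lineqs P \<Longrightarrow> loc_fun l differentiable (at y)"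
    and cpl: "\<And>c. cpl_fun i c differentiable (at y)"
  shows "grad (\<lambda>y. lagr P i y m' d' \<theta>) y =
    grad (obj_fun i) y + (\<Sum>c\<in>UNIV. d' $ c *\<^sub>R grad (cpl_fun i c) y) +
    (\<Sum>l\<in>loc i. m' $ l *\<^sub>R grad (loc_fun l) y)"
proof -
  have c: "(\<lambda>y. \<Sum>c\<in>UNIV. d' $ c * cpl_fun i c y) differentiable (at y)"
    by (auto intro!: differentiable_sum differentiable_mult cpl)
  have l: "(\<lambda>y. \<Sum>l\<in>loc i. m' $ l * loc_fun l y) differentiable (at y)"
    by (auto intro!: differentiable_sum differentiable_mult loc simp: loc_def)
  have "grad (\<lambda>y. lagr P i y m' d' \<theta>) y = grad (obj_fun i) y +
      grad (\<lambda>y. \<Sum>c\<in>UNIV. d' $ c * cpl_fun i c y) y + grad (\<lambda>y. \<Sum>l\<in>loc i. m' $ l * loc_fun l y) y"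
    unfolding lagr_def loc_def[symmetric]
    by (simp add: grad_add obj c l differentiable_add)
  also have "grad (\<lambda>y. \<Sum>c\<in>UNIV. d' $ c * cpl_fun i c y) y = (\<Sum>c\<in>UNIV. d' $ c *\<^sub>R grad (cpl_fun i c) y)"
    by (intro grad_linear_combination cpl) simp
  also have "grad (\<lambda>y. \<Sum>l\<in>loc i. m' $ l * loc_fun l y) y = (\<Sum>l\<in>loc i. m' $ l *\<^sub>R grad (loc_fun l) y)"
    by (intro grad_linear_combination loc loc_subset) simp_all
  finally show ?thesis .
qed

lemma grad_sub:
  assumes obj: "obj_fun i differentiable (at y)" and cpl: "\<And>c. cpl_fun i c differentiable (at y)"
  shows "grad (sub_fun i) y = grad (obj_fun i) y + (\<Sum>c\<in>UNIV. d $ c *\<^sub>R grad (cpl_fun i c) y)"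
proof -
  have c: "(\<lambda>y. \<Sum>c\<in>UNIV. d $ c * cpl_fun i c y) differentiable (at y)"
    by (auto intro!: differentiable_sum differentiable_mult cpl)
  have "grad (\<lambda>y. \<Sum>c\<in>UNIV. d $ c * cpl_fun i c y) y = (\<Sum>c\<in>UNIV. d $ c *\<^sub>R grad (cpl_fun i c) y)"
    by (intro grad_linear_combination cpl) simp
  then show ?thesis unfolding sub_fun_def by (simp add: grad_add obj c)
qed

lemma lagr_grad_at_x:
  "grad (\<lambda>y. lagr P i y m' d' \<theta>) x =
    grad (obj_fun i) x + (\<Sum>c\<in>UNIV. d' $ c *\<^sub>R grad (cpl_fun i c) x) +
    (\<Sum>l\<in>loc i. m' $ l *\<^sub>R grad (loc_fun l) x)"
  by (intro lagr_grad twice_diffD twice_diff_obj twice_diff_loc twice_diff_cpl)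

lemma grad_sub_at_x:
  "grad (sub_fun i) x = grad (obj_fun i) x + (\<Sum>c\<in>UNIV. d $ c *\<^sub>R grad (cpl_fun i c) x)"
  by (intro grad_sub twice_diffD twice_diff_obj twice_diff_cpl)

text \<open>The KKT condition only states that the gradients of the local Lagrangians sum to zero.
  Each of them is supported on the coordinates of its own block, so each vanishes
  separately.\<close>

lemma stationarity: "grad (sub_fun i) x + (\<Sum>l\<in>loc i. m $ l *\<^sub>R grad (loc_fun l) x) = 0"
proof -
  define v where "v i = grad (sub_fun i) x + (\<Sum>l\<in>loc i. m $ l *\<^sub>R grad (loc_fun l) x)" for i
  have v: "grad (\<lambda>y. lagr P i y m d \<theta>) x = v i" for i
    by (simp add: v_def lagr_grad_at_x grad_sub_at_x)
  have block: "v i $ a = 0" if "xown P a \<noteq> i" for i a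
  proof -
    have "(\<Sum>l\<in>loc i. m $ l * grad (loc_fun l) x $ a) = 0"
      using that by (intro sum.neutral ballI) (auto simp: loc_def intro!: grad_loc_block)
    then show ?thesis using that by (simp add: v_def grad_sub_block)
  qed
  have "lagr P i y m d \<theta> = sub_fun i y + (\<Sum>l\<in>loc i. m $ l * loc_fun l y)" for i y
    by (simp add: lagr_def sub_fun_def loc_def)
  moreover have "(\<lambda>y. sub_fun i y + (\<Sum>l\<in>loc i. m $ l * loc_fun l y)) differentiable (at x)" for i
    by (intro differentiable_add twice_diffD twice_diff_sub twice_diff_linear_combination twice_diff_loc
        loc_subset) simp
  ultimately have "(\<lambda>y. lagr P i y m d \<theta>) differentiable (at x)" for i by simp
  then have "grad (\<lambda>y. \<Sum>i\<in>UNIV. lagr P i y m d \<theta>) x = (\<Sum>i\<in>UNIV. v i)"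
    using grad_linear_combination[of UNIV "\<lambda>i y. lagr P i y m d \<theta>" x "\<lambda>_. 1"] by (simp add: v)
  then have total: "(\<Sum>i\<in>UNIV. v i) = 0" using KKT by (simp add: KKT_def)
  have "v i $ a = 0" for a
  proof (cases "xown P a = i")
    case True
    have "0 = (\<Sum>j\<in>UNIV. v j $ a)" using arg_cong[OF total, of "\<lambda>v. v $ a"] by simp
    also have "\<dots> = (\<Sum>j\<in>UNIV. if j = i then v j $ a else 0)"
      using block True by (intro sum.cong) auto
    finally show ?thesis by simp
  qed (rule block)
  then have "v i = 0" by (simp add: vec_eq_iff)
  then show ?thesis by (simp add: v_def)
qed

text \<open>Terms of equality constraints are affine, hence convex for either sign of the
  multiplier; the other coupling terms have nonnegative multipliers.\<close>

lemma convex_sub: "convex_on UNIV (sub_fun i)"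
proof -
  have "convex_on UNIV (\<lambda>y. d $ c * cpl_fun i c y)" for c
  proof (cases "c \<in> ceqs P")
    case True
    then obtain a b where ab: "\<And>y. cpl_fun i c y = a \<bullet> y + b"
      using convexity unfolding strictly_convex_problem_def by metis
    show ?thesis unfolding ab by (rule convex_onI) (simp_all add: inner_simps algebra_simps)
  next
    case False
    then have "convex_on UNIV (cpl_fun i c)" "0 \<le> d $ c"
      using convexity KKT by (auto simp: strictly_convex_problem_def KKT_def)
    then show ?thesis by (intro convex_on_cmul)
  qed
  then show ?thesis
    using convexity unfolding sub_fun_def strictly_convex_problem_def
    by (intro convex_on_add convex_on_sum_functions) auto
qed

text \<open>Written in the shape of the set \<open>A\<close> of
  \<open>convex_second_order_condition\<close>, so that it can be folded there.\<close>

definition active :: "'p \<Rightarrow> 'l set" where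
  "active i = {l \<in> leqs P. lown P l = i} \<union> {l \<in> {l \<in> lineqs P. lown P l = i}. loc_fun l x = 0}"

lemma
  shows active_inj: "inj_on (\<lambda>l. grad (loc_fun l) x) (active i)"
    and active_independent: "independent ((\<lambda>l. grad (loc_fun l) x) ` active i)"
proof -
  have sub: "Inl ` active i \<subseteq> binding P \<theta> x" by (auto simp: active_def binding_def)
  have eq: "(\<lambda>l. grad (loc_fun l) x) = constraint_grad P \<theta> x \<circ> Inl"
    by (simp add: fun_eq_iff constraint_grad_def)
  have "inj_on (constraint_grad P \<theta> x) (Inl ` active i)"
    using LICQ sub by (auto simp: LICQ_def intro: inj_on_subset)
  then show "inj_on (\<lambda>l. grad (loc_fun l) x) (active i)"
    unfolding eq by (intro comp_inj_on) auto
  have "independent (constraint_grad P \<theta> x ` (Inl ` active i))"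
    using LICQ sub unfolding LICQ_def by (meson image_mono independent_mono)
  then show "independent ((\<lambda>l. grad (loc_fun l) x) ` active i)"
    unfolding eq image_comp .
qed

lemma lagr_hess_psd:
  assumes u: "\<And>l. l \<in> active i \<Longrightarrow> grad (loc_fun l) x \<bullet> u = 0"
  shows "0 \<le> u \<bullet> (lagr_hess i *v u)"
proof -
  let ?E = "{l \<in> leqs P. lown P l = i}" and ?J = "{l \<in> lineqs P. lown P l = i}"
  have EJ: "?E \<union> ?J = loc i" by (auto simp: loc_def)
  have C: "{y. (\<forall>l\<in>?E. loc_fun l y = 0) \<and> (\<forall>l\<in>?J. loc_fun l y \<le> 0)} = local_set P i \<theta>"
    by (auto simp: local_set_def)
  have "0 \<le> u \<bullet> ((hess (sub_fun i) x + (\<Sum>l\<in>?E \<union> ?J. m $ l *\<^sub>R hess (loc_fun l) x)) *v u)"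
  proof (rule convex_second_order_condition[where c = loc_fun and m = "\<lambda>l. m $ l"], unfold EJ C active_def[symmetric])
    show "?E \<inter> ?J = {}" using separable by (auto simp: separable_def)
    show "convex (local_set P i \<theta>)"
      using convexity by (simp add: strictly_convex_problem_def)
    show "x \<in> local_set P i \<theta>" using KKT by (auto simp: KKT_def feasible_def)
    show "\<And>l. l \<in> ?J \<Longrightarrow> 0 \<le> m $ l" "\<And>l. l \<in> ?J \<Longrightarrow> m $ l * loc_fun l x = 0"
      using KKT by (auto simp: KKT_def)
  qed (use u in \<open>auto intro!: convex_sub twice_diff_sub twice_diff_loc loc_subset stationarity
      active_inj active_independent\<close>)
  then show ?thesis by (simp add: lagr_hess_def EJ)
qed

lemma lagr_hess_symmetric: "u \<bullet> (lagr_hess i *v v) = v \<bullet> (lagr_hess i *v u)"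
proof -
  have sum: "(\<Sum>l\<in>loc i. m $ l *\<^sub>R hess (loc_fun l) x) *v w = (\<Sum>l\<in>loc i. m $ l *\<^sub>R (hess (loc_fun l) x *v w))" for w
    by (simp add: matrix_sum_vector scaleR_matrix_vector_assoc)
  have "(\<Sum>l\<in>loc i. m $ l * (u \<bullet> (hess (loc_fun l) x *v v))) = (\<Sum>l\<in>loc i. m $ l * (v \<bullet> (hess (loc_fun l) x *v u)))"
    by (intro sum.cong refl arg_cong2[where f = "(*)"] hess_symmetric twice_diff_loc loc_subset)
  then show ?thesis
    using hess_symmetric[OF twice_diff_sub, of u i v]
    by (simp add: lagr_hess_def matrix_vector_mult_add_rdistrib sum inner_add_right inner_sum_right)
qed

text \<open>The KKT matrix of subproblem \<open>i\<close>: the Hessian of the Lagrangian bordered by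
  constraint gradients, with linearized complementarity rows. The gradient of \<open>lagr\<close>
  splits into single gradients only where the functions are differentiable, hence the detour through
  an equality near \<open>zpair x m\<close>.\<close>

lemma local_G_z_vector:
  "local_G_z P i x m d \<theta> *v h = (\<chi> r. if r \<notin> zidx P i then 0 else (case r of
     Inl a \<Rightarrow> (lagr_hess i *v (\<chi> a. h $ Inl a)) $ a + (\<Sum>l\<in>loc i. h $ Inr l * grad (loc_fun l) x $ a)
   | Inr l \<Rightarrow> if l \<in> leqs P then grad (loc_fun l) x \<bullet> (\<chi> a. h $ Inl a)
       else m $ l * (grad (loc_fun l) x \<bullet> (\<chi> a. h $ Inl a)) + h $ Inr l * loc_fun l x))"
  (is "_ = ?R h")
proof -
  let ?X = "\<lambda>z :: real ^ ('x + 'l). \<chi> a. z $ Inl a"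
  have X: "(?X has_derivative ?X) (at z)" for z
    by (intro has_derivative_vecI) (simp add: bounded_linear.has_derivative[OF bounded_linear_vec_nth])
  have z0: "?X (zpair x m) = x" "\<And>l. zpair x m $ Inr l = m $ l"
    by (simp_all add: zpair_def vec_eq_iff)
  have comp: "((\<lambda>z. f (?X z)) has_derivative (\<lambda>h. f' (?X h))) (at (zpair x m))"
    if "(f has_derivative f') (at x)" for f :: "real ^ 'x \<Rightarrow> 'z::real_normed_vector" and f'
    using has_derivative_compose[OF X, of f f' "zpair x m"] that by (simp add: z0)
  have nth: "((\<lambda>z. z $ r) has_derivative (\<lambda>h. h $ r)) (at (zpair x m))" for r
    by (rule bounded_linear.has_derivative[OF bounded_linear_vec_nth has_derivative_ident])
  have "(?X \<longlongrightarrow> ?X z) (nhds z)" for z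
    using has_derivative_continuous[OF X] tendsto_at_iff_tendsto_nhds[where g = ?X]
    by (simp add: continuous_within)
  from this[of "zpair x m"] have "(?X \<longlongrightarrow> x) (nhds (zpair x m))" by (simp only: z0)
  then have "\<forall>\<^sub>F z in nhds (zpair x m). (\<forall>i. obj_fun i differentiable (at (?X z))) \<and>
    (\<forall>l\<in>leqs P \<union> lineqs P. loc_fun l differentiable (at (?X z))) \<and>
    (\<forall>i c. cpl_fun i c differentiable (at (?X z)))"
    by (rule eventually_compose_filterlim[OF eventually_differentiable])
  then have ev: "\<forall>\<^sub>F z in nhds (zpair x m). 
      grad (\<lambda>y. lagr P i y (\<chi> l. z $ Inr l) d \<theta>) (?X z) =
      grad (sub_fun i) (?X z) + (\<Sum>l\<in>loc i. z $ Inr l *\<^sub>R grad (loc_fun l) (?X z))"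
  proof eventually_elim
    case (elim z)
    then show ?case by (subst lagr_grad) (auto simp: grad_sub)
  qed
  have grad_der: "((\<lambda>z. grad (\<lambda>y. lagr P i y (\<chi> l. z $ Inr l) d \<theta>) (?X z)) has_derivative
      (\<lambda>h. lagr_hess i *v ?X h + (\<Sum>l\<in>loc i. h $ Inr l *\<^sub>R grad (loc_fun l) x))) (at (zpair x m))"
  proof (rule has_derivative_transform_eventually)
    let ?f = "\<lambda>z. grad (sub_fun i) (?X z) + (\<Sum>l\<in>loc i. z $ Inr l *\<^sub>R grad (loc_fun l) (?X z))"
    have "(?f has_derivative (\<lambda>h. hess (sub_fun i) x *v ?X h +
        (\<Sum>l\<in>loc i. zpair x m $ Inr l *\<^sub>R (hess (loc_fun l) x *v ?X h) +
          h $ Inr l *\<^sub>R grad (loc_fun l) (?X (zpair x m))))) (at (zpair x m))"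
      by (intro has_derivative_add has_derivative_sum has_derivative_scaleR comp nth twice_diff_hess
          twice_diff_sub twice_diff_loc loc_subset)
    moreover have "hess (sub_fun i) x *v w +
        (\<Sum>l\<in>loc i. m $ l *\<^sub>R (hess (loc_fun l) x *v w) + h $ Inr l *\<^sub>R grad (loc_fun l) x) =
      lagr_hess i *v w + (\<Sum>l\<in>loc i. h $ Inr l *\<^sub>R grad (loc_fun l) x)" for w and h :: "real ^ ('x + 'l)"
      by (simp add: lagr_hess_def matrix_vector_mult_add_rdistrib matrix_sum_vector
          scaleR_matrix_vector_assoc sum.distrib)
    ultimately show "(?f has_derivative
      (\<lambda>h. lagr_hess i *v ?X h + (\<Sum>l\<in>loc i. h $ Inr l *\<^sub>R grad (loc_fun l) x))) (at (zpair x m))"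
      by (simp add: z0)
    show "\<forall>\<^sub>F z in at (zpair x m). ?f z = grad (\<lambda>y. lagr P i y (\<chi> l. z $ Inr l) d \<theta>) (?X z)"
      using ev by (auto simp: eventually_at_filter elim!: eventually_mono)
    show "?f (zpair x m) = grad (\<lambda>y. lagr P i y (\<chi> l. zpair x m $ Inr l) d \<theta>) (?X (zpair x m))"
      using eventually_nhds_x_imp_x[OF ev] by simp
  qed simp
  have "((\<lambda>z. local_G P i z d \<theta>) has_derivative ?R) (at (zpair x m))"
  proof (rule has_derivative_vecI)
    fix r
    have loc_der: "((\<lambda>z. loc_fun l (?X z)) has_derivative (\<lambda>h. grad (loc_fun l) x \<bullet> ?X h)) (at (zpair x m))"
      if "Inr l \<in> zidx P i" for l
      using that by (intro comp has_derivative_grad twice_diffD twice_diff_loc) (auto simp: zidx_def)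
    consider "r \<notin> zidx P i" | a where "r = Inl a" "r \<in> zidx P i" | l where "r = Inr l" "r \<in> zidx P i"
      by (cases r) auto
    then show "((\<lambda>z. local_G P i z d \<theta> $ r) has_derivative (\<lambda>h. ?R h $ r)) (at (zpair x m))"
    proof cases
      case 1
      then show ?thesis by (simp add: local_G_def Let_def)
    next
      case 2
      then show ?thesis
        using has_derivative_vecD[OF grad_der, of a] by (simp add: local_G_def Let_def)
    next
      case 3
      have "((\<lambda>z. z $ Inr l * loc_fun l (?X z)) has_derivative
          (\<lambda>h. m $ l * (grad (loc_fun l) x \<bullet> ?X h) + h $ Inr l * loc_fun l x)) (at (zpair x m))"
        using has_derivative_mult[OF nth loc_der, of l "Inr l"] 3 by (simp add: z0)
      then show ?thesis using 3 loc_der[of l] by (cases "l \<in> leqs P") (simp_all add: local_G_def Let_def)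
    qed
  qed
  then show ?thesis unfolding local_G_z_def by (rule jacobian_vector_unique)
qed

lemma local_G_d_vector:
  "jacobian (\<lambda>d. local_G P i (zpair x m) d \<theta>) (at d) *v h =
    (\<chi> r. if r \<notin> zidx P i then 0 else (case r of
       Inl a \<Rightarrow> (\<Sum>c\<in>UNIV. h $ c * grad (cpl_fun i c) x $ a) | Inr l \<Rightarrow> 0))"
  (is "_ = ?R h")
proof (rule jacobian_vector_unique, rule has_derivative_vecI)
  fix r
  have z0: "(\<chi> a. zpair x m $ Inl a) = x" "(\<chi> l. zpair x m $ Inr l) = m"
    by (simp_all add: zpair_def vec_eq_iff)
  have grad: "grad (\<lambda>y. lagr P i y m d' \<theta>) x $ a = (grad (obj_fun i) x $ a +
      (\<Sum>l\<in>loc i. m $ l * grad (loc_fun l) x $ a)) + (\<Sum>c\<in>UNIV. d' $ c * grad (cpl_fun i c) x $ a)" for d' a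
    by (simp add: lagr_grad_at_x)
  have der: "((\<lambda>d'. grad (\<lambda>y. lagr P i y m d' \<theta>) x $ a) has_derivative
      (\<lambda>h. \<Sum>c\<in>UNIV. h $ c * grad (cpl_fun i c) x $ a)) (at d)" for a
  proof -
    have "((\<lambda>d' :: real ^ 'c. k + (\<Sum>c\<in>UNIV. d' $ c * g c)) has_derivative (\<lambda>h. 0 + (\<Sum>c\<in>UNIV. h $ c * g c))) (at d)" for k and g :: "'c \<Rightarrow> real"
      by (intro has_derivative_add has_derivative_const has_derivative_sum has_derivative_mult_left
          bounded_linear.has_derivative[OF bounded_linear_vec_nth has_derivative_ident])
    then show ?thesis unfolding grad by simp
  qed
  show "((\<lambda>d. local_G P i (zpair x m) d \<theta> $ r) has_derivative (\<lambda>h. ?R h $ r)) (at d)"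
    using der by (cases "r \<in> zidx P i"; cases r) (simp_all add: local_G_def Let_def z0)
qed

end

section \<open>Response of the local solutions to the dual variables\<close>

context kkt_point
begin

abbreviation D_mat :: "real ^ 'c ^ 'c" where
  "D_mat \<equiv> coupling_matrix P x m d \<theta>"

text \<open>\<open>local_sol i v\<close> solves \<open>\<partial>\<^bsub>z\<^sub>i\<^esub> G\<^sub>i z = \<partial>\<^sub>d G\<^sub>i v\<close>, so that \<open>\<partial>\<^sub>d x v = - primal_sol v\<close>.\<close>

definition local_sol :: "'p \<Rightarrow> real ^ 'c \<Rightarrow> real ^ ('x + 'l)" where
  "local_sol i v = inverse_on (zidx P i) (local_G_z P i x m d \<theta>) *v
     (jacobian (\<lambda>d. local_G P i (zpair x m) d \<theta>) (at d) *v v)"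

text \<open>Block \<open>i\<close> of \<open>primal_sol v\<close> padded by zeros, in view of
  \<open>local_sol_support\<close>.\<close>

definition local_primal :: "'p \<Rightarrow> real ^ 'c \<Rightarrow> real ^ 'x" where
  "local_primal i v = (\<chi> a. local_sol i v $ Inl a)"

definition primal_sol :: "real ^ 'c \<Rightarrow> real ^ 'x" where
  "primal_sol v = (\<chi> a. local_sol (xown P a) v $ Inl a)"

lemma stacked_dual_vector: "stacked_dual P x m d \<theta> *v v = - primal_sol v"
proof -
  have "(stacked_dual P x m d \<theta> *v v) $ a = - primal_sol v $ a" for a
  proof -
    let ?K = "inverse_on (zidx P (xown P a)) (local_G_z P (xown P a) x m d \<theta>)"
      and ?J = "jacobian (\<lambda>d. local_G P (xown P a) (zpair x m) d \<theta>) (at d)"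
    have "(stacked_dual P x m d \<theta> *v v) $ a = - ((?K ** ?J) *v v) $ Inl a"
      by (simp add: stacked_dual_def Let_def matrix_vector_mult_def sum_negf)
    then show ?thesis
      by (simp add: primal_sol_def local_sol_def matrix_vector_mul_assoc)
  qed
  then show ?thesis by (simp add: vec_eq_iff)
qed

lemma local_inverse:
  "is_inverse_on (zidx P i) (local_G_z P i x m d \<theta>) (inverse_on (zidx P i) (local_G_z P i x m d \<theta>))"
  by (rule inverse_on_works[OF local_invertible])

lemma local_sol_support: "r \<notin> zidx P i \<Longrightarrow> local_sol i v $ r = 0"
  using local_inverse[of i] by (simp add: is_inverse_on_def local_sol_def matrix_vector_mult_def)

lemma local_sol_equation:
  "local_G_z P i x m d \<theta> *v local_sol i v = jacobian (\<lambda>d. local_G P i (zpair x m) d \<theta>) (at d) *v v"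
proof -
  let ?K = "inverse_on (zidx P i) (local_G_z P i x m d \<theta>)"
    and ?J = "jacobian (\<lambda>d. local_G P i (zpair x m) d \<theta>) (at d)"
  have "local_G_z P i x m d \<theta> *v local_sol i v = id_on (zidx P i) *v (?J *v v)"
    using local_inverse[of i] unfolding local_sol_def is_inverse_on_def
    by (metis matrix_vector_mul_assoc)
  also have "\<dots> = ?J *v v"
    by (rule id_on_vector_coord_space) (simp add: coord_space_def local_G_d_vector)
  finally show ?thesis .
qed

lemma local_sol_stationary:
  assumes "xown P a = i"
  shows "(lagr_hess i *v local_primal i v) $ a + (\<Sum>l\<in>loc i. local_sol i v $ Inr l * grad (loc_fun l) x $ a) =
    (\<Sum>c\<in>UNIV. v $ c * grad (cpl_fun i c) x $ a)"
proof -
  have "Inl a \<in> zidx P i" using assms by (auto simp: zidx_def)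
  then show ?thesis
    using arg_cong[OF local_sol_equation[of i v], of "\<lambda>w. w $ Inl a"]
    by (simp add: local_G_z_vector local_G_d_vector local_primal_def)
qed

lemma local_sol_constraint:
  assumes l: "l \<in> loc i"
  shows "if l \<in> leqs P then grad (loc_fun l) x \<bullet> local_primal i v = 0
    else m $ l * (grad (loc_fun l) x \<bullet> local_primal i v) + local_sol i v $ Inr l * loc_fun l x = 0"
proof -
  have "Inr l \<in> zidx P i" using l by (auto simp: zidx_def loc_def)
  then show ?thesis
    using arg_cong[OF local_sol_equation[of i v], of "\<lambda>w. w $ Inr l"]
    by (simp add: local_G_z_vector local_G_d_vector local_primal_def split: if_splits)
qed

text \<open>For an active inequality the complementarity row reduces to \<open>m $ l\<close> times
  the directional derivative, and \<open>m $ l\<close> is positive by strict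
  complementarity.\<close>

lemma local_sol_tangent:
  assumes l: "l \<in> active i"
  shows "grad (loc_fun l) x \<bullet> local_primal i v = 0"
proof -
  have loc: "l \<in> loc i" using l by (auto simp: active_def loc_def)
  show ?thesis
  proof (cases "l \<in> leqs P")
    case False
    then have "loc_fun l x = 0" "m $ l > 0"
      using l strict_compl by (auto simp: active_def strict_complementarity_def)
    then show ?thesis using local_sol_constraint[OF loc, of v] False by simp
  qed (use local_sol_constraint[OF loc, of v] in simp)
qed

text \<open>Here \<open>m $ l = 0\<close>, so the complementarity row is the nonzero number
  \<open>loc_fun l x\<close> times the multiplier component.\<close>

lemma local_sol_inactive:
  assumes l: "l \<in> loc i" "l \<notin> active i"
  shows "local_sol i v $ Inr l = 0"
proof -
  have l': "l \<in> lineqs P" "l \<notin> leqs P" "loc_fun l x \<noteq> 0"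
    using l by (auto simp: active_def loc_def)
  moreover have "m $ l * loc_fun l x = 0" using KKT l' unfolding KKT_def by blast
  ultimately show ?thesis using local_sol_constraint[OF l(1), of v] by simp
qed

text \<open>Pairing the stationarity rows with the primal part: each constraint term drops out,
  since either its multiplier component is zero or its gradient is orthogonal. Summed over
  \<open>i\<close>, this writes the quadratic form of the overview's \<open>A M A\<^sup>T\<close> at
  \<open>v\<close> as a sum of local energies.\<close>

lemma local_energy:
  "local_primal i v \<bullet> (lagr_hess i *v local_primal i v) =
    (\<Sum>a | xown P a = i. primal_sol v $ a * (\<Sum>c\<in>UNIV. v $ c * grad (tot_fun c) x $ a))"
proof -
  let ?u = "local_primal i v"
  have supp: "?u $ a = 0" if "xown P a \<noteq> i" for a
    using that local_sol_support[of "Inl a" i v] by (auto simp: local_primal_def zidx_def)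
  have restrict: "(\<Sum>a | xown P a = i. ?u $ a * f $ a) = ?u \<bullet> f" for f :: "real ^ 'x"
    unfolding inner_vec_def inner_real_def
    by (intro sum.mono_neutral_left) (auto simp: supp)
  have "(\<Sum>a | xown P a = i. primal_sol v $ a * (\<Sum>c\<in>UNIV. v $ c * grad (tot_fun c) x $ a)) =
    (\<Sum>a | xown P a = i. ?u $ a * (lagr_hess i *v ?u + (\<Sum>l\<in>loc i. local_sol i v $ Inr l *\<^sub>R grad (loc_fun l) x)) $ a)"
    by (intro sum.cong refl)
      (auto simp: primal_sol_def local_primal_def grad_tot local_sol_stationary[unfolded local_primal_def])
  also have "\<dots> = ?u \<bullet> (lagr_hess i *v ?u) +
      (\<Sum>l\<in>loc i. local_sol i v $ Inr l * (grad (loc_fun l) x \<bullet> ?u))"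
    unfolding restrict by (simp add: inner_add_right inner_sum_right inner_commute)
  also have "(\<Sum>l\<in>loc i. local_sol i v $ Inr l * (grad (loc_fun l) x \<bullet> ?u)) = 0"
    using local_sol_inactive local_sol_tangent by (intro sum.neutral) force
  finally show ?thesis by simp
qed

text \<open>
  By semidefiniteness, \<open>H u\<close> is orthogonal to the tangent space, hence a combination of the active
  gradients; this yields an element of the kernel of \<open>\<partial>\<^bsub>z\<^sub>i\<^esub> G\<^sub>i\<close> with primal part \<open>u\<close>.
\<close>

lemma local_energy_zero:
  assumes zero: "local_primal i v \<bullet> (lagr_hess i *v local_primal i v) = 0"
  shows "local_primal i v = 0"
proof -
  let ?u = "local_primal i v" and ?b = "\<lambda>l. grad (loc_fun l) x"
  let ?W = "{u. \<forall>l\<in>active i. ?b l \<bullet> u = 0}"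
  have W: "subspace ?W" by (auto simp: subspace_def inner_right_distrib)
  have orth: "h \<bullet> (lagr_hess i *v ?u) = 0" if "h \<in> ?W" for h
  proof (rule psd_form_kernel[of "lagr_hess i" ?W, OF lagr_hess_symmetric W _ _ zero that])
    show "0 \<le> w \<bullet> (lagr_hess i *v w)" if "w \<in> ?W" for w
      using that by (intro lagr_hess_psd) simp
    show "?u \<in> ?W" using local_sol_tangent by simp
  qed
  obtain w where w: "\<And>k l. k \<in> active i \<Longrightarrow> l \<in> active i \<Longrightarrow> ?b k \<bullet> w l = (if k = l then 1 else 0)"
    using independent_dual_family[OF active_inj active_independent] by metis
  define \<mu> where "\<mu> l = (lagr_hess i *v ?u) \<bullet> w l" for l
  \<comment> \<open>Subtracting the multiples \<open>(?b l \<bullet> h) *\<^sub>R w l\<close> moves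
    any \<open>h\<close> into \<open>?W\<close>, where \<open>orth\<close> applies; the correction
    terms supply the coefficients \<open>\<mu>\<close>.\<close>
  have Hu: "lagr_hess i *v ?u = (\<Sum>l\<in>active i. \<mu> l *\<^sub>R ?b l)"
  proof (rule vector_eq_rdot[THEN iffD1], rule allI)
    fix h
    have "?b k \<bullet> (h - (\<Sum>l\<in>active i. (?b l \<bullet> h) *\<^sub>R w l)) = 0" if k: "k \<in> active i" for k
    proof -
      have "(\<Sum>l\<in>active i. (?b l \<bullet> h) * (?b k \<bullet> w l)) = (\<Sum>l\<in>active i. if l = k then ?b k \<bullet> h else 0)"
        using k by (intro sum.cong) (auto simp: w)
      then show ?thesis using k by (simp add: inner_diff_right inner_sum_right)
    qed
    then have "(h - (\<Sum>l\<in>active i. (?b l \<bullet> h) *\<^sub>R w l)) \<bullet> (lagr_hess i *v ?u) = 0"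
      by (intro orth) simp
    then have "h \<bullet> (lagr_hess i *v ?u) = (\<Sum>l\<in>active i. (?b l \<bullet> h) * (w l \<bullet> (lagr_hess i *v ?u)))"
      by (simp add: inner_diff_left inner_sum_left)
    also have "\<dots> = (\<Sum>l\<in>active i. \<mu> l * (?b l \<bullet> h))"
      by (intro sum.cong) (simp_all add: \<mu>_def inner_commute[of "w _"])
    finally show "(lagr_hess i *v ?u) \<bullet> h = (\<Sum>l\<in>active i. \<mu> l *\<^sub>R ?b l) \<bullet> h"
      by (simp add: inner_sum_right inner_commute[of _ h])
  qed
  define z :: "real ^ ('x + 'l)" where
    "z = (\<chi> r. case r of Inl a \<Rightarrow> ?u $ a | Inr l \<Rightarrow> if l \<in> active i then - \<mu> l else 0)"
  have zu: "(\<chi> a. z $ Inl a) = ?u" by (simp add: z_def vec_eq_iff)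
  have act: "active i \<subseteq> loc i" by (auto simp: active_def loc_def)
  have "(\<Sum>l\<in>loc i. z $ Inr l * ?b l $ a) = - (\<Sum>l\<in>active i. \<mu> l * ?b l $ a)" for a
  proof -
    have "(\<Sum>l\<in>loc i. z $ Inr l * ?b l $ a) = (\<Sum>l\<in>active i. z $ Inr l * ?b l $ a)"
      using act by (intro sum.mono_neutral_right) (auto simp: z_def)
    also have "\<dots> = (\<Sum>l\<in>active i. - (\<mu> l * ?b l $ a))"
      by (intro sum.cong) (auto simp: z_def)
    finally show ?thesis by (simp add: sum_negf)
  qed
  moreover have "?b l \<bullet> ?u = 0" if "Inr l \<in> zidx P i" "l \<in> leqs P" for l
    using that by (intro local_sol_tangent) (auto simp: active_def zidx_def)
  \<comment> \<open>An active constraint has value zero and a gradient orthogonal to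
    \<open>?u\<close>; for an inactive one both the multiplier and the entry of \<open>z\<close> are
    zero.\<close>
  moreover have "m $ l * (?b l \<bullet> ?u) + z $ Inr l * loc_fun l x = 0"
    if l: "Inr l \<in> zidx P i" "l \<notin> leqs P" for l
  proof (cases "loc_fun l x = 0")
    case True
    then have "l \<in> active i" using l by (auto simp: active_def zidx_def)
    then show ?thesis using local_sol_tangent True by simp
  next
    case False
    moreover have "l \<notin> active i" using False l by (auto simp: active_def)
    moreover have "m $ l * loc_fun l x = 0" using KKT l unfolding KKT_def zidx_def by blast
    ultimately show ?thesis by (simp add: z_def)
  qed
  ultimately have "local_G_z P i x m d \<theta> *v z = 0"
    unfolding local_G_z_vector zu Hu vec_eq_iff
    by (auto simp: zidx_def split: sum.splits)
  then have "id_on (zidx P i) *v z = 0"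
    using local_inverse[of i] unfolding is_inverse_on_def
    by (metis matrix_vector_mul_assoc matrix_vector_mult_0_right)
  moreover have "z \<in> coord_space (zidx P i)"
  proof -
    have "z $ r = 0" if "r \<notin> zidx P i" for r
    proof (cases r)
      case (Inl a)
      then show ?thesis using that local_sol_support[of r i v] by (simp add: z_def local_primal_def)
    next
      case (Inr l)
      then have "l \<notin> active i" using that by (auto simp: zidx_def active_def)
      then show ?thesis using Inr by (simp add: z_def)
    qed
    then show ?thesis by (simp add: coord_space_def)
  qed
  ultimately have "z = 0" by (simp add: id_on_vector_coord_space)
  then show ?thesis unfolding zu[symmetric] by (simp add: vec_eq_iff)
qed

section \<open>The coupling matrix: injectivity, sparsity and isolated constraints\<close>

definition cweight :: "'c \<Rightarrow> real" where
  "cweight c = (if c \<in> ceqs P then 1 else d $ c)"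

lemma coupling_C_x_vector:
  "jacobian (\<lambda>x. coupling_C P x d \<theta>) (at x) *v h = (\<chi> c. cweight c * (grad (tot_fun c) x \<bullet> h))"
proof (rule jacobian_vector_unique, rule has_derivative_vecI)
  fix c
  have "((\<lambda>x. cweight c * tot_fun c x) has_derivative (\<lambda>h. cweight c * (grad (tot_fun c) x \<bullet> h))) (at x)"
    by (intro has_derivative_mult_right has_derivative_grad differentiable_tot)
  then show "((\<lambda>x. coupling_C P x d \<theta> $ c) has_derivative
      (\<lambda>h. (\<chi> c. cweight c * (grad (tot_fun c) x \<bullet> h)) $ c)) (at x)"
    by (cases "c \<in> ceqs P") (simp_all add: coupling_C_def cweight_def)
qed

lemma coupling_C_d_vector:
  "jacobian (\<lambda>d. coupling_C P x d \<theta>) (at d) *v h = (\<chi> c. if c \<in> ceqs P then 0 else h $ c * tot_fun c x)"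
proof (rule jacobian_vector_unique, rule has_derivative_vecI)
  fix c
  have "((\<lambda>d. d $ c * tot_fun c x) has_derivative (\<lambda>h. h $ c * tot_fun c x)) (at d)"
    by (intro has_derivative_mult_left bounded_linear.has_derivative[OF bounded_linear_vec_nth has_derivative_ident])
  then show "((\<lambda>d. coupling_C P x d \<theta> $ c) has_derivative
      (\<lambda>h. (\<chi> c. if c \<in> ceqs P then 0 else h $ c * tot_fun c x) $ c)) (at d)"
    by (cases "c \<in> ceqs P") (simp_all add: coupling_C_def)
qed

text \<open>The signs in \<open>coupling_matrix\<close> and \<open>stacked_dual\<close> cancel in
  the first term. The weight is the factor \<open>diag(\<lambda>)\<close>: positive on binding
  constraints by strict complementarity, zero on nonbinding ones, where only the diagonal term
  remains.\<close>

lemma coupling_matrix_vector: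
  "(D_mat *v v) $ c = cweight c * (grad (tot_fun c) x \<bullet> primal_sol v) -
     (if c \<in> ceqs P then 0 else v $ c * tot_fun c x)"
proof -
  have neg: "(- A) *v w = - (A *v w)" for A :: "real ^ 'c ^ 'c" and w
    by (simp add: vec_eq_iff matrix_vector_mult_def sum_negf)
  show ?thesis
    unfolding coupling_matrix_def neg matrix_vector_mult_add_rdistrib matrix_vector_mul_assoc[symmetric]
      stacked_dual_vector coupling_C_x_vector coupling_C_d_vector
    by simp
qed

text \<open>This is injectivity of the principal submatrix on \<open>V\<close>. Testing the rows in
  \<open>V\<close> suffices for the total energy to vanish, because \<open>v\<close> is zero
  elsewhere. All local responses are then zero, so the combination of coupling gradients with
  coefficients \<open>v\<close> equals one of active local gradients, and independence forces
  \<open>v = 0\<close>.\<close>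

lemma coupling_matrix_injective:
  assumes v: "v \<in> coord_space V" and Dv: "\<And>c. c \<in> V \<Longrightarrow> (D_mat *v v) $ c = 0"
  shows "v = 0"
proof -
  let ?A = "\<lambda>c. grad (tot_fun c) x" and ?b = "\<lambda>l. grad (loc_fun l) x"
  define B where "B = {c. Inr c \<in> binding P \<theta> x}"
  have B: "c \<in> B \<longleftrightarrow> c \<in> ceqs P \<or> tot_fun c x = 0" for c
    by (auto simp: B_def binding_def)
  have compl: "d $ c = 0" if "c \<notin> B" for c
    using that KKT by (auto simp: B KKT_def)
  \<comment> \<open>For a nonbinding constraint the row of \<open>D_mat\<close> is the nonzero slack
    on the diagonal, up to sign.\<close>
  have inactive: "v $ c = 0" if c: "c \<notin> B" for c
  proof (cases "c \<in> V")
    case True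
    then show ?thesis
      using Dv[OF True] c compl[OF c] by (simp add: coupling_matrix_vector cweight_def B)
  qed (use v in \<open>simp add: coord_space_def\<close>)
  have orth: "v $ c * (?A c \<bullet> primal_sol v) = 0" for c
  proof (cases "c \<in> B \<and> c \<in> V")
    case True
    then have "cweight c > 0"
      using strict_compl by (auto simp: cweight_def B strict_complementarity_def)
    moreover have "cweight c * (?A c \<bullet> primal_sol v) = 0"
      using Dv[of c] True by (auto simp: coupling_matrix_vector B split: if_splits)
    ultimately show ?thesis by simp
  qed (use inactive v in \<open>auto simp: coord_space_def\<close>)
  let ?r = "\<Sum>c\<in>UNIV. v $ c *\<^sub>R ?A c"
  let ?e = "\<lambda>i. local_primal i v \<bullet> (lagr_hess i *v local_primal i v)"
  have "(\<Sum>i\<in>UNIV. ?e i) = (\<Sum>i\<in>UNIV. \<Sum>a | xown P a = i. primal_sol v $ a * ?r $ a)"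
    by (simp add: local_energy)
  also have "\<dots> = (\<Sum>a\<in>UNIV. primal_sol v $ a * ?r $ a)"
    using sum.group[of UNIV UNIV "xown P" "\<lambda>a. primal_sol v $ a * ?r $ a"] by simp
  also have "\<dots> = primal_sol v \<bullet> ?r" by (simp add: inner_vec_def)
  also have "\<dots> = (\<Sum>c\<in>UNIV. v $ c * (?A c \<bullet> primal_sol v))"
    by (simp add: inner_sum_right inner_commute)
  also have "\<dots> = 0" by (intro sum.neutral ballI orth)
  finally have "(\<Sum>i\<in>UNIV. ?e i) = 0" .
  then have "?e i = 0" for i
    using sum_nonneg_eq_0_iff[of UNIV ?e] lagr_hess_psd local_sol_tangent by simp
  then have prim0: "local_primal i v = 0" for i by (rule local_energy_zero)
  \<comment> \<open>Every local constraint belongs to one subproblem, so the multiplier components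
    of all subproblems fit into one function, cut off to the binding constraints.\<close>
  define \<mu> where "\<mu> l = (if Inl l \<in> binding P \<theta> x then local_sol (lown P l) v $ Inr l else 0)" for l
  have \<mu>: "\<mu> l = local_sol i v $ Inr l" if "l \<in> loc i" for i l
    using that local_sol_inactive[of l i v] by (auto simp: \<mu>_def binding_def active_def loc_def)
  have "?r $ a = (\<Sum>l\<in>leqs P \<union> lineqs P. \<mu> l *\<^sub>R ?b l) $ a" for a
  proof -
    have "?r $ a = (\<Sum>l\<in>loc (xown P a). local_sol (xown P a) v $ Inr l * ?b l $ a)"
      using local_sol_stationary[OF refl, of a v] by (simp add: prim0 grad_tot)
    also have "\<dots> = (\<Sum>l\<in>loc (xown P a). \<mu> l * ?b l $ a)"
      by (intro sum.cong) (auto simp: \<mu>)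
    also have "\<dots> = (\<Sum>l\<in>leqs P \<union> lineqs P. \<mu> l * ?b l $ a)"
      by (intro sum.mono_neutral_left) (auto simp: loc_def intro!: grad_loc_block)
    finally show ?thesis by simp
  qed
  then have eq: "?r = (\<Sum>l\<in>leqs P \<union> lineqs P. \<mu> l *\<^sub>R ?b l)" by (simp add: vec_eq_iff)
  obtain w where w: "\<And>k l. k \<in> binding P \<theta> x \<Longrightarrow> l \<in> binding P \<theta> x \<Longrightarrow>
      constraint_grad P \<theta> x k \<bullet> w l = (if k = l then 1 else 0)"
    using LICQ independent_dual_family unfolding LICQ_def by metis
  have "v $ c = 0" for c
  proof (cases "c \<in> B")
    case True
    then have cb: "Inr c \<in> binding P \<theta> x" by (simp add: B_def)
    have 1: "v $ c' * (?A c' \<bullet> w (Inr c)) = (if c' = c then v $ c else 0)" for c'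
      using w[OF _ cb, of "Inr c'"] inactive[of c'] by (cases "c' \<in> B") (auto simp: B_def constraint_grad_def)
    have 2: "\<mu> l * (?b l \<bullet> w (Inr c)) = 0" for l
      using w[OF _ cb, of "Inl l"] by (auto simp: \<mu>_def constraint_grad_def)
    have "v $ c = ?r \<bullet> w (Inr c)" by (simp add: inner_sum_left 1)
    also have "\<dots> = 0" unfolding eq by (simp add: inner_sum_left 2)
    finally show ?thesis .
  qed (rule inactive)
  then show ?thesis by (simp add: vec_eq_iff)
qed

lemma not_involved_grad:
  assumes "\<not> involved P i c"
  shows "grad (cpl_fun i c) x = 0"
proof -
  have "cpl_fun i c y = cpl_fun i c x" for y
    using assms by (auto simp: involved_def)
  then have "(cpl_fun i c has_derivative (\<lambda>h. 0 \<bullet> h)) (at x)"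
    by (simp add: has_derivative_transform[OF _ _ has_derivative_const[of "cpl_fun i c x"]])
  then show ?thesis by (rule grad_unique)
qed

text \<open>Changing the dual variable of \<open>c'\<close> moves only the blocks of subproblems
  involved in \<open>c'\<close>, and the gradient of constraint \<open>c\<close> lives on the blocks
  of those involved in \<open>c\<close>. The diagonal is excluded because of the slack term.\<close>

lemma coupling_matrix_sparse:
  assumes "D_mat $ c $ c' \<noteq> 0" and "c \<noteq> c'"
  shows "\<exists>i. involved P i c \<and> involved P i c'"
proof (rule ccontr)
  assume none: "\<not> ?thesis"
  have sol: "local_sol i (axis c' 1) = 0" if "\<not> involved P i c'" for i
  proof -
    have "(\<Sum>b\<in>UNIV. axis c' 1 $ b * grad (cpl_fun i b) x $ a) = 0" for a
      using not_involved_grad[OF that] by (intro sum.neutral) (auto simp: axis_def)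
    then have "jacobian (\<lambda>d. local_G P i (zpair x m) d \<theta>) (at d) *v axis c' 1 = 0"
      by (auto simp: local_G_d_vector vec_eq_iff split: sum.split)
    then show ?thesis by (simp add: local_sol_def)
  qed
  have "grad (tot_fun c) x $ a * primal_sol (axis c' 1) $ a = 0" for a
    using none not_involved_grad[of "xown P a" c] sol[of "xown P a"]
    by (cases "involved P (xown P a) c") (auto simp: grad_tot primal_sol_def)
  then have "grad (tot_fun c) x \<bullet> primal_sol (axis c' 1) = 0"
    unfolding inner_vec_def inner_real_def by (intro sum.neutral ballI)
  moreover have "(D_mat *v axis c' 1) $ c = D_mat $ c $ c'"
    by (simp add: matrix_vector_mult_basis column_def)
  moreover have "axis c' 1 $ c = (0::real)" using assms(2) by (simp add: axis_def)
  ultimately show False using assms(1) by (simp add: coupling_matrix_vector split: if_splits)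
qed

text \<open>The constraint gradient is zero, and an independent family contains no zero vector;
  complementarity then makes the dual variable zero.\<close>

lemma isolated_constraint_nonbinding:
  assumes "\<And>i. \<not> involved P i c"
  shows "c \<notin> ceqs P" "tot_fun c x \<noteq> 0" "d $ c = 0"
proof -
  have "constraint_grad P \<theta> x (Inr c) = 0"
    using not_involved_grad[OF assms] by (simp add: constraint_grad_def vec_eq_iff grad_tot)
  moreover have "0 \<notin> constraint_grad P \<theta> x ` binding P \<theta> x"
    using LICQ dependent_zero[of "constraint_grad P \<theta> x ` binding P \<theta> x"] by (auto simp: LICQ_def)
  ultimately have "Inr c \<notin> binding P \<theta> x" by (metis imageI)
  then show c: "c \<notin> ceqs P" "tot_fun c x \<noteq> 0" by (auto simp: binding_def)
  then show "d $ c = 0" using KKT by (auto simp: KKT_def)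
qed

text \<open>Row \<open>c\<close> of the right-hand side carries the factor \<open>d $ c = 0\<close>,
  and row \<open>c\<close> of \<open>D_mat\<close> is a nonzero diagonal entry. Averaging sets this
  row of every new iterate to zero, so the solution has to agree.\<close>

lemma isolated_constraint_solution:
  assumes iso: "\<And>i. \<not> involved P i c" and sol: "D_mat ** ystar = coupling_rhs P x m d \<theta>"
  shows "ystar $ c $ j = 0"
proof -
  note c = isolated_constraint_nonbinding[OF iso]
  have row: "coupling_rhs P x m d \<theta> $ c $ j = 0"
  proof -
    let ?Jx = "jacobian (\<lambda>x. coupling_C P x d \<theta>) (at x)"
      and ?Jt = "jacobian (\<lambda>\<theta>. coupling_C P x d \<theta>) (at \<theta>)"
    \<comment> \<open>Differentiability of all components is needed: \<open>jacobian\<close> is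
      unspecified unless the whole map is differentiable, even if component \<open>c\<close> is
      constant.\<close>
    have "(\<lambda>\<theta>. coupling_C P x d \<theta> $ b) differentiable (at \<theta>)" for b
    proof -
      have "(\<lambda>\<theta>. total_cpl P b x \<theta>) differentiable (at \<theta>)"
        unfolding total_cpl_def using differentiable_cpl_param by (auto intro!: differentiable_sum)
      then show ?thesis
        by (cases "b \<in> ceqs P") (auto simp: coupling_C_def intro!: differentiable_mult)
    qed
    then have "(\<lambda>\<theta>. coupling_C P x d \<theta>) differentiable (at \<theta>)"
      by (subst differentiable_componentwise_within) (auto simp: Basis_vec_def inner_axis)
    then have "((\<lambda>\<theta>. coupling_C P x d \<theta>) has_derivative (\<lambda>h. ?Jt *v h)) (at \<theta>)"
      by (simp add: jacobian_works)
    then have "((\<lambda>\<theta>. coupling_C P x d \<theta> $ c) has_derivative (\<lambda>h. (?Jt *v h) $ c)) (at \<theta>)"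
      by (rule has_derivative_vecD)
    moreover have "((\<lambda>\<theta>. coupling_C P x d \<theta> $ c) has_derivative (\<lambda>h. 0)) (at \<theta>)"
      using c by (simp add: coupling_C_def)
    ultimately have "(\<lambda>h. (?Jt *v h) $ c) = (\<lambda>h. 0)" by (rule has_derivative_unique)
    then have "(?Jt *v axis j 1) $ c = 0" by metis
    then have Jt: "?Jt $ c $ j = 0" by (simp add: matrix_vector_mult_basis column_def)
    have "?Jx $ c $ a = 0" for a
    proof -
      have "?Jx $ c $ a = (?Jx *v axis a 1) $ c" by (simp add: matrix_vector_mult_basis column_def)
      also have "\<dots> = 0" using c unfolding coupling_C_x_vector by (simp add: cweight_def)
      finally show ?thesis .
    qed
    then show ?thesis using Jt by (simp add: coupling_rhs_def matrix_matrix_mult_def)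
  qed
  have "(D_mat ** ystar) $ c $ j = (D_mat *v column j ystar) $ c"
    by (simp add: matrix_matrix_mult_def matrix_vector_mult_def column_def)
  also have "\<dots> = - (ystar $ c $ j * tot_fun c x)"
    unfolding coupling_matrix_vector using c by (simp add: cweight_def column_def)
  finally show ?thesis using row sol c by simp
qed

end

section \<open>The bipartite graph and the iteration\<close>

lemma graph_dist_le_iff:
  "graph_dist P u v \<le> enat n \<longleftrightarrow> (\<exists>k\<le>n. (u, v) \<in> graph_edges P ^^ k)"
proof
  assume "graph_dist P u v \<le> enat n"
  then have "(INF k \<in> {k. (u, v) \<in> graph_edges P ^^ k}. enat k) < enat (Suc n)"
    unfolding graph_dist_def by (rule le_less_trans) simp
  then show "\<exists>k\<le>n. (u, v) \<in> graph_edges P ^^ k"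
    by (auto simp: INF_less_iff less_Suc_eq_le)
next
  assume "\<exists>k\<le>n. (u, v) \<in> graph_edges P ^^ k"
  then show "graph_dist P u v \<le> enat n"
    unfolding graph_dist_def by (auto intro: INF_lower2)
qed

lemma graph_dist_refl: "graph_dist P u u = 0"
proof -
  have "graph_dist P u u \<le> enat 0" by (subst graph_dist_le_iff) auto
  then show ?thesis by (simp add: zero_enat_def[symmetric])
qed

lemma graph_edges_sym: "(u, v) \<in> graph_edges P ^^ n \<longleftrightarrow> (v, u) \<in> graph_edges P ^^ n"
proof -
  have "(v, u) \<in> graph_edges P ^^ n" if "(u, v) \<in> graph_edges P ^^ n" for u v
    using that
  proof (induction n arbitrary: v)
    case (Suc n)
    then obtain w where "(u, w) \<in> graph_edges P ^^ n" "(w, v) \<in> graph_edges P" by auto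
    moreover from this have "(v, w) \<in> graph_edges P" by (auto simp: graph_edges_def)
    ultimately show ?case using Suc.IH by (blast intro: relpow_Suc_I2)
  qed simp
  then show ?thesis by blast
qed

lemma graph_dist_sym: "graph_dist P u v = graph_dist P v u"
proof -
  have "{n. (u, v) \<in> graph_edges P ^^ n} = {n. (v, u) \<in> graph_edges P ^^ n}"
    using graph_edges_sym by blast
  then show ?thesis by (simp only: graph_dist_def)
qed

lemma graph_dist_triangle: "graph_dist P u w \<le> graph_dist P u v + graph_dist P v w"
proof (cases "graph_dist P u v")
  case (enat a)
  show ?thesis
  proof (cases "graph_dist P v w")
    case (enat b)
    obtain k where k: "k \<le> a" "(u, v) \<in> graph_edges P ^^ k"
      using graph_dist_le_iff[of P u v a] \<open>graph_dist P u v = enat a\<close> by auto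
    obtain l where l: "l \<le> b" "(v, w) \<in> graph_edges P ^^ l"
      using graph_dist_le_iff[of P v w b] enat by auto
    have "(u, w) \<in> graph_edges P ^^ (k + l)" using k l by (auto simp: relpow_add)
    then have "graph_dist P u w \<le> enat (a + b)"
      using k l by (subst graph_dist_le_iff) (metis add_mono)
    then show ?thesis using enat \<open>graph_dist P u v = enat a\<close> by simp
  qed simp
qed simp

lemma nbhd_0: "nbhd P 0 k = {c. involved P k c}"
proof -
  have "graph_dist P (Inr c) (Inl k) \<le> enat 1 \<longleftrightarrow> involved P k c" for c
  proof -
    have "(\<exists>n\<le>1. (Inr c, Inl k) \<in> graph_edges P ^^ n) \<longleftrightarrow> (Inr c, Inl k) \<in> graph_edges P"
      by (auto simp: le_Suc_eq)
    then show ?thesis by (simp only: graph_dist_le_iff) (auto simp: graph_edges_def)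
  qed
  then show ?thesis by (simp add: nbhd_def)
qed

lemma nbhd_0_subset: "nbhd P 0 k \<subseteq> nbhd P \<omega> k"
proof
  fix c assume "c \<in> nbhd P 0 k"
  then have "graph_dist P (Inr c) (Inl k) \<le> enat (2 * 0 + 1)" by (simp add: nbhd_def)
  also have "\<dots> \<le> enat (2 * \<omega> + 1)" by simp
  finally show "c \<in> nbhd P \<omega> k" by (simp add: nbhd_def)
qed

text \<open>A witness is required because \<open>LEAST\<close> says nothing otherwise, and no bound
  would exist if an entry between unconnected constraints were nonzero.\<close>

lemma bandwidth_banded:
  assumes "banded (\<lambda>i j. graph_dist P (Inr i) (Inr j)) A b"
  shows "banded (\<lambda>i j. graph_dist P (Inr i) (Inr j)) A (bandwidth P A)"
  using assms unfolding banded_def bandwidth_def 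
  by (rule LeastI[where P = "\<lambda>B. \<forall>i j. graph_dist P (Inr i) (Inr j) > enat B \<longrightarrow> A $ i $ j = 0"])

lemma C_in_entry:
  "C_in P D \<omega> k $ i $ j = (if i \<in> nbhd P \<omega> k \<and> j \<in> nbhd P \<omega> k then D $ i $ j else 0)"
  by (simp add: C_in_def id_on_mult_right id_on_mult_left)

lemma C_out_entry:
  "C_out P D \<omega> k $ i $ j = (if i \<in> nbhd P \<omega> k \<and> j \<notin> nbhd P \<omega> k then D $ i $ j else 0)"
  by (simp add: C_out_def id_on_mult_right id_on_mult_left)

lemma id_on_mult_subset: "I \<subseteq> J \<Longrightarrow> id_on I ** id_on J = (id_on I :: real ^ 'n::finite ^ 'n)"
  unfolding vec_eq_iff id_on_mult_left by (auto simp: id_on_def)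

lemma norm_inf_row: "(\<Sum>j\<in>UNIV. \<bar>A $ i $ j\<bar>) \<le> norm_inf A"
  unfolding norm_inf_def by (rule Max_ge) auto

lemma norm_inf_le:
  assumes "\<And>i. (\<Sum>j\<in>UNIV. \<bar>A $ i $ j\<bar>) \<le> b"
  shows "norm_inf A \<le> b"
  unfolding norm_inf_def using assms by (subst Max_le_iff) auto

lemma norm_inf_nonneg: "0 \<le> norm_inf A"
  by (rule order_trans[OF sum_nonneg norm_inf_row[of A undefined]]) simp

lemma norm_inf_row_mult:
  fixes A :: "real ^ 'n::finite ^ 'm::finite" and E :: "real ^ 'k::finite ^ 'n"
  shows "(\<Sum>j\<in>UNIV. \<bar>(A ** E) $ i $ j\<bar>) \<le> (\<Sum>l\<in>UNIV. \<bar>A $ i $ l\<bar>) * norm_inf E"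
proof -
  have "(\<Sum>j\<in>UNIV. \<bar>(A ** E) $ i $ j\<bar>) \<le> (\<Sum>j\<in>UNIV. \<Sum>l\<in>UNIV. \<bar>A $ i $ l\<bar> * \<bar>E $ l $ j\<bar>)"
    by (intro sum_mono) (simp add: matrix_matrix_mult_def order.trans[OF sum_abs] abs_mult)
  also have "\<dots> = (\<Sum>l\<in>UNIV. \<bar>A $ i $ l\<bar> * (\<Sum>j\<in>UNIV. \<bar>E $ l $ j\<bar>))"
    by (subst sum.swap) (simp add: sum_distrib_left)
  also have "\<dots> \<le> (\<Sum>l\<in>UNIV. \<bar>A $ i $ l\<bar> * norm_inf E)"
    by (intro sum_mono mult_left_mono norm_inf_row) simp
  finally show ?thesis by (simp add: sum_distrib_right)
qed

lemma R_const_nonneg: "0 \<le> R_const P D \<omega> k"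
  by (simp add: R_const_def sum_nonneg)

lemma decay_nonneg: "0 \<le> \<rho> \<Longrightarrow> 0 \<le> decay \<rho> \<omega> b"
  by (simp add: decay_def)

text \<open>A positive value of the ceiling of \<open>r - 1\<close> is less than \<open>r\<close>,
  so \<open>2 * n * b < \<omega>\<close>. The case \<open>b = 0\<close> is excluded by
  \<open>0 < n\<close>, since division by zero gives \<open>0\<close>.\<close>

lemma decay_exponent:
  assumes "nat \<lceil>real \<omega> / (2 * real b) - 1\<rceil> = n" and "0 < n"
  shows "(2 * n - 1) * b \<le> \<omega> - 1" "0 < \<omega>"
proof -
  have n: "real n < real \<omega> / (2 * real b)"
    using assms by linarith
  then have "b \<noteq> 0" using assms(2) by (intro notI) simp
  then have "real (2 * n * b) < real \<omega>" using n by (simp add: field_simps)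
  then have *: "2 * n * b < \<omega>" by (simp only: of_nat_less_iff)
  then show "0 < \<omega>" by simp
  have "(2 * n - 1) * b \<le> 2 * n * b" by (rule mult_right_mono) simp_all
  then show "(2 * n - 1) * b \<le> \<omega> - 1" using * by linarith
qed

section \<open>Blocks of the coupling matrix and the error recursion\<close>

context kkt_point
begin

abbreviation gd :: "'c \<Rightarrow> 'c \<Rightarrow> enat" where
  "gd i j \<equiv> graph_dist P (Inr i) (Inr j)"

lemma coupling_matrix_dist:
  assumes "D_mat $ c $ c' \<noteq> 0"
  shows "gd c c' \<le> enat 2"
proof (cases "c = c'")
  case False
  then obtain i where i: "involved P i c" "involved P i c'"
    using coupling_matrix_sparse[OF assms] by blast
  then have "(Inr c, Inl i) \<in> graph_edges P" "(Inl i, Inr c') \<in> graph_edges P"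
    by (auto simp: graph_edges_def)
  then have "(Inr c, Inr c') \<in> graph_edges P ^^ 2"
    by (auto simp: numeral_2_eq_2)
  then show ?thesis by (subst graph_dist_le_iff) auto
qed (simp add: graph_dist_refl)

lemma C_in_banded: "banded gd (C_in P D_mat \<omega> k) (bandwidth P (C_in P D_mat \<omega> k))"
proof (rule bandwidth_banded)
  show "banded gd (C_in P D_mat \<omega> k) 2"
    using coupling_matrix_dist by (auto simp: banded_def C_in_entry not_le[symmetric])
qed

lemma C_in_supported: "supported_matrix (nbhd P \<omega> k) (C_in P D_mat \<omega> k)"
  by (simp add: supported_matrix_def C_in_entry)

lemma C_in_injective:
  assumes v: "v \<in> coord_space (nbhd P \<omega> k)" and z: "C_in P D_mat \<omega> k *v v = 0"
  shows "v = 0"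
proof (rule coupling_matrix_injective[OF v])
  fix c assume c: "c \<in> nbhd P \<omega> k"
  have "(D_mat *v v) $ c = (C_in P D_mat \<omega> k *v v) $ c"
    unfolding matrix_vector_mult_def vec_lambda_beta
    using c v by (intro sum.cong) (auto simp: C_in_entry coord_space_def)
  then show "(D_mat *v v) $ c = 0" by (simp add: z)
qed

abbreviation C_inv :: "nat \<Rightarrow> 'p \<Rightarrow> real ^ 'c ^ 'c" where
  "C_inv \<omega> k \<equiv> inverse_on (nbhd P \<omega> k) (C_in P D_mat \<omega> k)"

lemma C_inv: "is_inverse_on (nbhd P \<omega> k) (C_in P D_mat \<omega> k) (C_inv \<omega> k)"
  by (rule inverse_on_works[OF injective_imp_invertible_on[OF C_in_supported C_in_injective]])

lemma sigma_min_pos: "nbhd P \<omega> k \<noteq> {} \<Longrightarrow> 0 < sigma_min P D_mat \<omega> k"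
  unfolding sigma_min_def by (rule Min_singular_values_pos[OF C_in_supported _ C_in_injective])

lemma sigma_min_le_max: "nbhd P \<omega> k \<noteq> {} \<Longrightarrow> sigma_min P D_mat \<omega> k \<le> sigma_max P D_mat \<omega> k"
  unfolding sigma_min_def sigma_max_def
  using finite_singular_values_on[OF C_in_supported] singular_values_on_nonempty[OF C_in_supported]
  by (metis Max_ge Min_in)

definition contraction :: "nat \<Rightarrow> 'p \<Rightarrow> real" where
  "contraction \<omega> k = ((sigma_max P D_mat \<omega> k)\<^sup>2 - (sigma_min P D_mat \<omega> k)\<^sup>2) /
     ((sigma_max P D_mat \<omega> k)\<^sup>2 + (sigma_min P D_mat \<omega> k)\<^sup>2)"

lemma contraction_bounds:
  assumes "nbhd P \<omega> k \<noteq> {}"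
  shows "0 \<le> contraction \<omega> k" "contraction \<omega> k < 1"
proof -
  have "0 < (sigma_min P D_mat \<omega> k)\<^sup>2" using sigma_min_pos[OF assms] by simp
  moreover have "(sigma_min P D_mat \<omega> k)\<^sup>2 \<le> (sigma_max P D_mat \<omega> k)\<^sup>2"
    using sigma_min_pos[OF assms] sigma_min_le_max[OF assms] by (intro power_mono) auto
  moreover from calculation have "0 < (sigma_max P D_mat \<omega> k)\<^sup>2 + (sigma_min P D_mat \<omega> k)\<^sup>2"
    by linarith
  ultimately show "0 \<le> contraction \<omega> k" "contraction \<omega> k < 1"
    unfolding contraction_def by simp_all
qed

text \<open>The term of \<open>rate\<close> for \<open>k\<close> without the factor
  \<open>R_const\<close>.\<close>

definition entry_bound :: "nat \<Rightarrow> 'p \<Rightarrow> real" where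
  "entry_bound \<omega> k = sigma_max P D_mat \<omega> k / (sigma_min P D_mat \<omega> k)\<^sup>2 *
     decay (contraction \<omega> k) \<omega> (bandwidth P (C_in P D_mat \<omega> k))"

lemma entry_bound_nonneg: "nbhd P \<omega> k \<noteq> {} \<Longrightarrow> 0 \<le> entry_bound \<omega> k"
  using sigma_min_pos[of \<omega> k] sigma_min_le_max[of \<omega> k] contraction_bounds[of \<omega> k]
  by (simp add: entry_bound_def decay_nonneg)

text \<open>A nonzero row \<open>i\<close> of \<open>C_out\<close> is a neighbour of a constraint
  outside the neighbourhood, hence far from \<open>c\<close>; \<open>inverse_entry_decay\<close>
  then applies with the exponent of the rate.\<close>

lemma C_inv_entry_bound:
  assumes c: "c \<in> nbhd P 0 k" and out: "C_out P D_mat \<omega> k $ i $ l \<noteq> 0"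
  shows "\<bar>C_inv \<omega> k $ c $ i\<bar> \<le> entry_bound \<omega> k"
proof -
  let ?\<rho> = "contraction \<omega> k" and ?b = "bandwidth P (C_in P D_mat \<omega> k)"
    and ?s0 = "sigma_min P D_mat \<omega> k" and ?s1 = "sigma_max P D_mat \<omega> k"
  have ne: "nbhd P \<omega> k \<noteq> {}" using c nbhd_0_subset[of P k \<omega>] by auto
  note s = sigma_min_pos[OF ne] sigma_min_le_max[OF ne] and \<rho> = contraction_bounds[OF ne]
  have i: "i \<in> nbhd P \<omega> k" and l: "l \<notin> nbhd P \<omega> k" and il: "D_mat $ i $ l \<noteq> 0"
    using out by (auto simp: C_out_entry split: if_splits)
  \<comment> \<open>If \<open>i\<close> were within \<open>\<omega> - 1\<close> of \<open>c\<close>,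
    then \<open>l\<close> would be within \<open>2 + (\<omega> - 1) + 1\<close> of \<open>k\<close>,
    which is at most \<open>2 * \<omega> + 1\<close> because
    \<open>\<omega> \<ge> 1\<close>.\<close>
  have far: "gd c i > enat (\<omega> - 1)" if "\<omega> > 0"
  proof (rule ccontr)
    assume "\<not> ?thesis"
    then have "gd i c \<le> enat (\<omega> - 1)" by (simp add: graph_dist_sym[of P "Inr i" "Inr c"])
    moreover have "gd l i \<le> enat 2"
      using coupling_matrix_dist[OF il] by (simp add: graph_dist_sym[of P "Inr l" "Inr i"])
    moreover have "graph_dist P (Inr c) (Inl k) \<le> enat 1"
      using c by (simp add: nbhd_def)
    moreover have "graph_dist P (Inr l) (Inl k) \<le> gd l i + (gd i c + graph_dist P (Inr c) (Inl k))"
      by (meson add_left_mono graph_dist_triangle order_trans)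
    ultimately have "graph_dist P (Inr l) (Inl k) \<le> enat 2 + (enat (\<omega> - 1) + enat 1)"
      by (meson add_mono order_trans)
    also have "\<dots> \<le> enat (2 * \<omega> + 1)" using that by simp
    finally show False using l by (simp add: nbhd_def)
  qed
  have decay: "\<bar>C_inv \<omega> k $ c $ i\<bar> \<le> ?\<rho> ^ n / ?s0" if "n = 0 \<or> gd c i > enat ((2 * n - 1) * ?b)" for n
    unfolding contraction_def sigma_min_def sigma_max_def
    by (rule inverse_entry_decay[OF C_in_supported ne C_inv s(1)[unfolded sigma_min_def]
          graph_dist_refl graph_dist_sym graph_dist_triangle C_in_banded that])
  show ?thesis
  proof (cases "?b = 0 \<and> \<omega> > 0")
    case True
    \<comment> \<open>With bandwidth \<open>0\<close> all partial sums are diagonal, so the decay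
      estimate holds for every \<open>n\<close> and the limit gives a zero entry, matching the value
      \<open>0\<close> of \<open>decay\<close>.\<close>
    then have "gd c i > enat 0" using far by (metis enat_0 le_less_trans zero_le)
    then have "\<bar>C_inv \<omega> k $ c $ i\<bar> \<le> ?\<rho> ^ n / ?s0" for n
      using True by (intro decay) simp
    moreover have "(\<lambda>n. ?\<rho> ^ n / ?s0) \<longlonglongrightarrow> 0 / ?s0"
      using \<rho> s by (intro tendsto_divide LIMSEQ_power_zero tendsto_const) auto
    ultimately have "\<bar>C_inv \<omega> k $ c $ i\<bar> \<le> 0 / ?s0"
      by (intro LIMSEQ_le_const) auto
    then show ?thesis using entry_bound_nonneg[OF ne] by simp
  next
    case False
    define n where "n = nat \<lceil>real \<omega> / (2 * real ?b) - 1\<rceil>"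
    have "n = 0 \<or> gd c i > enat ((2 * n - 1) * ?b)"
    proof (cases "n = 0")
      case n: False
      with decay_exponent[OF n_def[symmetric]] have "enat ((2 * n - 1) * ?b) \<le> enat (\<omega> - 1)" "0 < \<omega>"
        by auto
      then show ?thesis using far by (meson le_less_trans)
    qed simp
    then have "\<bar>C_inv \<omega> k $ c $ i\<bar> \<le> ?\<rho> ^ n / ?s0" by (rule decay)
    \<comment> \<open>Enlarging the numerator to \<open>?s1\<close> produces the leading factor of
      the rate.\<close>
    also have "\<dots> = ?s0 / ?s0\<^sup>2 * ?\<rho> ^ n" using s by (simp add: power2_eq_square)
    also have "\<dots> \<le> ?s1 / ?s0\<^sup>2 * ?\<rho> ^ n"
      using s \<rho> by (intro mult_right_mono divide_right_mono) auto
    also have "\<dots> = entry_bound \<omega> k"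
      using False by (auto simp: entry_bound_def decay_def n_def)
    finally show ?thesis .
  qed
qed

lemma S_block_eq: "S_block P D_mat \<omega> k = - (id_on (nbhd P 0 k) ** C_inv \<omega> k ** C_out P D_mat \<omega> k)"
proof -
  have "C_out P D_mat \<omega> k ** id_on (- nbhd P \<omega> k) = C_out P D_mat \<omega> k"
    by (auto simp: vec_eq_iff id_on_mult_right C_out_entry)
  moreover have "id_on (nbhd P 0 k) ** id_on (nbhd P \<omega> k) = (id_on (nbhd P 0 k) :: real ^ 'c ^ 'c)"
    by (rule id_on_mult_subset[OF nbhd_0_subset])
  ultimately show ?thesis
    by (simp add: S_block_def flip: matrix_mul_assoc)
qed

lemma C_inv_id_right: "C_inv \<omega> k ** id_on (nbhd P \<omega> k) = C_inv \<omega> k"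
  using C_inv[of \<omega> k]
  by (intro supported_matrix_id_right) (simp add: is_inverse_on_def supported_matrix_def)

lemma U_block_eq: "U_block P D_mat \<omega> k = id_on (nbhd P 0 k) ** C_inv \<omega> k"
proof -
  have "id_on (nbhd P 0 k) ** id_on (nbhd P \<omega> k) = (id_on (nbhd P 0 k) :: real ^ 'c ^ 'c)"
    by (rule id_on_mult_subset[OF nbhd_0_subset])
  then show ?thesis
    by (simp add: U_block_def C_inv_id_right flip: matrix_mul_assoc)
qed

text \<open>Only entries of the inverse that meet a nonzero entry of \<open>C_out\<close> count, and
  all of these obey \<open>entry_bound\<close>; what remains is the total absolute mass of
  \<open>C_out\<close>.\<close>

lemma S_block_row_sum:
  assumes c: "c \<in> nbhd P 0 k"
  shows "(\<Sum>l\<in>UNIV. \<bar>S_block P D_mat \<omega> k $ c $ l\<bar>) \<le> R_const P D_mat \<omega> k * entry_bound \<omega> k"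
proof -
  let ?B = "C_inv \<omega> k" and ?C = "C_out P D_mat \<omega> k"
  have entry: "S_block P D_mat \<omega> k $ c $ l = - (\<Sum>i\<in>UNIV. ?B $ c $ i * ?C $ i $ l)" for l
    using c unfolding S_block_eq matrix_mul_assoc[symmetric]
    by (simp add: id_on_mult_left) (simp add: matrix_matrix_mult_def)
  have "(\<Sum>l\<in>UNIV. \<bar>S_block P D_mat \<omega> k $ c $ l\<bar>) \<le> (\<Sum>l\<in>UNIV. \<Sum>i\<in>UNIV. \<bar>?B $ c $ i * ?C $ i $ l\<bar>)"
    unfolding entry abs_minus_cancel by (intro sum_mono sum_abs)
  also have "\<dots> \<le> (\<Sum>l\<in>UNIV. \<Sum>i\<in>UNIV. entry_bound \<omega> k * \<bar>?C $ i $ l\<bar>)"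
  proof (intro sum_mono)
    fix i l
    show "\<bar>?B $ c $ i * ?C $ i $ l\<bar> \<le> entry_bound \<omega> k * \<bar>?C $ i $ l\<bar>"
      using C_inv_entry_bound[OF c, of \<omega> i l]
      by (cases "?C $ i $ l = 0") (auto simp: abs_mult intro: mult_right_mono)
  qed
  also have "\<dots> = entry_bound \<omega> k * (\<Sum>i\<in>UNIV. \<Sum>l\<in>UNIV. \<bar>?C $ i $ l\<bar>)"
    by (subst sum.swap) (simp add: sum_distrib_left)
  also have "(\<Sum>i\<in>UNIV. \<Sum>l\<in>UNIV. \<bar>?C $ i $ l\<bar>) = R_const P D_mat \<omega> k"
    unfolding R_const_def
    by (intro sum.mono_neutral_cong_right) (auto simp: C_out_entry intro!: sum.mono_neutral_cong_right)
  finally show ?thesis by (simp add: mult.commute)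
qed

text \<open>The rows of the system belonging to the neighbourhood, solved for the unknowns inside it
  with the outside values taken from \<open>ystar\<close>.\<close>

lemma block_fixed_point:
  assumes sol: "D_mat ** ystar = q" and c: "c \<in> nbhd P 0 k"
  shows "(S_block P D_mat \<omega> k ** ystar + U_block P D_mat \<omega> k ** q) $ c = ystar $ c"
proof -
  let ?T = "id_on (nbhd P 0 k) :: real ^ 'c ^ 'c" and ?I = "id_on (nbhd P \<omega> k) :: real ^ 'c ^ 'c"
    and ?B = "C_inv \<omega> k" and ?A = "C_in P D_mat \<omega> k" and ?C = "C_out P D_mat \<omega> k"
  have B: "?B ** ?A = ?I" "?B ** ?I = ?B"
    using C_inv[of \<omega> k] by (simp_all add: is_inverse_on_def C_inv_id_right)
  have split: "?I ** D_mat = ?A + ?C"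
    by (simp add: vec_eq_iff id_on_mult_left C_in_entry C_out_entry)
  have "?B ** D_mat = ?B ** (?I ** D_mat)"
    by (simp add: B(2) matrix_mul_assoc)
  also have "\<dots> = ?I + ?B ** ?C"
    by (simp add: split matrix_add_ldistrib B(1))
  finally have BD: "?B ** D_mat = ?I + ?B ** ?C" .
  have U: "U_block P D_mat \<omega> k ** q = ?T ** ((?I + ?B ** ?C) ** ystar)"
    unfolding U_block_eq sol[symmetric] BD[symmetric] by (simp add: matrix_mul_assoc)
  have S: "S_block P D_mat \<omega> k ** ystar = - (?T ** ((?B ** ?C) ** ystar))"
    unfolding S_block_eq
    by (simp add: matrix_mul_assoc matrix_diff_rdistrib[of 0, simplified])
  have "S_block P D_mat \<omega> k ** ystar + U_block P D_mat \<omega> k ** q = ?T ** (?I ** ystar)"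
    unfolding U S by (simp add: matrix_add_rdistrib matrix_add_ldistrib)
  then show ?thesis
    using c nbhd_0_subset[of P k \<omega>] by (auto simp: vec_eq_iff id_on_mult_left)
qed

lemma rate_term:
  "R_const P D_mat \<omega> k * entry_bound \<omega> k \<le> rate P D_mat \<omega>"
proof -
  let ?f = "\<lambda>k. let \<sigma>1 = sigma_max P D_mat \<omega> k; \<sigma>0 = sigma_min P D_mat \<omega> k in
     R_const P D_mat \<omega> k * \<sigma>1 / \<sigma>0\<^sup>2 *
     decay ((\<sigma>1\<^sup>2 - \<sigma>0\<^sup>2) / (\<sigma>1\<^sup>2 + \<sigma>0\<^sup>2)) \<omega> (bandwidth P (C_in P D_mat \<omega> k))"
  have "R_const P D_mat \<omega> k * entry_bound \<omega> k = ?f k"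
    by (simp add: entry_bound_def contraction_def Let_def)
  also have "\<dots> \<le> Max (range ?f)" by (rule Max_ge) auto
  finally show ?thesis by (simp add: rate_def)
qed

lemma rate_nonneg: "0 \<le> rate P D_mat \<omega>"
proof -
  fix k :: 'p
  have "0 \<le> R_const P D_mat \<omega> k * entry_bound \<omega> k"
  \<comment> \<open>Without singular values the sign of \<open>entry_bound\<close> is unknown, but
    the factor \<open>R_const\<close> is then an empty sum.\<close>
  proof (cases "nbhd P \<omega> k = {}")
    case True
    then show ?thesis by (simp add: R_const_def)
  qed (simp add: R_const_nonneg entry_bound_nonneg)
  then show ?thesis using rate_term order_trans by blast
qed

lemma aggregation_row:
  "(aggregation P ** M) $ c = (\<Sum>k | involved P k c. (1 / real (cdegree P c)) *\<^sub>R M $ (k, c))"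
proof -
  have "(aggregation P ** M) $ c $ j = (\<Sum>k | involved P k c. (1 / real (cdegree P c)) * M $ (k, c) $ j)" for j
  proof -
    have "(aggregation P ** M) $ c $ j = (\<Sum>r\<in>UNIV. aggregation P $ c $ r * M $ r $ j)"
      by (simp add: matrix_matrix_mult_def)
    also have "\<dots> = (\<Sum>r\<in>(\<lambda>k. (k, c)) ` {k. involved P k c}. aggregation P $ c $ r * M $ r $ j)"
      by (rule sum.mono_neutral_right) (auto simp: aggregation_def nbhd_0)
    also have "\<dots> = (\<Sum>k | involved P k c. aggregation P $ c $ (k, c) * M $ (k, c) $ j)"
      by (subst sum.reindex) (auto simp: inj_on_def)
    also have "\<dots> = (\<Sum>k | involved P k c. (1 / real (cdegree P c)) * M $ (k, c) $ j)"
      by (intro sum.cong) (auto simp: aggregation_def nbhd_0)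
    finally show ?thesis .
  qed
  then show ?thesis by (simp add: vec_eq_iff)
qed

text \<open>Every involved block reproduces row \<open>c\<close> of \<open>ystar\<close>, so the
  error row is an average over the involved subproblems of rows of \<open>S_block\<close> times the
  old error; an average of bounds by \<open>rate\<close> is again bounded by
  \<open>rate\<close>.\<close>

lemma iteration_step:
  assumes sol: "D_mat ** ystar = coupling_rhs P x m d \<theta>"
    and y': "y' = aggregation P ** (S_stack P D_mat \<omega> ** y + U_stack P D_mat \<omega> ** coupling_rhs P x m d \<theta>)"
  shows "norm_inf (y' - ystar) \<le> rate P D_mat \<omega> * norm_inf (y - ystar)"
proof (rule norm_inf_le)
  fix c
  let ?q = "coupling_rhs P x m d \<theta>" and ?K = "{k. involved P k c}"
  have row: "y' $ c = (\<Sum>k\<in>?K. (1 / real (cdegree P c)) *\<^sub>R (S_block P D_mat \<omega> k ** y + U_block P D_mat \<omega> k ** ?q) $ c)"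
    unfolding y' aggregation_row
    by (intro sum.cong) (simp_all add: vec_eq_iff matrix_matrix_mult_def S_stack_def U_stack_def)
  show "(\<Sum>j\<in>UNIV. \<bar>(y' - ystar) $ c $ j\<bar>) \<le> rate P D_mat \<omega> * norm_inf (y - ystar)"
  proof (cases "?K = {}")
    case True
    then have "y' $ c = 0" by (simp add: row)
    moreover have "ystar $ c $ j = 0" for j
      by (rule isolated_constraint_solution[OF _ sol]) (use True in auto)
    ultimately show ?thesis by (simp add: rate_nonneg norm_inf_nonneg)
  next
    case False
    define n where "n = real (card ?K)"
    have n: "n > 0" using False by (simp add: n_def card_gt_0_iff)
    have deg: "real (cdegree P c) = n" by (simp add: cdegree_def n_def)
    define E where "E = y - ystar"
    have err: "(S_block P D_mat \<omega> k ** y + U_block P D_mat \<omega> k ** ?q) $ c = ystar $ c + (S_block P D_mat \<omega> k ** E) $ c"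
      if "k \<in> ?K" for k
    proof -
      have "(S_block P D_mat \<omega> k ** ystar + U_block P D_mat \<omega> k ** ?q) $ c = ystar $ c"
        using that by (intro block_fixed_point sol) (simp add: nbhd_0)
      then show ?thesis by (simp add: E_def matrix_diff_ldistrib algebra_simps)
    qed
    have "y' $ c = (\<Sum>k\<in>?K. (1 / n) *\<^sub>R (ystar $ c + (S_block P D_mat \<omega> k ** E) $ c))"
      unfolding row deg by (intro sum.cong refl) (simp only: err)
    \<comment> \<open>The weights \<open>1 / n\<close> over the \<open>n\<close> involved
      subproblems sum to one, so the exact row comes out unchanged.\<close>
    also have "\<dots> = ystar $ c + (\<Sum>k\<in>?K. (1 / n) *\<^sub>R (S_block P D_mat \<omega> k ** E) $ c)"
      using n by (auto simp: scaleR_add_right sum.distrib n_def sum_constant_scaleR simp del: sum_constant)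
    finally have "(y' - ystar) $ c $ j = (\<Sum>k\<in>?K. (1 / n) * (S_block P D_mat \<omega> k ** E) $ c $ j)" for j
      by simp
    then have "(\<Sum>j\<in>UNIV. \<bar>(y' - ystar) $ c $ j\<bar>) \<le>
        (\<Sum>j\<in>UNIV. \<Sum>k\<in>?K. (1 / n) * \<bar>(S_block P D_mat \<omega> k ** E) $ c $ j\<bar>)"
      using n by (intro sum_mono) (simp add: order.trans[OF sum_abs] abs_mult)
    also have "\<dots> = (\<Sum>k\<in>?K. (1 / n) * (\<Sum>j\<in>UNIV. \<bar>(S_block P D_mat \<omega> k ** E) $ c $ j\<bar>))"
      by (subst sum.swap) (simp add: sum_distrib_left)
    also have "\<dots> \<le> (\<Sum>k\<in>?K. (1 / n) * (rate P D_mat \<omega> * norm_inf E))"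
    proof (intro sum_mono mult_left_mono)
      fix k assume "k \<in> ?K"
      then have "(\<Sum>l\<in>UNIV. \<bar>S_block P D_mat \<omega> k $ c $ l\<bar>) \<le> rate P D_mat \<omega>"
        using S_block_row_sum[of c k \<omega>] rate_term[of \<omega> k] by (simp add: nbhd_0)
      then show "(\<Sum>j\<in>UNIV. \<bar>(S_block P D_mat \<omega> k ** E) $ c $ j\<bar>) \<le> rate P D_mat \<omega> * norm_inf E"
        by (rule order_trans[OF norm_inf_row_mult mult_right_mono[OF _ norm_inf_nonneg]])
    qed (use n in simp)
    also have "\<dots> = rate P D_mat \<omega> * norm_inf (y - ystar)"
      using n by (auto simp: n_def E_def)
    finally show ?thesis .
  qed
qed

end

theorem theorem2:
  fixes P :: "('p::finite, 'x::finite, 'l::finite, 'c::finite, 'q::finite) sep_problem"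
    and x :: "real ^ 'x" and m :: "real ^ 'l" and d :: "real ^ 'c" and \<theta>0 :: "real ^ 'q"
    and D :: "real ^ 'c ^ 'c" and q :: "real ^ 'q ^ 'c"
    and \<omega> :: nat and ystar :: "real ^ 'q ^ 'c" and y :: "nat \<Rightarrow> real ^ 'q ^ 'c"
  assumes separable: "separable P"
    and strict_convexity: "strictly_convex_problem P \<theta>0"
    and optimal: "optimal P \<theta>0 x"
    and A1: "C2_problem P x \<theta>0"
    and A2: "KKT P \<theta>0 x m d"
    and A4: "LICQ P \<theta>0 x"
    and A5: "strict_complementarity P \<theta>0 x m d"
    and local_Jacobians_defined: "\<And>i. invertible_on (zidx P i) (local_G_z P i x m d \<theta>0)"
    and D: "D = coupling_matrix P x m d \<theta>0"
    and q: "q = coupling_rhs P x m d \<theta>0"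
    and ystar: "D ** ystar = q"
    and iteration: "\<And>t. y (Suc t) = aggregation P ** (S_stack P D \<omega> ** y t + U_stack P D \<omega> ** q)"
  shows "\<forall>t. norm_inf (y t - ystar) \<le> rate P D \<omega> ^ t * norm_inf (y 0 - ystar)"
proof
  interpret kkt_point P x m d \<theta>0
    using separable strict_convexity A1 A2 A4 A5 local_Jacobians_defined by unfold_locales
  fix t
  show "norm_inf (y t - ystar) \<le> rate P D \<omega> ^ t * norm_inf (y 0 - ystar)"
  proof (induction t)
    case (Suc t)
    have "norm_inf (y (Suc t) - ystar) \<le> rate P D \<omega> * norm_inf (y t - ystar)"
      using iteration_step[OF ystar[unfolded D q] iteration[unfolded D q]] by (simp add: D)
    also have "\<dots> \<le> rate P D \<omega> * (rate P D \<omega> ^ t * norm_inf (y 0 - ystar))"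
      using Suc rate_nonneg by (intro mult_left_mono) (auto simp: D)
    finally show ?case by (simp add: mult.assoc)
  qed simp
qed

end
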